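(* Let $n\ge 2$, let $G$ be an open set in $\mathbb{R}^n$, and let $1\le q<\infty$, $\delta\in(0,1)$ and a constant $C>0$ be given. Then the following three conditions (with the same constant $C$) are equivalent. (A) The fractional inequality $$\bigg(\int_G |u(x)|^{q}\,dx\bigg)^{1/q}\le C\int_G\int_G \frac{|u(x)-u(y)|}{|x-y|^{n+\delta}}\,dy\,dx$$ holds for all measurable functions $u:G\to\mathbb{R}$ with compact support in $G$. (B) The fractional isocapacitary inequality $$|K|^{1/q}\le C\,\mathrm{cap}_{\delta,1}(K,G)$$ holds for every compact set $K$ in $G$. (C) The fractional isoperimetric inequality $$|D|^{1/q}\le 2C\,P_\delta(D,G)$$ holds for every open set $D\subset\subset G$ whose boundary $\partial D$ is an $(n-1)$-dimensional $C^\infty$-manifold in $G$.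
   Context: $|A|$ denotes the Lebesgue $n$-measure of a measurable set $A\subset\mathbb{R}^n$. $D\subset\subset G$ means that the closure $\overline{D}$ is a compact subset of $G$. Double integrals of non-negative functions may take the value $+\infty$. $C_0(G)$ is the family of all continuous functions $u:G\to\mathbb{R}$ with compact support in $G$. For a compact set $K\subset G$, the fractional $(\delta,1)$-capacity is $$\mathrm{cap}_{\delta,1}(K,G)=\inf_u \int_G\int_G\frac{|u(x)-u(y)|}{|x-y|^{n+\delta}}\,dy\,dx,$$ where the infimum is taken over all $u\in C_0(G)$ such that $u(x)\ge 1$ for each $x\in K$. For a measurable set $A\subset G$, the fractional $\delta$-perimeter of $A$ with respect to $G$ is $$P_\delta(A,G)=\int_A\int_{G\setminus A}\frac{1}{|x-y|^{n+\delta}}\,dy\,dx\in[0,\infty].$$ A closed set $\Gamma\subset G$ is an $(n-1)$-dimensional $C^\infty$-manifold in $G$ if for each point $x\in\Gamma$ there exist open sets $U\subset\mathbb{R}^{n-1}$ and $V\subset\mathbb{R}$, a smooth function $g:U\to V$, and a rotation $\psi$ of $\mathbb{R}^n$ about the point $x$, such that $x=\psi(x)\in\psi(U\times V)$ and $\Gamma\cap\psi(U\times V)=\{\psi(y,g(y)) : y\in U\}$. *)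

theory Defs
  imports "HOL-Analysis.Analysis"
begin

text \<open>
  Functions \<open>u : G \<rightarrow> \<real>\<close> are total functions whose values outside \<open>G\<close> are never
  inspected: every integral, support and regularity condition below is restricted to \<open>G\<close>.
  All possibly infinite quantities are \<open>ennreal\<close>-valued.
\<close>

text \<open>Intended for \<open>p > 0\<close>, where \<open>\<infinity>\<close> raised to the power \<open>p\<close> is \<open>\<infinity>\<close>.\<close>

definition ennreal_powr :: "ennreal \<Rightarrow> real \<Rightarrow> ennreal" where
  "ennreal_powr x p = (if x = \<infinity> then \<infinity> else ennreal (enn2real x powr p))"

text \<open>
  If the closure of \<open>{x \<in> G. u x \<noteq> 0}\<close> relative to \<open>G\<close> is compact, it coincides with the
  closure in the whole space; hence the closure below is taken in the whole space.
\<close>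

definition compact_support_in :: "('a::euclidean_space) set \<Rightarrow> ('a \<Rightarrow> real) \<Rightarrow> bool" where
  "compact_support_in G u \<longleftrightarrow>
     compact (closure {x \<in> G. u x \<noteq> 0}) \<and> closure {x \<in> G. u x \<noteq> 0} \<subseteq> G"

definition C0 :: "('a::euclidean_space) set \<Rightarrow> ('a \<Rightarrow> real) set" where
  "C0 G = {u. continuous_on G u \<and> compact_support_in G u}"

text \<open>On the diagonal the integrand is \<open>0 / 0 = 0\<close>; the diagonal is a null set.\<close>

definition frac_energy :: "real \<Rightarrow> (real ^ 'n) set \<Rightarrow> (real ^ 'n \<Rightarrow> real) \<Rightarrow> ennreal" where
  "frac_energy \<delta> G u =
     (\<integral>\<^sup>+x\<in>G. (\<integral>\<^sup>+y\<in>G. ennreal (\<bar>u x - u y\<bar> / norm (x - y) powr (real CARD('n) + \<delta>))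
        \<partial>lebesgue) \<partial>lebesgue)"

definition frac_cap :: "real \<Rightarrow> (real ^ 'n) set \<Rightarrow> (real ^ 'n) set \<Rightarrow> ennreal" where
  "frac_cap \<delta> K G = (INF u\<in>{u \<in> C0 G. \<forall>x\<in>K. u x \<ge> 1}. frac_energy \<delta> G u)"

definition frac_perimeter :: "real \<Rightarrow> (real ^ 'n) set \<Rightarrow> (real ^ 'n) set \<Rightarrow> ennreal" where
  "frac_perimeter \<delta> A G =
     (\<integral>\<^sup>+x\<in>A. (\<integral>\<^sup>+y\<in>G - A. ennreal (1 / norm (x - y) powr (real CARD('n) + \<delta>))
        \<partial>lebesgue) \<partial>lebesgue)"

primrec higher_differentiable_on ::
  "nat \<Rightarrow> ('a::real_normed_vector \<Rightarrow> 'b::real_normed_vector) \<Rightarrow> 'a set \<Rightarrow> bool" where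
  "higher_differentiable_on 0 f U \<longleftrightarrow> continuous_on U f"
| "higher_differentiable_on (Suc k) f U \<longleftrightarrow>
     (\<forall>x\<in>U. f differentiable (at x)) \<and>
     (\<forall>v. higher_differentiable_on k (\<lambda>x. frechet_derivative f (at x) v) U)"

text \<open>Used for open \<open>U\<close> only.\<close>

definition smooth_on :: "'a set \<Rightarrow> ('a::real_normed_vector \<Rightarrow> 'b::real_normed_vector) \<Rightarrow> bool" where
  "smooth_on U f \<longleftrightarrow> (\<forall>k. higher_differentiable_on k f U)"

definition rotation_about :: "real ^ 'n \<Rightarrow> (real ^ 'n \<Rightarrow> real ^ 'n) \<Rightarrow> bool" where
  "rotation_about x \<psi> \<longleftrightarrow> (\<exists>Q. rotation_matrix Q \<and> (\<forall>z. \<psi> z = x + Q *v (z - x)))"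

text \<open>
  The splitting of n-space into (n-1)-space and a line is rendered by indexing coordinates with
  \<open>'m option\<close>, so that \<open>n = CARD('m) + 1\<close>: the coordinates \<open>Some i\<close> are those of the first
  factor and \<open>None\<close> is the last coordinate. As \<open>'m\<close> is nonempty, \<open>n \<ge> 2\<close>, and every such
  \<open>n\<close> arises.
\<close>

definition join_coords :: "real ^ 'm \<Rightarrow> real \<Rightarrow> real ^ ('m::finite option)" where
  "join_coords y t = (\<chi> i. case i of None \<Rightarrow> t | Some j \<Rightarrow> y $ j)"

definition smooth_hypersurface_in ::
  "(real ^ ('m::finite option)) set \<Rightarrow> (real ^ ('m option)) set \<Rightarrow> bool" where
  "smooth_hypersurface_in \<Gamma> G \<longleftrightarrow>
     closedin (top_of_set G) \<Gamma> \<and>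
     (\<forall>x\<in>\<Gamma>. \<exists>(U :: (real ^ 'm) set) (V :: real set) g \<psi>.
        open U \<and> open V \<and> smooth_on U g \<and> g ` U \<subseteq> V \<and> rotation_about x \<psi> \<and>
        x = \<psi> x \<and> x \<in> \<psi> ` {join_coords y t | y t. y \<in> U \<and> t \<in> V} \<and>
        \<Gamma> \<inter> \<psi> ` {join_coords y t | y t. y \<in> U \<and> t \<in> V} = {\<psi> (join_coords y (g y)) | y. y \<in> U})"

end

theory Submission
  imports Defs
begin

text \<open>
  (A) to (B) is testing. For (B) to (C), convolving the indicator of \<open>D\<close> with a mollifier gives
  admissible functions for compact subsets of \<open>D\<close> whose energy tends to twice the perimeter:
  translations do not increase the energy over points well inside \<open>G\<close>, and the interaction of the
  support with a thin boundary layer of \<open>G\<close> tends to zero.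

  For (C) to (A), the coarea formula and Minkowski's inequality reduce the claim to superlevel sets
  with smooth boundary. After truncating and mollifying, the function \<open>w\<close> is smooth. Sard's theorem is avoided
  by perturbing \<open>w\<close> to \<open>w + a \<bullet> x\<close>: the pairs \<open>(a, t)\<close> for which \<open>t\<close> is a critical
  value lie in the image of \<open>x \<mapsto> (- \<nabla>w x, w x - \<nabla>w x \<bullet> x)\<close>, a null set because this
  map raises the dimension. All limits are taken with Fatou's lemma; finite energy itself yields
  the \<open>L\<^sup>1\<close> convergence of the mollified functions.
\<close>

section \<open>Smooth functions\<close>

text \<open>The constant \<open>C\<close> must survive unchanged, so every step is either free of
  loss or carries an error that tends to zero. The \<open>2\<close> in (C) comes from the symmetry
  of the energy: the energy of an indicator counts each pair of points across the boundary twice.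
  \<open>G\<close> is an arbitrary open set, which causes two difficulties. Translating a point near
  the boundary may leave \<open>G\<close>, so mollification controls the energy only over points
  farther from the complement than the mollification radius. And a linear function lacks compact
  support and may have infinite energy over \<open>G\<close>, so \<open>a \<bullet> x\<close> is
  replaced by \<open>a \<bullet> \<Psi> x\<close>, with \<open>\<Psi>\<close> compactly supported
  and equal to the identity near the support of \<open>w\<close>; subtracting the bound
  \<open>norm a * (2 * R)\<close> and taking the positive part keeps the support inside that of
  \<open>w\<close>. Write \<open>s = n + \<delta>\<close> for the exponent of the kernel. From
  \<open>s > n\<close> come integrability away from the diagonal and the rate \<epsilon> to the
  power \<open>s - n\<close> for mollification in L1; from \<open>s < n + 1\<close> comes the finite
  energy of \<open>\<Psi>\<close>.\<close>

lemma higher_differentiable_on_cong: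
  assumes "open U" "\<And>x. x \<in> U \<Longrightarrow> f x = g x" "higher_differentiable_on k f U"
  shows "higher_differentiable_on k g U"
  using assms(2,3)
proof (induction k arbitrary: f g)
  case 0
  then show ?case by (auto cong: continuous_on_cong)
next
  case (Suc k)
  have D: "(g has_derivative frechet_derivative f (at x)) (at x)" if "x \<in> U" for x
    by (rule has_derivative_transform_within_open[OF _ assms(1) that, of f])
       (use Suc.prems that in \<open>auto simp: frechet_derivative_works[symmetric]\<close>)
  then have eq: "frechet_derivative g (at x) = frechet_derivative f (at x)" if "x \<in> U" for x
    using that by (metis frechet_derivative_at)
  have "higher_differentiable_on k (\<lambda>x. frechet_derivative g (at x) v) U" for v
    by (rule Suc.IH[of "\<lambda>x. frechet_derivative f (at x) v"]) (use Suc.prems eq in auto)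
  then show ?case
    using D by (auto simp: differentiable_def)
qed

text \<open>Frees later proofs from \<open>frechet_derivative\<close>: since derivatives are unique,
  any explicitly known family of them serves.\<close>

lemma higher_differentiable_on_SucI:
  assumes "open U" "\<And>x. x \<in> U \<Longrightarrow> (f has_derivative f' x) (at x)"
    "\<And>v. higher_differentiable_on k (\<lambda>x. f' x v) U"
  shows "higher_differentiable_on (Suc k) f U"
proof -
  have "frechet_derivative f (at x) = f' x" if "x \<in> U" for x
    using assms(2)[OF that] by (metis frechet_derivative_at)
  then show ?thesis
    using assms by (auto simp: differentiable_def intro: higher_differentiable_on_cong)
qed

text \<open>The recursion passes to directional derivatives, so dropping one order is an induction
  whose base is that differentiability implies continuity.\<close>

lemma higher_differentiable_on_SucD:
  assumes "higher_differentiable_on (Suc k) f U"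
  shows "higher_differentiable_on k f U"
  using assms
proof (induction k arbitrary: f)
  case 0
  then show ?case
    by (auto intro!: continuous_at_imp_continuous_on differentiable_imp_continuous_within)
next
  case (Suc k)
  then show ?case by fastforce
qed

lemma higher_differentiable_on_has_derivative:
  assumes "higher_differentiable_on (Suc k) f U" "x \<in> U"
  shows "(f has_derivative frechet_derivative f (at x)) (at x)"
  using assms by (auto simp: frechet_derivative_works[symmetric])

lemma higher_differentiable_on_const:
  "open U \<Longrightarrow> higher_differentiable_on k (\<lambda>_. c) U"
proof (induction k arbitrary: c)
  case (Suc k)
  show ?case
    by (rule higher_differentiable_on_SucI[where f'="\<lambda>_ _. 0"])
       (use Suc in \<open>auto intro!: derivative_eq_intros\<close>)
qed auto

lemma higher_differentiable_on_add:
  assumes "open U" "higher_differentiable_on k f U" "higher_differentiable_on k g U"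
  shows "higher_differentiable_on k (\<lambda>x. f x + g x) U"
  using assms(2,3)
proof (induction k arbitrary: f g)
  case (Suc k)
  show ?case
    by (rule higher_differentiable_on_SucI[OF assms(1) has_derivative_add[OF
        higher_differentiable_on_has_derivative[OF Suc.prems(1)]
        higher_differentiable_on_has_derivative[OF Suc.prems(2)]]])
       (use Suc in auto)
qed (simp add: continuous_on_add)

lemma higher_differentiable_on_mult:
  fixes f g :: "'a::real_normed_vector \<Rightarrow> real"
  assumes "open U" "higher_differentiable_on k f U" "higher_differentiable_on k g U"
  shows "higher_differentiable_on k (\<lambda>x. f x * g x) U"
  using assms(2,3)
proof (induction k arbitrary: f g)
  case (Suc k)
  \<comment> \<open>The product rule leaves one factor undifferentiated, so both factors are also
    needed at the lower order \<open>k\<close>.\<close>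
  show ?case
    by (rule higher_differentiable_on_SucI[OF assms(1) has_derivative_mult[OF
        higher_differentiable_on_has_derivative[OF Suc.prems(1)]
        higher_differentiable_on_has_derivative[OF Suc.prems(2)]]])
       (use Suc Suc.prems[THEN higher_differentiable_on_SucD]
        in \<open>auto intro!: higher_differentiable_on_add assms(1)\<close>)
qed (simp add: continuous_on_mult)

lemma smooth_on_const: "open U \<Longrightarrow> smooth_on U (\<lambda>_. c)"
  by (simp add: smooth_on_def higher_differentiable_on_const)

lemma smooth_on_add: "open U \<Longrightarrow> smooth_on U f \<Longrightarrow> smooth_on U g \<Longrightarrow> smooth_on U (\<lambda>x. f x + g x)"
  by (simp add: smooth_on_def higher_differentiable_on_add)

lemma smooth_on_mult:
  fixes f g :: "'a::real_normed_vector \<Rightarrow> real"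
  shows "open U \<Longrightarrow> smooth_on U f \<Longrightarrow> smooth_on U g \<Longrightarrow> smooth_on U (\<lambda>x. f x * g x)"
  by (simp add: smooth_on_def higher_differentiable_on_mult)

lemma smooth_on_minus:
  fixes f :: "'a::real_normed_vector \<Rightarrow> real"
  shows "open U \<Longrightarrow> smooth_on U f \<Longrightarrow> smooth_on U (\<lambda>x. - f x)"
  using smooth_on_mult[OF _ smooth_on_const, of U f "-1"] by simp

lemma smooth_on_has_derivative:
  "smooth_on U f \<Longrightarrow> x \<in> U \<Longrightarrow> (f has_derivative frechet_derivative f (at x)) (at x)"
  unfolding smooth_on_def using higher_differentiable_on_has_derivative by blast

lemma smooth_on_frechet_derivative:
  "smooth_on U f \<Longrightarrow> smooth_on U (\<lambda>x. frechet_derivative f (at x) v)"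
  unfolding smooth_on_def using higher_differentiable_on.simps(2) by blast

lemma smooth_on_continuous: "smooth_on U f \<Longrightarrow> continuous_on U f"
  unfolding smooth_on_def using higher_differentiable_on.simps(1) by blast

lemma smooth_on_bounded_linear:
  assumes "open U" "bounded_linear f"
  shows "smooth_on U f"
  unfolding smooth_on_def
proof
  fix k show "higher_differentiable_on k f U"
  proof (cases k)
    case 0
    then show ?thesis using assms by (simp add: linear_continuous_on)
  next
    case (Suc j)
    show ?thesis unfolding Suc
      by (rule higher_differentiable_on_SucI[where f'="\<lambda>_. f"])
         (use assms in \<open>auto intro: bounded_linear_imp_has_derivative higher_differentiable_on_const\<close>)
  qed
qed

text \<open>The powers in the denominator make the family closed under differentiation.\<close>

definition flat_exp :: "nat \<Rightarrow> real \<Rightarrow> real" where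
  "flat_exp k t = (if t > 0 then exp (- 1 / t) / t ^ k else 0)"

lemma flat_exp_has_real_derivative:
  "(flat_exp k has_real_derivative flat_exp (k + 2) t - of_nat k * flat_exp (k + 1) t) (at t)"
proof -
  consider "t > 0" | "t < 0" | "t = 0" by linarith
  then show ?thesis
  proof cases
    case 1
    have "((\<lambda>t. exp (- 1 / t) / t ^ k) has_real_derivative
        flat_exp (k + 2) t - of_nat k * flat_exp (k + 1) t) (at t)"
      using 1
      by (cases k) (auto intro!: derivative_eq_intros simp: flat_exp_def field_simps power2_eq_square,
          metis One_nat_def power_eq_if)
    then show ?thesis
      by (rule has_field_derivative_transform_within_open[where S="{0<..}"])
         (use 1 in \<open>auto simp: flat_exp_def\<close>)
  next
    case 2
    have "((\<lambda>t. 0) has_real_derivative 0) (at t)" by simp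
    then have "(flat_exp k has_real_derivative 0) (at t)"
      by (rule has_field_derivative_transform_within_open[where S="{..<0}"])
         (use 2 in \<open>auto simp: flat_exp_def\<close>)
    then show ?thesis using 2 by (simp add: flat_exp_def)
  next
    case 3
    \<comment> \<open>In the variable \<open>inverse h\<close> the right difference quotient at 0 is
      a power divided by an exponential.\<close>
    have "((\<lambda>h. (inverse h) ^ (k + 1) / exp (inverse h)) \<longlongrightarrow> 0) (at_right (0::real))"
      by (rule filterlim_compose[OF tendsto_power_div_exp_0 filterlim_inverse_at_top_right])
    then have R: "((\<lambda>h. flat_exp k h / h) \<longlongrightarrow> 0) (at_right 0)"
      by (rule Lim_transform_eventually)
         (auto simp: eventually_at_filter flat_exp_def field_simps exp_minus)
    have "((\<lambda>h. flat_exp k h / h) \<longlongrightarrow> 0) (at_left 0)"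
      by (rule Lim_transform_eventually[OF tendsto_const])
         (auto simp: eventually_at_filter flat_exp_def)
    with R have "((\<lambda>h. flat_exp k h / h) \<longlongrightarrow> 0) (at 0)"
      by (simp add: filterlim_at_split)
    then show ?thesis using 3
      by (simp add: DERIV_def flat_exp_def)
  qed
qed

text \<open>Differentiation produces factors \<open>v \<bullet> x\<close> and raises the index of
  \<open>flat_exp\<close>, so the induction runs over all products of a smooth \<open>P\<close> with
  some \<open>flat_exp k\<close>. The argument \<open>x \<bullet> x\<close> avoids the norm, which
  is not smooth at the origin.\<close>

lemma smooth_on_bump: "smooth_on UNIV (\<lambda>x::'a::real_inner. flat_exp 0 (1 - r * (x \<bullet> x)))"
proof -
  have "higher_differentiable_on m (\<lambda>x. P x * flat_exp k (1 - r * (x \<bullet> x))) UNIV"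
    if "smooth_on UNIV P" for m k and P :: "'a \<Rightarrow> real"
    using that
  proof (induction m arbitrary: k P)
    case 0
    have "continuous_on UNIV (flat_exp k)"
      using flat_exp_has_real_derivative
      by (metis DERIV_isCont continuous_at_imp_continuous_on)
    then have "continuous_on UNIV (\<lambda>x::'a. flat_exp k (1 - r * (x \<bullet> x)))"
      by (rule continuous_on_compose2) (auto intro!: continuous_on_diff continuous_on_mult continuous_on_inner continuous_on_const continuous_on_id)
    then show ?case
      using continuous_on_mult[OF smooth_on_continuous[OF 0]] by simp
  next
    case (Suc m)
    let ?E = "\<lambda>j x::'a. flat_exp j (1 - r * (x \<bullet> x))"
    have d: "((\<lambda>x. P x * ?E k x) has_derivative
        (\<lambda>v. frechet_derivative P (at x) v * ?E k x + P x * (-2 * r * (v \<bullet> x)) * ?E (k + 2) x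
           + P x * (2 * r * of_nat k * (v \<bullet> x)) * ?E (k + 1) x)) (at x)" for x
    proof -
      have E: "(?E k has_derivative (\<lambda>v. - r * (2 * (v \<bullet> x)) * (?E (k + 2) x - of_nat k * ?E (k + 1) x))) (at x)"
by (rule has_derivative_compose[OF _ flat_exp_has_real_derivative[unfolded has_field_derivative_def], THEN has_derivative_eq_rhs])
           (auto intro!: derivative_eq_intros simp: inner_commute algebra_simps)
      show ?thesis
        by (rule has_derivative_eq_rhs[OF has_derivative_mult[OF
              smooth_on_has_derivative[OF Suc.prems UNIV_I] E]])
           (auto simp: fun_eq_iff algebra_simps)
    qed
    have lin: "smooth_on UNIV (\<lambda>x::'a. c * (v \<bullet> x))" for c v
      by (intro smooth_on_mult smooth_on_const smooth_on_bounded_linear bounded_linear_inner_right) auto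
    show ?case
    proof (rule higher_differentiable_on_SucI[OF open_UNIV d])
      fix v
      have P: "smooth_on UNIV (\<lambda>x. frechet_derivative P (at x) v)"
        "smooth_on UNIV (\<lambda>x. P x * (-2 * r * (v \<bullet> x)))"
        "smooth_on UNIV (\<lambda>x. P x * (2 * r * of_nat k * (v \<bullet> x)))"
        by (simp_all add: smooth_on_frechet_derivative smooth_on_mult smooth_on_minus lin Suc.prems)
      show "higher_differentiable_on m (\<lambda>x. frechet_derivative P (at x) v * ?E k x
          + P x * (-2 * r * (v \<bullet> x)) * ?E (k + 2) x
          + P x * (2 * r * of_nat k * (v \<bullet> x)) * ?E (k + 1) x) UNIV"
        by (intro higher_differentiable_on_add open_UNIV Suc.IH[OF P(1)] Suc.IH[OF P(2)] Suc.IH[OF P(3)])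
    qed
  qed
  from this[OF smooth_on_const[OF open_UNIV, of 1]] show ?thesis
    by (auto simp: smooth_on_def)
qed

section \<open>Smooth superlevel sets\<close>

text \<open>The quotient rule for a function over the \<open>j\<close>-th power of \<open>Q\<close>,
  brought to the denominator \<open>Q ^ (j + 2)\<close>. Here \<open>u + a / Q * w\<close> and
  \<open>s + a / Q * r\<close> stand for the derivatives of numerator and base along a graph of
  slope \<open>a / Q\<close>. The case \<open>j = 0\<close> is separate because \<open>j - 1\<close>
  truncates.\<close>

lemma quotient_power_identity:
  fixes Q :: real
  assumes "Q \<noteq> 0"
  shows "- f * (inverse (Q ^ j) * (real j * (s + a / Q * r) * Q ^ (j - 1)) * inverse (Q ^ j))
      + (u + a / Q * w) / Q ^ j
    = ((u * Q + a * w) * Q + (- real j) * f * (s * Q + a * r)) / Q ^ (j + 2)"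
proof (cases j)
  case (Suc i)
  show ?thesis unfolding Suc using assms by (simp add: field_simps)
qed (use assms in \<open>simp add: field_simps power2_eq_square\<close>)

text \<open>Near the base point \<open>h\<close> increases strictly along every line parallel to
  \<open>e\<close>, so each such line meets the level \<open>t\<close> exactly once and the larger
  values lie on one side. The affine chart \<open>p\<close> will be a rotated copy of the coordinate
  splitting.\<close>

lemma smooth_implicit_graph:
  fixes h :: "'b::real_normed_vector \<Rightarrow> real" and A :: "'a::euclidean_space \<Rightarrow> 'b"
  assumes h: "smooth_on UNIV h" and A: "bounded_linear A"
    and p_def: "\<And>y s. p y s = c + A y + s *\<^sub>R e"
    and W: "open W" "p y0 s0 \<in> W" and eq: "h (p y0 s0) = t"
    and pos: "frechet_derivative h (at (p y0 s0)) e > 0"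
  obtains U V g where "open U" "open V" "y0 \<in> U" "s0 \<in> V" "smooth_on U g" "g ` U \<subseteq> V"
    "\<And>y s. y \<in> U \<Longrightarrow> s \<in> V \<Longrightarrow> p y s \<in> W"
    "\<And>y s. y \<in> U \<Longrightarrow> s \<in> V \<Longrightarrow> h (p y s) = t \<longleftrightarrow> s = g y"
    "\<And>y s. y \<in> U \<Longrightarrow> s \<in> V \<Longrightarrow> h (p y s) > t \<longleftrightarrow> s > g y"
proof -
  interpret A: bounded_linear A by (rule A)
  define q where "q z = frechet_derivative h (at z) e" for z
  have q: "smooth_on UNIV q" unfolding q_def by (rule smooth_on_frechet_derivative[OF h])
  have dh: "(h has_derivative frechet_derivative h (at z)) (at z)" for z
    by (rule smooth_on_has_derivative[OF h UNIV_I])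
  have lin: "linear (frechet_derivative h (at z))" for z
    using dh by (rule has_derivative_linear)
  have dpp: "((\<lambda>z. p (fst z) (snd z)) has_derivative (\<lambda>w. A (fst w) + snd w *\<^sub>R e)) (at z)" for z
    unfolding p_def by (auto intro!: derivative_eq_intros A.has_derivative)
  have contp: "continuous_on UNIV (\<lambda>z. p (fst z) (snd z))"
    using dpp by (meson continuous_at_imp_continuous_on has_derivative_continuous)
  have conth: "continuous_on UNIV (\<lambda>z. h (p (fst z) (snd z)))"
    by (rule continuous_on_compose2[OF smooth_on_continuous[OF h] contp]) auto
  have contq: "continuous_on UNIV (\<lambda>z. q (p (fst z) (snd z)))"
    by (rule continuous_on_compose2[OF smooth_on_continuous[OF q] contp]) auto
  define N where "N = (\<lambda>z. p (fst z) (snd z)) -` W \<inter> {z. q (p (fst z) (snd z)) > 0}"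
  have "open N" unfolding N_def
    by (intro open_Int open_vimage open_Collect_less contq W contp continuous_on_const)
  moreover have "(y0, s0) \<in> N" using W pos by (simp add: N_def q_def)
  ultimately obtain A0 B0 where AB: "open A0" "open B0" "y0 \<in> A0" "s0 \<in> B0" "A0 \<times> B0 \<subseteq> N"
    by (auto elim!: open_prod_elim)
  obtain r where r: "r > 0" "cball s0 r \<subseteq> B0" using AB(2,4) open_contains_cball by blast
  have N: "p y s \<in> W" "q (p y s) > 0" if "y \<in> A0" "s0 - r \<le> s" "s \<le> s0 + r" for y s
  proof -
    have "s \<in> B0" using r(2) that by (auto simp: cball_def dist_real_def abs_le_iff)
    then show "p y s \<in> W" "q (p y s) > 0" using AB(5) that by (auto simp: N_def)
  qed
  have dps: "(p y has_derivative (\<lambda>w. w *\<^sub>R e)) (at s)" for y s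
    unfolding p_def by (auto intro!: derivative_eq_intros)
  have dhs: "((\<lambda>s. h (p y s)) has_real_derivative q (p y s)) (at s)" for y s
    using has_derivative_compose[OF dps dh, of y s]
    by (simp add: has_field_derivative_def q_def linear_cmul[OF lin] mult_commute_abs)
  have mono: "h (p y s) < h (p y s')"
    if "y \<in> A0" "s0 - r \<le> s" "s < s'" "s' \<le> s0 + r" for y s s'
    by (rule DERIV_pos_imp_increasing[OF that(3)])
       (use that dhs N in \<open>meson order.trans\<close>)
  define V where "V = {s0 - r <..< s0 + r}"
  \<comment> \<open>The signs of \<open>h - t\<close> at the two ends of the segment are open
    conditions on \<open>y\<close>, and they put the root given by the intermediate value theorem
    strictly inside \<open>V\<close>.\<close>
  define U where "U = A0 \<inter> ({y. h (p y (s0 + r)) > t} \<inter> {y. h (p y (s0 - r)) < t})"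
  have cont1: "continuous_on UNIV (\<lambda>y. h (p y s))" for s
    by (rule continuous_on_compose2[OF conth, of UNIV "\<lambda>y. (y, s)", simplified])
       (auto intro!: continuous_intros)
  have cont2: "continuous_on UNIV (\<lambda>s. h (p y s))" for y
    using dhs by (meson DERIV_isCont continuous_at_imp_continuous_on)
  have openU: "open U" unfolding U_def
    by (intro open_Int AB open_Collect_less cont1 continuous_on_const)
  have y0U: "y0 \<in> U" using AB mono[of y0 s0 "s0 + r"] mono[of y0 "s0 - r" s0] r eq by (auto simp: U_def)
  have "\<exists>s. s \<in> V \<and> h (p y s) = t" if "y \<in> U" for y
  proof -
    have "\<exists>s\<ge>s0 - r. s \<le> s0 + r \<and> h (p y s) = t"
      by (rule IVT') (use that r cont2 in \<open>auto simp: U_def intro: continuous_on_subset\<close>)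
    then obtain s where s: "s0 - r \<le> s" "s \<le> s0 + r" "h (p y s) = t" by blast
    then have "s \<noteq> s0 - r" "s \<noteq> s0 + r" using that by (auto simp: U_def)
    then show ?thesis using s by (auto simp: V_def intro!: exI[of _ s])
  qed
  then obtain g where g: "\<And>y. y \<in> U \<Longrightarrow> g y \<in> V" "\<And>y. y \<in> U \<Longrightarrow> h (p y (g y)) = t"
    by metis
  have mono': "h (p y s) < h (p y s') \<longleftrightarrow> s < s'" if "y \<in> U" "s \<in> V" "s' \<in> V" for y s s'
    using mono[of y s s'] mono[of y s' s] that
    by (cases s s' rule: linorder_cases) (auto simp: U_def V_def)
  have inj': "h (p y s) = h (p y s') \<longleftrightarrow> s = s'" if "y \<in> U" "s \<in> V" "s' \<in> V" for y s s'
    using mono'[of y s s'] mono'[of y s' s] that by auto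
  \<comment> \<open>\<open>\<Phi>\<close> straightens the levels of \<open>h\<close>: its inverse
    sends \<open>(y, t)\<close> to \<open>(y, g y)\<close>, so the inverse function theorem for
    \<open>\<Phi>\<close> differentiates \<open>g\<close>.\<close>
  define \<Phi> where "\<Phi> z = (fst z, h (p (fst z) (snd z)))" for z
  have inj: "inj_on \<Phi> (U \<times> V)"
    using inj' by (auto simp: inj_on_def \<Phi>_def)
  have qpos: "q (p y (g y)) > 0" if "y \<in> U" for y
    using N(2)[of y "g y"] g(1)[OF that] that by (auto simp: U_def V_def)
  have dg: "(g has_derivative (\<lambda>v. - frechet_derivative h (at (p y (g y))) (A v) / q (p y (g y)))) (at y)"
    if y: "y \<in> U" for y
  proof -
    let ?h = "frechet_derivative h (at (p y (g y)))"
    let ?I = "inv_into (U \<times> V) \<Phi>"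
    have \<Phi>: "\<Phi> (y, g y) = (y, t)" using g(2)[OF y] by (simp add: \<Phi>_def)
    have d\<Phi>: "(\<Phi> has_derivative (\<lambda>w. (fst w, ?h (A (fst w) + snd w *\<^sub>R e)))) (at (y, g y))"
      unfolding \<Phi>_def
      using has_derivative_Pair[OF has_derivative_fst[OF has_derivative_ident]
          has_derivative_compose[OF dpp[of "(y, g y)"] dh]] by simp
    have "(?I has_derivative (\<lambda>w. (fst w, (snd w - ?h (A (fst w))) / q (p y (g y))))) (at (\<Phi> (y, g y)))"
    proof (rule has_derivative_inverse_strong[OF _ _ _ _ d\<Phi>])
      show "open (U \<times> V)" using openU by (simp add: open_Times V_def)
      show "(y, g y) \<in> U \<times> V" using g(1)[OF y] y by simp
      show "continuous_on (U \<times> V) \<Phi>" unfolding \<Phi>_def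
        by (intro continuous_on_Pair continuous_on_fst continuous_on_id continuous_on_subset[OF conth]) auto
      show "?I (\<Phi> x) = x" if "x \<in> U \<times> V" for x using inj that by (rule inv_into_f_f)
      show "(\<lambda>w. (fst w, ?h (A (fst w) + snd w *\<^sub>R e)))
          \<circ> (\<lambda>w. (fst w, (snd w - ?h (A (fst w))) / q (p y (g y)))) = id"
        using qpos[OF y]
        by (auto simp: fun_eq_iff linear_add[OF lin] linear_cmul[OF lin] q_def[symmetric])
    qed
    then have I: "(?I has_derivative (\<lambda>w. (fst w, (snd w - ?h (A (fst w))) / q (p y (g y))))) (at (y, t))"
      by (simp add: \<Phi>)
    have "((\<lambda>y. (y, t)) has_derivative (\<lambda>v. (v, 0))) (at y)"
      by (intro has_derivative_Pair has_derivative_ident has_derivative_const)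
    from has_derivative_snd[OF has_derivative_compose[OF this I]]
    have "((\<lambda>y. snd (?I (y, t))) has_derivative (\<lambda>v. - ?h (A v) / q (p y (g y)))) (at y)"
      by simp
    then show ?thesis
    proof (rule has_derivative_transform_within_open[OF _ openU y])
      fix x assume x: "x \<in> U"
      then have "?I (\<Phi> (x, g x)) = (x, g x)" using inj g(1) by (intro inv_into_f_f) auto
      then show "snd (?I (x, t)) = g x" using g(2)[OF x] by (simp add: \<Phi>_def)
    qed
  qed
  define P where "P y = p y (g y)" for y
  define a where "a v z = - frechet_derivative h (at z) (A v)" for v z
  have a: "smooth_on UNIV (a v)" for v
    unfolding a_def by (intro smooth_on_minus smooth_on_frechet_derivative h open_UNIV)
  have dP: "(P has_derivative (\<lambda>v. A v + (a v (P y) / q (P y)) *\<^sub>R e)) (at y)" if "y \<in> U" for y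
    unfolding P_def p_def a_def
    using dg[OF that, unfolded p_def]
    by (auto intro!: derivative_eq_intros A.has_derivative)
  have qP: "q (P y) > 0" if "y \<in> U" for y using qpos[OF that] by (simp add: P_def)
  text \<open>Up to composition with the graph, the derivatives of the implicit function stay in the class
    of quotients of a smooth function by a power of the transversal derivative.\<close>
  have S: "higher_differentiable_on k (\<lambda>y. f (P y) / q (P y) ^ j) U" if "smooth_on UNIV f" for k f j
    using that
  proof (induction k arbitrary: f j)
    case 0
    have cP: "continuous_on U P"
      using dP by (meson continuous_at_imp_continuous_on has_derivative_continuous)
    have "continuous_on U (\<lambda>y. f (P y))" "continuous_on U (\<lambda>y. q (P y))"
      using continuous_on_compose2[OF smooth_on_continuous[OF 0] cP]
        continuous_on_compose2[OF smooth_on_continuous[OF q] cP] by auto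
    then have "continuous_on U (\<lambda>y. f (P y) / q (P y) ^ j)"
      using qP by (intro continuous_on_divide continuous_on_power) force+
    then show ?case by simp
  next
    case (Suc k)
    let ?D = "\<lambda>f v z. frechet_derivative f (at z) v"
    have df: "((\<lambda>y. f (P y)) has_derivative
        (\<lambda>v. ?D f (A v) (P y) + a v (P y) / q (P y) * ?D f e (P y))) (at y)"
      if "y \<in> U" "smooth_on UNIV f" for f y
    proof -
      have l: "linear (frechet_derivative f (at (P y)))"
        using smooth_on_has_derivative[OF that(2) UNIV_I] by (rule has_derivative_linear)
      show ?thesis
        using has_derivative_compose[OF dP[OF that(1)] smooth_on_has_derivative[OF that(2) UNIV_I]]
        by (simp add: linear_add[OF l] linear_cmul[OF l])
    qed
    \<comment> \<open>Numerator of the derivative in direction \<open>v\<close> over the denominator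
      \<open>q (P y) ^ (j + 2)\<close>. It is a smooth function of the ambient point, as the
      induction hypothesis demands.\<close>
    define F where "F v z = (?D f (A v) z * q z + a v z * ?D f e z) * q z
        + (- real j) * f z * (?D q (A v) z * q z + a v z * ?D q e z)" for v z
    have F: "smooth_on UNIV (F v)" for v
      unfolding F_def
      by (intro smooth_on_add smooth_on_mult smooth_on_const smooth_on_frechet_derivative a q Suc.prems open_UNIV)
    show ?case
    proof (rule higher_differentiable_on_SucI[OF openU])
      fix y assume y: "y \<in> U"
      have "((\<lambda>y. f (P y) / q (P y) ^ j) has_derivative
        (\<lambda>v. F v (P y) / q (P y) ^ (j + 2))) (at y)"
        by (rule has_derivative_eq_rhs[OF has_derivative_divide[OF df[OF y Suc.prems]
               has_derivative_power[OF df[OF y q]]]])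
           (use qP[OF y] in simp, rule ext, unfold F_def, rule quotient_power_identity, use qP[OF y] in simp)
      then show "((\<lambda>y. f (P y) / q (P y) ^ j) has_derivative
        (\<lambda>v. F v (P y) / q (P y) ^ (j + 2))) (at y)" .
    qed (rule Suc.IH[OF F])
  qed
  have "smooth_on U g" unfolding smooth_on_def
  proof
    fix k
    \<comment> \<open>The derivative formula for \<open>g\<close> yields one order more than
      required; the surplus is dropped afterwards.\<close>
    have "higher_differentiable_on (Suc k) g U"
    proof (rule higher_differentiable_on_SucI[OF openU])
      show "(g has_derivative (\<lambda>v. a v (P y) / q (P y) ^ 1)) (at y)" if "y \<in> U" for y
        using dg[OF that] by (simp add: a_def P_def)
    qed (rule S[OF a])
    then show "higher_differentiable_on k g U" by (rule higher_differentiable_on_SucD)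
  qed
  show ?thesis
  proof
    show "open V" "s0 \<in> V" using r by (auto simp: V_def)
    show "p y s \<in> W" if "y \<in> U" "s \<in> V" for y s
      using N(1)[of y s] that by (auto simp: U_def V_def)
    show "h (p y s) = t \<longleftrightarrow> s = g y" "h (p y s) > t \<longleftrightarrow> s > g y" if "y \<in> U" "s \<in> V" for y s
      using inj'[OF that g(1)[OF that(1)]] mono'[OF that(1) g(1)[OF that(1)] that(2)] g(2)[OF that(1)] by auto
  qed (use openU y0U g(1) \<open>smooth_on U g\<close> in auto)
qed

text \<open>\<open>D\<close> need be a superlevel set of \<open>h\<close> only inside
  \<open>W\<close>, which contains the frontier. On the frontier \<open>h = t\<close>, and some
  directional derivative is nonzero; rotating the last axis into that direction shows the frontier
  as a graph.\<close>

lemma smooth_hypersurface_frontier_superlevel: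
  fixes h :: "real ^ ('m::finite option) \<Rightarrow> real"
  assumes h: "smooth_on UNIV h" and W: "open W" "closure D \<subseteq> W" and G: "closure D \<subseteq> G"
    and D: "\<And>x. x \<in> W \<Longrightarrow> x \<in> D \<longleftrightarrow> h x > t"
    and reg: "\<And>x. x \<in> closure D \<Longrightarrow> h x = t \<Longrightarrow> \<exists>v. frechet_derivative h (at x) v \<noteq> 0"
  shows "smooth_hypersurface_in (frontier D) G"
proof -
  have conth: "continuous_on UNIV h" by (rule smooth_on_continuous[OF h])
  have DW: "D = W \<inter> {x. h x > t}" using D W(2) closure_subset[of D] by blast
  have openD: "open D" unfolding DW
    by (intro open_Int W open_Collect_less conth continuous_on_const)
  have "closed {x. h x \<ge> t}" by (intro closed_Collect_le conth continuous_on_const)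
  then have cl: "closure D \<subseteq> {x. h x \<ge> t}" by (rule closure_minimal[rotated]) (auto simp: DW)
  have fr: "frontier D = closure D - D" using openD by (simp add: frontier_def interior_open)
  have ht: "h x = t" "x \<in> W" if "x \<in> frontier D" for x
  proof -
    have x: "x \<in> closure D" "x \<notin> D" using that by (simp_all add: fr)
    then show "x \<in> W" using W(2) by blast
    then have "\<not> h x > t" using D x(2) by blast
    moreover have "h x \<ge> t" using x(1) cl by blast
    ultimately show "h x = t" by simp
  qed
  show ?thesis unfolding smooth_hypersurface_in_def
  proof (intro conjI ballI)
    show "closedin (top_of_set G) (frontier D)"
      using G fr by (intro closed_subset frontier_closed) auto
  next
    fix x assume x: "x \<in> frontier D"
    have lin: "linear (frechet_derivative h (at x))"
      using smooth_on_has_derivative[OF h UNIV_I] by (rule has_derivative_linear)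
    obtain v where v: "frechet_derivative h (at x) v \<noteq> 0"
      using reg[of x] ht(1)[OF x] x by (auto simp: fr)
    then have v0: "v \<noteq> 0" using linear_0[OF lin] by auto
    \<comment> \<open>The sign makes \<open>h\<close> increase along \<open>e\<close>, so
      \<open>D\<close> lies on the upper side of the graph.\<close>
    define e where "e = (sgn (frechet_derivative h (at x) v) / norm v) *\<^sub>R v"
    have e: "norm e = 1" "frechet_derivative h (at x) e > 0"
      using v v0 by (auto simp: e_def linear_cmul[OF lin] sgn_if field_simps)
    \<comment> \<open>Dimension at least 2 provides a transformation of determinant 1, not merely an
      orthogonal one, taking the last axis to \<open>e\<close>.\<close>
    have "2 \<le> CARD('m option)" using zero_less_card_finite[where 'a='m] by simp
    from rotation_exists_1[OF this norm_axis_1 e(1), of None]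
    obtain f :: "real ^ 'm option \<Rightarrow> real ^ 'm option"
      where f: "orthogonal_transformation f" "det (matrix f) = 1" "f (axis None 1) = e"
      by blast
    define Q where "Q = matrix f"
    have linf: "linear f" using f(1) by (rule orthogonal_transformation_linear)
    have Qf: "Q *v z = f z" for z unfolding Q_def by (simp add: linf matrix_works)
    have Q: "rotation_matrix Q"
      using f orthogonal_transformation_matrix[of f] by (auto simp: rotation_matrix_def Q_def)
    define \<psi> where "\<psi> z = x + Q *v (z - x)" for z
    define J :: "real ^ 'm \<Rightarrow> real ^ 'm option" where "J y = join_coords y 0" for y
    have join: "join_coords y s = J y + s *\<^sub>R axis None 1" for y s
      by (auto simp: J_def join_coords_def vec_eq_iff axis_def split: option.splits)
    have linJ: "linear J"
      by (rule linearI) (auto simp: J_def join_coords_def vec_eq_iff split: option.splits)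
    define p where "p y s = \<psi> (join_coords y s)" for y s
    have p: "p y s = (x - f x) + f (J y) + s *\<^sub>R e" for y s
      by (simp add: p_def \<psi>_def Qf join linear_diff[OF linf] linear_add[OF linf] linear_cmul[OF linf] f(3))
    \<comment> \<open>\<open>\<psi>\<close> fixes \<open>x\<close>, so the chart parameters of
      \<open>x\<close> are its own coordinates.\<close>
    define y0 where "y0 = (\<chi> j. x $ Some j)"
    have x0: "join_coords y0 (x $ None) = x"
      by (auto simp: join_coords_def y0_def vec_eq_iff split: option.splits)
    have px: "p y0 (x $ None) = x" by (simp add: p_def x0 \<psi>_def)
    have "bounded_linear (\<lambda>y. f (J y))"
      using linear_compose[OF linJ linf] by (simp add: o_def linear_conv_bounded_linear)
    then obtain U V g where UV: "open U" "open V" "y0 \<in> U" "x $ None \<in> V" "smooth_on U g" "g ` U \<subseteq> V"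
      "\<And>y s. y \<in> U \<Longrightarrow> s \<in> V \<Longrightarrow> p y s \<in> W"
      "\<And>y s. y \<in> U \<Longrightarrow> s \<in> V \<Longrightarrow> h (p y s) = t \<longleftrightarrow> s = g y"
      "\<And>y s. y \<in> U \<Longrightarrow> s \<in> V \<Longrightarrow> h (p y s) > t \<longleftrightarrow> s > g y"
      by (rule smooth_implicit_graph[OF h _ p W(1), where ?y0.0=y0 and ?s0.0="x $ None" and t=t])
         (use px ht[OF x] e(2) in auto)
    \<comment> \<open>A graph point has \<open>h = t\<close> and is therefore outside
      \<open>D\<close>, while arbitrarily small steps along \<open>e\<close> lead into
      \<open>D\<close>.\<close>
    have onto: "p y (g y) \<in> frontier D" if y: "y \<in> U" for y
    proof -
      have gV: "g y \<in> V" using UV(6) y by auto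
      have n: "p y (g y) \<notin> D" using D[OF UV(7)[OF y gV]] UV(8)[OF y gV] by simp
      have "p y (g y) \<in> closure D" unfolding closure_approachable
      proof (intro allI impI)
        fix r :: real assume "r > 0"
        obtain d where d: "d > 0" "ball (g y) d \<subseteq> V" using UV(2) gV open_contains_ball by blast
        let ?s = "g y + min d r / 2"
        have s: "?s \<in> V" using d \<open>r > 0\<close> by (intro subsetD[OF d(2)]) (auto simp: dist_real_def)
        have "p y ?s \<in> D" using D[OF UV(7)[OF y s]] UV(9)[OF y s] d \<open>r > 0\<close> by simp
        moreover have "dist (p y ?s) (p y (g y)) < r"
          using d \<open>r > 0\<close> e(1) by (simp add: p dist_norm scaleR_add_left)
        ultimately show "\<exists>z\<in>D. dist z (p y (g y)) < r" by blast
      qed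
      with n show ?thesis by (simp add: fr)
    qed
    have img: "\<psi> ` {join_coords y s | y s. y \<in> U \<and> s \<in> V} = {p y s | y s. y \<in> U \<and> s \<in> V}"
      by (auto simp: p_def)
    show "\<exists>(U :: (real ^ 'm) set) V g \<psi>.
        open U \<and> open V \<and> smooth_on U g \<and> g ` U \<subseteq> V \<and> rotation_about x \<psi> \<and>
        x = \<psi> x \<and> x \<in> \<psi> ` {join_coords y t | y t. y \<in> U \<and> t \<in> V} \<and>
        frontier D \<inter> \<psi> ` {join_coords y t | y t. y \<in> U \<and> t \<in> V} = {\<psi> (join_coords y (g y)) | y. y \<in> U}"
    proof (intro exI conjI)
      show "open U" "open V" "smooth_on U g" "g ` U \<subseteq> V" by fact+
      show "rotation_about x \<psi>" using Q by (auto simp: rotation_about_def \<psi>_def)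
      show "x = \<psi> x" by (simp add: \<psi>_def)
      show "x \<in> \<psi> ` {join_coords y t | y t. y \<in> U \<and> t \<in> V}"
        unfolding img using px UV(3,4) by force
      show "frontier D \<inter> \<psi> ` {join_coords y t | y t. y \<in> U \<and> t \<in> V} = {\<psi> (join_coords y (g y)) | y. y \<in> U}"
        unfolding img p_def[symmetric] using onto UV(6,8) ht(1) by fast
    qed
  qed
qed

section \<open>Fractional energy and perimeter\<close>

lemma nn_integral_lborel_shift:
  fixes f :: "'a::euclidean_space \<Rightarrow> ennreal"
  assumes [measurable]: "f \<in> borel_measurable borel"
  shows "(\<integral>\<^sup>+x. f (x + c) \<partial>lborel) = (\<integral>\<^sup>+x. f x \<partial>lborel)"
  by (subst (2) lborel_affine[of 1 c]) (simp_all add: nn_integral_distr nn_integral_density add.commute)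

lemma nn_integral_lborel_reflect:
  fixes f :: "'a::euclidean_space \<Rightarrow> ennreal"
  assumes [measurable]: "f \<in> borel_measurable borel"
  shows "(\<integral>\<^sup>+x. f (c - x) \<partial>lborel) = (\<integral>\<^sup>+x. f x \<partial>lborel)"
  by (subst (2) lborel_affine[of "-1" c]) (simp_all add: nn_integral_distr nn_integral_density)

text \<open>Two applications of Fubini. The variable moved outermost is the level in the coarea
  formula and the translation vector in the mollification estimate.\<close>

lemma nn_integral_lborel_rotate:
  fixes g :: "'a::euclidean_space \<Rightarrow> 'b::euclidean_space \<Rightarrow> 'c::euclidean_space \<Rightarrow> ennreal"
  assumes m: "(\<lambda>p. g (fst p) (fst (snd p)) (snd (snd p))) \<in> borel_measurable (lborel \<Otimes>\<^sub>M (lborel \<Otimes>\<^sub>M lborel))"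
  shows "(\<integral>\<^sup>+x. \<integral>\<^sup>+y. \<integral>\<^sup>+z. g x y z \<partial>lborel \<partial>lborel \<partial>lborel) =
    (\<integral>\<^sup>+z. \<integral>\<^sup>+x. \<integral>\<^sup>+y. g x y z \<partial>lborel \<partial>lborel \<partial>lborel)"
proof -
  have [measurable]: "(\<lambda>(y, z). g x y z) \<in> borel_measurable (lborel \<Otimes>\<^sub>M lborel)" for x
    using measurable_compose[OF _ m, of "\<lambda>p. (x, p)"] by (simp add: case_prod_unfold)
  have "(\<lambda>q. g (fst (fst q)) (snd q) (snd (fst q))) \<in> borel_measurable ((lborel \<Otimes>\<^sub>M lborel) \<Otimes>\<^sub>M lborel)"
    using measurable_compose[OF _ m, of "\<lambda>q. (fst (fst q), (snd q, snd (fst q)))"] by simp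
  then have [measurable]: "(\<lambda>(x, z). \<integral>\<^sup>+y. g x y z \<partial>lborel) \<in> borel_measurable (lborel \<Otimes>\<^sub>M lborel)"
    using lborel.borel_measurable_nn_integral_fst by (force simp: case_prod_unfold)
  have "(\<integral>\<^sup>+x. \<integral>\<^sup>+y. \<integral>\<^sup>+z. g x y z \<partial>lborel \<partial>lborel \<partial>lborel) =
      (\<integral>\<^sup>+x. \<integral>\<^sup>+z. \<integral>\<^sup>+y. g x y z \<partial>lborel \<partial>lborel \<partial>lborel)"
    by (intro nn_integral_cong lborel_pair.Fubini'[symmetric]) measurable
  also have "\<dots> = (\<integral>\<^sup>+z. \<integral>\<^sup>+x. \<integral>\<^sup>+y. g x y z \<partial>lborel \<partial>lborel \<partial>lborel)"
    by (rule lborel_pair.Fubini'[symmetric]) measurable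
  finally show ?thesis .
qed

section \<open>Integrability of the kernel near the origin and away from it\<close>

text \<open>A substitute for polar coordinates: \<open>f\<close> is dominated by a sum of constants
  \<open>c k\<close> on balls of radius \<open>R k\<close>, and by \<open>geometric\<close> the
  integrals of the summands form a geometric series.\<close>

lemma nn_integral_dyadic_finite:
  fixes f :: "'a::euclidean_space \<Rightarrow> ennreal"
  assumes f: "\<And>z. f z \<noteq> 0 \<Longrightarrow> \<exists>k. f z \<le> ennreal (c k) \<and> norm z < R k"
    and nonneg: "\<And>k. 0 \<le> c k" "\<And>k. 0 \<le> R k"
    and geometric: "\<And>k. c k * R k ^ DIM('a) = K * \<rho> ^ k" and \<rho>: "0 \<le> \<rho>" "\<rho> < 1"
  shows "(\<integral>\<^sup>+z. f z \<partial>lborel) < \<infinity>"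
proof -
  let ?V = "unit_ball_vol (real DIM('a))"
  have le: "f z \<le> (\<Sum>k. ennreal (c k) * indicator (ball 0 (R k)) z)" for z
  proof (cases "f z = 0")
    case False
    then obtain k where k: "f z \<le> ennreal (c k)" "norm z < R k" using f by blast
    then have "f z \<le> (\<Sum>j\<in>{k}. ennreal (c j) * indicator (ball 0 (R j)) z)" by simp
    also have "\<dots> \<le> (\<Sum>j. ennreal (c j) * indicator (ball 0 (R j)) z)"
      by (rule sum_le_suminf) auto
    finally show ?thesis .
  qed simp
  have "(\<integral>\<^sup>+z. f z \<partial>lborel) \<le> (\<integral>\<^sup>+(z::'a). (\<Sum>k. ennreal (c k) * indicator (ball 0 (R k)) z) \<partial>lborel)"
    by (intro nn_integral_mono le)
  also have "\<dots> = (\<Sum>k. ennreal (c k) * emeasure lborel (ball (0::'a) (R k)))"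
  proof -
    have "(\<lambda>z. ennreal (c k) * indicator (ball (0::'a) (R k)) z) \<in> borel_measurable lborel" for k
      by (intro borel_measurable_times_ennreal borel_measurable_const borel_measurable_indicator) simp
    then show ?thesis
      by (simp add: nn_integral_suminf nn_integral_cmult_indicator)
  qed
  also have "\<dots> = (\<Sum>k. ennreal (?V * (K * \<rho> ^ k)))"
    by (intro suminf_cong)
       (simp add: emeasure_ball nonneg geometric[symmetric] ennreal_mult[symmetric] mult_ac)
  also have "\<dots> < \<infinity>"
  proof -
    have "0 \<le> K" using geometric[of 0] nonneg[of 0] by (metis mult.right_neutral mult_nonneg_nonneg power_0 zero_le_power)
    then have "(\<Sum>k. ennreal (?V * (K * \<rho> ^ k))) \<noteq> top"
      using \<rho> by (intro ennreal_suminf_neq_top summable_mult summable_geometric) auto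
    then show ?thesis by (simp add: less_top)
  qed
  finally show ?thesis .
qed

text \<open>On the shell where \<open>norm z / d\<close> lies between consecutive powers of 2, the
  integrand decays like \<open>2 powr (- s * k)\<close> and the volume grows like
  \<open>2 powr (n * k)\<close>; the ratio \<open>2 powr (n - s)\<close> is below 1.\<close>

lemma nn_integral_inverse_powr_outside_finite:
  assumes s: "s > real DIM('a::euclidean_space)" and d: "d > 0"
  shows "(\<integral>\<^sup>+(z::'a). ennreal (1 / norm z powr s) * indicator {z. norm z \<ge> d} z \<partial>lborel) < \<infinity>"
proof (rule nn_integral_dyadic_finite)
  let ?n = "real DIM('a)"
  let ?c = "\<lambda>k::nat. (d * 2 powr k) powr (-s)" and ?R = "\<lambda>k::nat. d * 2 powr (k + 1)"
  show "\<exists>k. ennreal (1 / norm z powr s) * indicator {z. norm z \<ge> d} z \<le> ennreal (?c k) \<and> norm z < ?R k"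
    if "ennreal (1 / norm z powr s) * indicator {z. norm z \<ge> d} z \<noteq> 0" for z :: 'a
  proof -
    have z: "norm z \<ge> d" using that by (auto simp: indicator_def split: if_splits)
    define k where "k = nat \<lfloor>log 2 (norm z / d)\<rfloor>"
    have r: "norm z / d \<ge> 1" using z d by simp
    then have l: "0 \<le> log 2 (norm z / d)" by simp
    then have k: "real k \<le> log 2 (norm z / d)" "log 2 (norm z / d) < real k + 1"
      unfolding k_def by linarith+
    have "2 powr (log 2 (norm z / d)) = norm z / d" using r by (subst powr_log_cancel) linarith+
    then have "2 powr k \<le> norm z / d" "norm z / d < 2 powr (k + 1)"
      using k by (metis powr_le_cancel_iff powr_less_cancel_iff one_less_numeral_iff semiring_norm(76) of_nat_1 of_nat_add)+
    then have "d * 2 powr k \<le> norm z" "norm z < ?R k" using d by (auto simp: field_simps)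
    moreover from this(1) have "norm z powr (-s) \<le> ?c k"
      using d s by (intro powr_mono2') auto
    ultimately show ?thesis using z by (auto simp: powr_minus_divide intro!: exI[of _ k] ennreal_leI)
  qed
  show "?c k * ?R k ^ DIM('a) = (d powr (?n - s) * 2 powr ?n) * (2 powr (?n - s)) ^ k" for k
  proof -
    have "?c k * ?R k ^ DIM('a) = ?c k * ?R k powr ?n" using d by (simp add: powr_realpow)
    also have "\<dots> = (d powr (- s) * 2 powr (- s * k)) * (d powr ?n * 2 powr ((k + 1) * ?n))"
      using d by (simp add: powr_mult powr_powr mult.commute add.commute)
    also have "\<dots> = (d powr (- s) * d powr ?n) * (2 powr (- s * k) * 2 powr ((k + 1) * ?n))"
      by (simp only: mult_ac)
    also have "\<dots> = d powr (?n - s) * 2 powr (?n + (?n - s) * k)"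
      unfolding powr_add[symmetric] by (simp add: algebra_simps)
    also have "\<dots> = (d powr (?n - s) * 2 powr ?n) * (2 powr (?n - s)) powr k"
      by (simp add: powr_add powr_powr)
    finally show ?thesis by (simp add: powr_realpow)
  qed
  show "2 powr (?n - s) < 1" using s by (simp add: powr_less_one)
qed (use d in auto)

text \<open>Shells shrinking to the origin, with ratio \<open>2 powr (s - 1 - n)\<close>. The radius
  \<open>2 powr (1 - k)\<close> is twice the outer radius of the shell, because the bound on
  \<open>norm z\<close> must be strict.\<close>

lemma nn_integral_norm_powr_inside_finite:
  assumes s: "s < real DIM('a::euclidean_space) + 1" "1 \<le> s"
  shows "(\<integral>\<^sup>+(z::'a). ennreal (norm z / norm z powr s) * indicator {z. norm z \<le> 1} z \<partial>lborel) < \<infinity>"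
proof (rule nn_integral_dyadic_finite)
  let ?n = "real DIM('a)"
  let ?c = "\<lambda>k::nat. (2 powr (- real k - 1)) powr (1 - s)" and ?R = "\<lambda>k::nat. 2 powr (1 - real k)"
  show "\<exists>k. ennreal (norm z / norm z powr s) * indicator {z. norm z \<le> 1} z \<le> ennreal (?c k) \<and> norm z < ?R k"
    if "ennreal (norm z / norm z powr s) * indicator {z. norm z \<le> 1} z \<noteq> 0" for z :: 'a
  proof -
    have z: "norm z \<le> 1" "0 < norm z" using that by (auto simp: indicator_def split: if_splits)
    define k where "k = nat \<lfloor>- log 2 (norm z)\<rfloor>"
    have l: "0 \<le> - log 2 (norm z)" using z by simp
    then have k: "real k \<le> - log 2 (norm z)" "- log 2 (norm z) < real k + 1"
      unfolding k_def by linarith+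
    have "2 powr (log 2 (norm z)) = norm z" using z by (subst powr_log_cancel) auto
    moreover have "2 powr (- real k - 1) \<le> 2 powr (log 2 (norm z))" using k by (intro powr_mono) auto
    moreover have "2 powr (log 2 (norm z)) < 2 powr (1 - real k)" using k by (intro powr_less_mono) auto
    ultimately have *: "2 powr (- real k - 1) \<le> norm z" "norm z < ?R k" by simp_all
    from *(1) have "norm z powr (1 - s) \<le> ?c k"
      using s by (intro powr_mono2') auto
    then show ?thesis using z * by (auto simp: powr_diff intro!: exI[of _ k] ennreal_leI)
  qed
  show "?c k * ?R k ^ DIM('a) = 2 powr (s - 1 + ?n) * (2 powr (s - 1 - ?n)) ^ k" for k
  proof -
    have "?c k * ?R k ^ DIM('a) = ?c k * ?R k powr ?n" by (simp add: powr_realpow)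
    also have "\<dots> = 2 powr (s - 1 + ?n) * (2 powr (s - 1 - ?n)) powr k"
      by (simp add: powr_powr powr_add[symmetric] algebra_simps)
    finally show ?thesis by (simp add: powr_realpow)
  qed
  show "2 powr (s - 1 - ?n) < 1" using s by (simp add: powr_less_one)
qed auto

section \<open>Energy, perimeter and the coarea formula\<close>

text \<open>The seminorm with \<open>s\<close> in place of the dimension plus
  \<open>\<delta>\<close>, over Borel-Lebesgue measure. Values in a normed space are allowed because
  the vector field \<open>\<Psi>\<close> of the perturbation is measured too.\<close>

definition energy :: "real \<Rightarrow> 'a::euclidean_space set \<Rightarrow> ('a \<Rightarrow> 'b::real_normed_vector) \<Rightarrow> ennreal" where
  "energy s A u = (\<integral>\<^sup>+x\<in>A. (\<integral>\<^sup>+y\<in>A. ennreal (norm (u x - u y) / norm (x - y) powr s) \<partial>lborel) \<partial>lborel)"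

definition perimeter :: "real \<Rightarrow> 'a::euclidean_space set \<Rightarrow> 'a set \<Rightarrow> ennreal" where
  "perimeter s A D = (\<integral>\<^sup>+x\<in>D. (\<integral>\<^sup>+y\<in>A - D. ennreal (1 / norm (x - y) powr s) \<partial>lborel) \<partial>lborel)"

lemma energy_mono:
  assumes "\<And>x y. x \<in> A \<Longrightarrow> y \<in> A \<Longrightarrow> norm (v x - v y) \<le> norm (u x - u y)"
  shows "energy s A v \<le> energy s A u"
  unfolding energy_def
  by (auto intro!: nn_integral_mono ennreal_leI divide_right_mono assms simp: indicator_def)

lemma energy_triangle:
  fixes u v :: "'a::euclidean_space \<Rightarrow> real"
  assumes [measurable]: "u \<in> borel_measurable borel" "v \<in> borel_measurable borel" "A \<in> sets borel"
  shows "energy s A (\<lambda>x. u x + v x) \<le> energy s A u + energy s A v"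
proof -
  have "energy s A (\<lambda>x. u x + v x) \<le> (\<integral>\<^sup>+x\<in>A. (\<integral>\<^sup>+y\<in>A.
      (ennreal (norm (u x - u y) / norm (x - y) powr s) + ennreal (norm (v x - v y) / norm (x - y) powr s))
      \<partial>lborel) \<partial>lborel)"
    unfolding energy_def
  proof (intro nn_integral_mono mult_right_mono)
    fix x y
    have "norm (u x + v x - (u y + v y)) \<le> norm (u x - u y) + norm (v x - v y)"
      by (simp add: abs_if)
    then have "norm (u x + v x - (u y + v y)) / norm (x - y) powr s
        \<le> norm (u x - u y) / norm (x - y) powr s + norm (v x - v y) / norm (x - y) powr s"
      by (metis add_divide_distrib divide_right_mono powr_ge_zero)
    then show "ennreal (norm (u x + v x - (u y + v y)) / norm (x - y) powr s)
        \<le> ennreal (norm (u x - u y) / norm (x - y) powr s) + ennreal (norm (v x - v y) / norm (x - y) powr s)"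
      by (simp add: ennreal_plus[symmetric] del: ennreal_plus)
  qed auto
  also have "\<dots> = energy s A u + energy s A v"
    unfolding energy_def by (simp add: distrib_right nn_integral_add)
  finally show ?thesis .
qed

text \<open>\<open>\<bar>u x - u y\<bar>\<close> is the sum of the positive parts of
  \<open>u x - u y\<close> and \<open>u y - u x\<close>, and a positive part is the length of the
  set of levels separating the two values. Exchanging \<open>x\<close> and \<open>y\<close> shows
  that both halves agree, whence the factor 2.\<close>

lemma energy_coarea:
  fixes u :: "'a::euclidean_space \<Rightarrow> real"
  assumes [measurable]: "u \<in> borel_measurable borel" "A \<in> sets borel"
  shows "energy s A u = 2 * (\<integral>\<^sup>+\<tau>. perimeter s A {x \<in> A. u x > \<tau>} \<partial>lborel)"
proof -
  define F where "F x y = indicator A x * (indicator A y * ennreal (1 / norm (x - y) powr s)) * ennreal (max 0 (u x - u y))" for x y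
  have [measurable]: "case_prod F \<in> borel_measurable (lborel \<Otimes>\<^sub>M lborel)"
    unfolding F_def case_prod_unfold by measurable
  have "energy s A u = (\<integral>\<^sup>+x. \<integral>\<^sup>+y. F x y + F y x \<partial>lborel \<partial>lborel)"
    unfolding energy_def
  proof (intro nn_integral_cong)
    fix x
    have "ennreal (norm (u x - u y) / norm (x - y) powr s) * indicator A y * indicator A x = F x y + F y x" for y
    proof -
      have "norm (u x - u y) / norm (x - y) powr s =
          1 / norm (x - y) powr s * max 0 (u x - u y) + 1 / norm (x - y) powr s * max 0 (u y - u x)"
        by (simp add: max_def abs_if add_divide_distrib field_simps)
      then show ?thesis
        by (simp add: F_def norm_minus_commute[of y] ennreal_mult[symmetric] indicator_def del: ennreal_plus)
           (intro impI ennreal_plus; simp)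
    qed
    then show "(\<integral>\<^sup>+y\<in>A. ennreal (norm (u x - u y) / norm (x - y) powr s) \<partial>lborel) * indicator A x
        = (\<integral>\<^sup>+y. F x y + F y x \<partial>lborel)"
      by (subst nn_integral_multc[symmetric]) auto
  qed
  also have "\<dots> = (\<integral>\<^sup>+x. \<integral>\<^sup>+y. F x y \<partial>lborel \<partial>lborel) + (\<integral>\<^sup>+x. \<integral>\<^sup>+y. F y x \<partial>lborel \<partial>lborel)"
    by (simp add: nn_integral_add)
  also have "(\<integral>\<^sup>+x. \<integral>\<^sup>+y. F y x \<partial>lborel \<partial>lborel) = (\<integral>\<^sup>+x. \<integral>\<^sup>+y. F x y \<partial>lborel \<partial>lborel)"
    by (rule lborel_pair.Fubini') measurable
  also have "(\<integral>\<^sup>+x. \<integral>\<^sup>+y. F x y \<partial>lborel \<partial>lborel) = (\<integral>\<^sup>+\<tau>. perimeter s A {x \<in> A. u x > \<tau>} \<partial>lborel)"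
  proof -
    define g where "g x y \<tau> = ennreal (1 / norm (x - y) powr s) * indicator (A - {x\<in>A. u x > \<tau>}) y * indicator {x\<in>A. u x > \<tau>} x" for x y \<tau>
    \<comment> \<open>The interval is closed at \<open>u y\<close> and open at \<open>u x\<close>
      because superlevel sets are defined by a strict inequality.\<close>
    have g: "g x y \<tau> = indicator A x * (indicator A y * ennreal (1 / norm (x - y) powr s)) * indicator {u y ..< u x} \<tau>" for x y \<tau>
      by (auto simp: g_def indicator_def)
    have m: "(\<lambda>p. g (fst p) (fst (snd p)) (snd (snd p))) \<in> borel_measurable (lborel \<Otimes>\<^sub>M (lborel \<Otimes>\<^sub>M lborel))"
    proof -
      have "g x y \<tau> = indicator A x * (indicator A y * ennreal (1 / norm (x - y) powr s)) * (if u y \<le> \<tau> \<and> \<tau> < u x then 1 else 0)" for x y \<tau>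
        by (simp add: g indicator_def)
      then show ?thesis by simp
    qed
    have "(\<integral>\<^sup>+x. \<integral>\<^sup>+y. F x y \<partial>lborel \<partial>lborel) = (\<integral>\<^sup>+x. \<integral>\<^sup>+y. \<integral>\<^sup>+\<tau>. g x y \<tau> \<partial>lborel \<partial>lborel \<partial>lborel)"
      unfolding g F_def
      by (intro nn_integral_cong) (simp add: nn_integral_cmult max_def ennreal_neg)
    also have "\<dots> = (\<integral>\<^sup>+\<tau>. \<integral>\<^sup>+x. \<integral>\<^sup>+y. g x y \<tau> \<partial>lborel \<partial>lborel \<partial>lborel)"
      by (rule nn_integral_lborel_rotate[OF m])
    also have "\<dots> = (\<integral>\<^sup>+\<tau>. perimeter s A {x \<in> A. u x > \<tau>} \<partial>lborel)"
      unfolding perimeter_def g_def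
      by (intro nn_integral_cong) (simp add: nn_integral_multc)
    finally show ?thesis .
  qed
  finally show ?thesis by (simp add: mult_2)
qed

lemma perimeter_levels_measurable [measurable]:
  fixes u :: "'a::euclidean_space \<Rightarrow> real"
  assumes [measurable]: "u \<in> borel_measurable borel" "A \<in> sets borel"
  shows "(\<lambda>\<tau>. perimeter s A {x \<in> A. u x > \<tau>}) \<in> borel_measurable borel"
proof -
  have "perimeter s A {x \<in> A. u x > \<tau>} = (\<integral>\<^sup>+x. \<integral>\<^sup>+y. ennreal (1 / norm (x - y) powr s) * indicator A y *
      indicator A x * (if u y \<le> \<tau> \<and> \<tau> < u x then 1 else 0) \<partial>lborel \<partial>lborel)" for \<tau>
    unfolding perimeter_def
    by (subst nn_integral_multc[symmetric]) (auto intro!: nn_integral_cong simp: indicator_def)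
  then show ?thesis by simp
qed

text \<open>In the coarea formula only the levels in \<open>{0..<1}\<close> contribute: below 0 the
  superlevel set is all of \<open>A\<close>, which has no complement in \<open>A\<close>, and from 1
  on it is empty.\<close>

lemma energy_indicator:
  assumes [measurable]: "D \<in> sets borel" "A \<in> sets borel" and "D \<subseteq> A"
  shows "energy s A (indicat_real D) = 2 * perimeter s A D"
proof -
  have "perimeter s A {x \<in> A. indicat_real D x > \<tau>} = perimeter s A D * indicator {0..<1} \<tau>" for \<tau>
  proof -
    consider "\<tau> < 0" | "0 \<le> \<tau>" "\<tau> < 1" | "1 \<le> \<tau>" by linarith
    then show ?thesis
    proof cases
      case 1
      then have "{x \<in> A. indicat_real D x > \<tau>} = A" by (auto simp: indicator_def)
      then show ?thesis using 1 by (simp add: perimeter_def)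
    next
      case 2
      then have "{x \<in> A. indicat_real D x > \<tau>} = D" using assms(3) by (auto simp: indicator_def split: if_splits)
      then show ?thesis using 2 by simp
    next
      case 3
      then have "{x \<in> A. indicat_real D x > \<tau>} = {}" by (auto simp: indicator_def)
      then show ?thesis using 3 by (simp add: perimeter_def)
    qed
  qed
  then show ?thesis by (simp add: energy_coarea nn_integral_cmult)
qed

text \<open>The difference quotient is dominated by an integrable function \<open>m\<close> of
  \<open>x - y\<close>: near the diagonal by the Lipschitz bound and \<open>s < n + 1\<close>,
  elsewhere by boundedness and \<open>s > n\<close>. The integrand vanishes unless one of the points
  lies in \<open>S\<close>, which has finite measure.\<close>

lemma energy_lipschitz_finite:
  fixes g :: "'a::euclidean_space \<Rightarrow> 'b::euclidean_space"
  assumes s: "real DIM('a) < s" "s < real DIM('a) + 1"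
    and lip: "\<And>x y. norm (g x - g y) \<le> L * norm (x - y)" "0 \<le> L"
    and bound: "\<And>x. norm (g x) \<le> M" and supp: "\<And>x. x \<notin> S \<Longrightarrow> g x = 0"
    and [measurable]: "S \<in> sets borel" and fin: "emeasure lborel S < \<infinity>"
  shows "energy s A g < \<infinity>"
proof -
  define m :: "'a \<Rightarrow> ennreal" where "m z = ennreal L * (ennreal (norm z / norm z powr s) * indicator {z. norm z \<le> 1} z)
      + ennreal (2 * M) * (ennreal (1 / norm z powr s) * indicator {z. norm z \<ge> 1} z)" for z
  have [measurable]: "m \<in> borel_measurable borel" unfolding m_def by measurable
  have "1 \<le> s" using s DIM_positive[where 'a='a] by linarith
  then have m_fin: "(\<integral>\<^sup>+z. m z \<partial>lborel) < \<infinity>"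
    using nn_integral_norm_powr_inside_finite[where 'a='a, OF s(2)]
      nn_integral_inverse_powr_outside_finite[where 'a='a, OF s(1), of 1]
    unfolding m_def by (simp add: nn_integral_add nn_integral_cmult ennreal_mult_less_top)
  have le: "ennreal (norm (g x - g y) / norm (x - y) powr s) \<le> indicator S x * m (x - y) + indicator S y * m (x - y)" for x y
  proof -
    have le': "ennreal (norm (g x - g y) / norm (x - y) powr s) \<le> m (x - y)"
    proof (cases "norm (x - y) \<le> 1")
      case True
      have "ennreal (norm (g x - g y) / norm (x - y) powr s) \<le> ennreal (L * norm (x - y) / norm (x - y) powr s)"
        using lip by (intro ennreal_leI divide_right_mono) auto
      also have "\<dots> = ennreal L * (ennreal (norm (x - y) / norm (x - y) powr s) * indicator {z. norm z \<le> 1} (x - y))"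
        using True lip(2) by (simp add: ennreal_mult[symmetric])
      finally show ?thesis unfolding m_def by (rule order_trans) simp
    next
      case False
      have "norm (g x - g y) \<le> 2 * M" using norm_triangle_ineq4[of "g x" "g y"] bound[of x] bound[of y] by linarith
      then have "ennreal (norm (g x - g y) / norm (x - y) powr s) \<le> ennreal (2 * M / norm (x - y) powr s)"
        by (intro ennreal_leI divide_right_mono) auto
      also have "\<dots> = ennreal (2 * M) * (ennreal (1 / norm (x - y) powr s) * indicator {z. norm z \<ge> 1} (x - y))"
        using False order_trans[OF norm_ge_zero bound] by (simp add: ennreal_mult[symmetric])
      finally show ?thesis unfolding m_def by (rule order_trans) simp
    qed
    show ?thesis
    proof (cases "x \<in> S \<or> y \<in> S")
      case True
      have "m (x - y) \<le> indicator S x * m (x - y) + indicator S y * m (x - y)"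
        using True by (auto simp: indicator_def)
      with le' show ?thesis by (rule order_trans)
    qed (simp add: supp)
  qed
  have "energy s A g \<le> (\<integral>\<^sup>+x. \<integral>\<^sup>+y. ennreal (norm (g x - g y) / norm (x - y) powr s) \<partial>lborel \<partial>lborel)"
    unfolding energy_def
    by (intro nn_integral_mono) (auto simp: indicator_def intro!: nn_integral_mono)
  also have "\<dots> \<le> (\<integral>\<^sup>+x. \<integral>\<^sup>+y. (indicator S x * m (x - y) + indicator S y * m (x - y)) \<partial>lborel \<partial>lborel)"
    by (intro nn_integral_mono le)
  also have "\<dots> = (\<integral>\<^sup>+x. \<integral>\<^sup>+y. indicator S x * m (x - y) \<partial>lborel \<partial>lborel)
      + (\<integral>\<^sup>+x. \<integral>\<^sup>+y. indicator S y * m (x - y) \<partial>lborel \<partial>lborel)"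
    by (simp add: nn_integral_add)
  also have "(\<integral>\<^sup>+x. \<integral>\<^sup>+y. indicator S y * m (x - y) \<partial>lborel \<partial>lborel)
      = (\<integral>\<^sup>+y. \<integral>\<^sup>+x. indicator S y * m (x - y) \<partial>lborel \<partial>lborel)"
    by (rule lborel_pair.Fubini'[symmetric]) measurable
  also have "\<dots> = (\<integral>\<^sup>+y. indicator S y * (\<integral>\<^sup>+z. m z \<partial>lborel) \<partial>lborel)"
    using nn_integral_lborel_shift[of m "- y" for y] by (simp add: nn_integral_cmult)
  also have "(\<integral>\<^sup>+x. \<integral>\<^sup>+y. indicator S x * m (x - y) \<partial>lborel \<partial>lborel)
      = (\<integral>\<^sup>+x. indicator S x * (\<integral>\<^sup>+z. m z \<partial>lborel) \<partial>lborel)"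
    by (simp add: nn_integral_cmult nn_integral_lborel_reflect)
  also have "(\<integral>\<^sup>+x. indicator S x * (\<integral>\<^sup>+z. m z \<partial>lborel) \<partial>lborel) + (\<integral>\<^sup>+x. indicator S x * (\<integral>\<^sup>+z. m z \<partial>lborel) \<partial>lborel) < \<infinity>"
    using m_fin fin by (simp add: nn_integral_multc ennreal_mult_less_top)
  finally show ?thesis .
qed

section \<open>Powers of extended nonnegative numbers\<close>

lemma measurable_ennreal_powr[measurable]:
  assumes [measurable]: "f \<in> borel_measurable M"
  shows "(\<lambda>x. ennreal_powr (f x) p) \<in> borel_measurable M"
  unfolding ennreal_powr_def by measurable

lemma ennreal_powr_ennreal: "0 \<le> x \<Longrightarrow> ennreal_powr (ennreal x) p = ennreal (x powr p)"
  by (simp add: ennreal_powr_def)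

lemma ennreal_powr_top [simp]: "ennreal_powr \<infinity> p = \<infinity>"
  by (simp add: ennreal_powr_def)

text \<open>Moves the exponent to the other side, so that Fatou's lemma and suprema can be applied
  to the bare integral or measure.\<close>

lemma ennreal_powr_le_iff:
  assumes "q > 0" "0 \<le> r"
  shows "ennreal_powr x (1 / q) \<le> ennreal r \<longleftrightarrow> x \<le> ennreal (r powr q)"
proof (cases x)
  case (real a)
  have "a powr (1 / q) \<le> r \<longleftrightarrow> a \<le> r powr q"
  proof
    assume "a powr (1 / q) \<le> r"
    then have "(a powr (1 / q)) powr q \<le> r powr q" using assms by (intro powr_mono2) auto
    then show "a \<le> r powr q" using real assms by (simp add: powr_powr)
  next
    assume "a \<le> r powr q"
    then have "a powr (1 / q) \<le> (r powr q) powr (1 / q)" using assms real by (intro powr_mono2) auto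
    then show "a powr (1 / q) \<le> r" using assms by (simp add: powr_powr)
  qed
  then show ?thesis using real assms by (simp add: ennreal_powr_ennreal)
next
  case top
  then show ?thesis using ennreal_powr_top[of "1 / q"] by (simp add: top_unique)
qed

lemma ennreal_powr_mono:
  assumes "p > 0" "x \<le> y"
  shows "ennreal_powr x p \<le> ennreal_powr y p"
proof (cases y)
  case (real r)
  then obtain a where a: "x = ennreal a" "0 \<le> a" using assms(2) by (cases x) (auto simp: top_unique)
  then show ?thesis using assms real by (simp add: ennreal_powr_ennreal powr_mono2)
next
  case top
  then show ?thesis using ennreal_powr_top[of p] by simp
qed

section \<open>Minkowski's inequality for superlevel sets\<close>

text \<open>Hoelder's inequality for \<open>f powr (q - 1)\<close> against an indicator, derived
  from Young's inequality so that \<open>q = 1\<close> needs no separate treatment. Sets of measure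
  zero or infinity are treated apart.\<close>

lemma holder_indicator:
  fixes f :: "'a \<Rightarrow> real"
  assumes [measurable]: "f \<in> borel_measurable M" "D \<in> sets M" and pos: "\<And>x. x \<in> D \<Longrightarrow> f x > 0"
    and q: "1 \<le> q" and I: "(\<integral>\<^sup>+x. ennreal (f x powr q) \<partial>M) = ennreal i" "i > 0"
  shows "(\<integral>\<^sup>+x. ennreal (f x powr (q - 1)) * indicator D x \<partial>M)
    \<le> ennreal ((i powr (1 / q)) powr (q - 1)) * ennreal_powr (emeasure M D) (1 / q)"
proof -
  define N where "N = i powr (1 / q)"
  have N: "N > 0" "N powr q = i" using I q by (auto simp: N_def powr_powr)
  show ?thesis
  proof (cases "emeasure M D")
    case top
    then show ?thesis using N ennreal_powr_top[of "1 / q"] by (simp add: ennreal_mult_top N_def[symmetric])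
  next
    case (real \<mu>)
    show ?thesis
    proof (cases "\<mu> = 0")
      case True
      then have "D \<in> null_sets M" using real by (auto simp: null_sets_def)
      then have "AE x in M. x \<notin> D" by (rule AE_not_in)
      then have "(\<integral>\<^sup>+x. ennreal (f x powr (q - 1)) * indicator D x \<partial>M) = (\<integral>\<^sup>+x. 0 \<partial>M)"
        by (intro nn_integral_cong_AE) (auto elim!: eventually_mono)
      then show ?thesis by simp
    next
      case False
      then have \<mu>: "\<mu> > 0" using real by simp
      \<comment> \<open>The scale at which Young's inequality loses nothing after integration: the
        constant \<open>c\<close> on \<open>D\<close> has the same \<open>q\<close>-mass
        \<open>i\<close> as \<open>f\<close>, which is \<open>c_mass\<close>.\<close>
      define c where "c = N / \<mu> powr (1 / q)"
      have c: "c > 0" using N \<mu> by (simp add: c_def)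
      have c_mass: "c powr q * \<mu> = i"
        using N \<mu> q by (simp add: c_def powr_divide powr_powr)
      have eq: "(1 - 1 / q) / c * i + c powr q / (q * c) * \<mu> = N powr (q - 1) * \<mu> powr (1 / q)"
      proof -
        have "(1 - 1 / q) / c * i + c powr q / (q * c) * \<mu> = (1 - 1 / q) / c * i + (c powr q * \<mu>) / (q * c)"
          by simp
        also have "\<dots> = i / c" unfolding c_mass using q c by (simp add: field_simps)
        also have "\<dots> = N powr (q - 1) * \<mu> powr (1 / q)"
          using N \<mu> by (simp add: c_def N(2)[symmetric] powr_diff)
        finally show ?thesis .
      qed
      have "f x powr (q - 1) \<le> (1 - 1 / q) / c * f x powr q + c powr q / (q * c)" if "x \<in> D" for x
      proof -
        have "(f x powr q) powr (1 - 1 / q) * (c powr q) powr (1 / q) \<le> (1 - 1 / q) * f x powr q + 1 / q * c powr q"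
          using pos[OF that] c q by (intro Youngs_inequality_0) auto
        also have "(f x powr q) powr (1 - 1 / q) * (c powr q) powr (1 / q) = f x powr (q - 1) * c"
          using q c by (simp add: powr_powr right_diff_distrib)
        finally show ?thesis using c q by (simp add: field_simps)
      qed
      then have "(\<integral>\<^sup>+x. ennreal (f x powr (q - 1)) * indicator D x \<partial>M)
        \<le> (\<integral>\<^sup>+x. ennreal ((1 - 1 / q) / c) * ennreal (f x powr q) + ennreal (c powr q / (q * c)) * indicator D x \<partial>M)"
        using c q
        by (intro nn_integral_mono)
           (auto simp: indicator_def ennreal_mult[symmetric] ennreal_plus[symmetric] simp del: ennreal_plus intro!: ennreal_leI)
      also have "\<dots> = ennreal ((1 - 1 / q) / c) * ennreal i + ennreal (c powr q / (q * c)) * ennreal \<mu>"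
        by (simp add: nn_integral_add nn_integral_cmult I(1) real)
      also have "\<dots> = ennreal ((1 - 1 / q) / c * i + c powr q / (q * c) * \<mu>)"
        using c q \<mu> I(2) by (simp add: ennreal_mult[symmetric] ennreal_plus[symmetric] del: ennreal_plus)
      also have "\<dots> = ennreal (N powr (q - 1)) * ennreal_powr (ennreal \<mu>) (1 / q)"
        unfolding eq using \<mu> by (simp add: ennreal_powr_ennreal ennreal_mult)
      finally show ?thesis by (simp add: N_def real)
    qed
  qed
qed

text \<open>Minkowski's integral inequality for \<open>f\<close> written as the integral of the
  indicators of its superlevel sets. With \<open>N\<close> the \<open>q\<close>-norm, one factor
  \<open>f\<close> of \<open>f powr q\<close> is expanded into levels and each level is estimated by
  Hoelder; this gives \<open>N powr q\<close> at most \<open>N powr (q - 1)\<close> times the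
  right-hand side. The division needs \<open>N\<close> positive and finite.\<close>

lemma nn_integral_powr_le_levels:
  fixes f :: "'a::euclidean_space \<Rightarrow> real"
  assumes [measurable]: "f \<in> borel_measurable borel" and nonneg: "\<And>x. 0 \<le> f x" and q: "1 \<le> q"
    and fin: "(\<integral>\<^sup>+x. ennreal (f x powr q) \<partial>lborel) < \<infinity>"
  shows "ennreal_powr (\<integral>\<^sup>+x. ennreal (f x powr q) \<partial>lborel) (1 / q)
    \<le> (\<integral>\<^sup>+\<tau>. ennreal_powr (emeasure lborel {x. f x > \<tau>}) (1 / q) * indicator {0<..} \<tau> \<partial>lborel)"
proof -
  obtain i where i: "(\<integral>\<^sup>+x. ennreal (f x powr q) \<partial>lborel) = ennreal i" "0 \<le> i"
    using fin by (cases "\<integral>\<^sup>+x. ennreal (f x powr q) \<partial>lborel") auto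
  show ?thesis
  proof (cases "i = 0")
    case True
    then show ?thesis using i by (simp add: ennreal_powr_def)
  next
    case False
    define N where "N = i powr (1 / q)"
    have N: "N > 0" "N powr q = i" using i False q by (auto simp: N_def powr_powr)
    define h where "h \<tau> = ennreal_powr (emeasure lborel {x. f x > \<tau>}) (1 / q) * indicator {0<..} \<tau>" for \<tau>
    have "(\<lambda>\<tau>. \<integral>\<^sup>+x. (if f x > \<tau> then 1 else 0) \<partial>lborel :: ennreal) \<in> borel_measurable lborel"
      by measurable
    also have "(\<lambda>\<tau>. \<integral>\<^sup>+x. (if f x > \<tau> then 1 else 0) \<partial>lborel :: ennreal) = (\<lambda>\<tau>. emeasure lborel {x. f x > \<tau>})"
    proof
      fix \<tau>
      have "(\<integral>\<^sup>+x. (if f x > \<tau> then 1 else 0) \<partial>lborel) = (\<integral>\<^sup>+x. indicator {x. f x > \<tau>} x \<partial>lborel)"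
        by (intro nn_integral_cong) (auto simp: indicator_def)
      then show "(\<integral>\<^sup>+x. (if f x > \<tau> then 1 else 0) \<partial>lborel) = emeasure lborel {x. f x > \<tau>}"
        by simp
    qed
    finally have [measurable]: "(\<lambda>\<tau>. emeasure lborel {x. f x > \<tau>}) \<in> borel_measurable lborel" .
    have [measurable]: "h \<in> borel_measurable lborel" unfolding h_def by measurable
    have "ennreal i = (\<integral>\<^sup>+x. \<integral>\<^sup>+\<tau>. ennreal (f x powr (q - 1)) * (if 0 < \<tau> \<and> \<tau> < f x then 1 else 0) \<partial>lborel \<partial>lborel)"
    proof (unfold i(1)[symmetric], intro nn_integral_cong)
      fix x
      have "(\<integral>\<^sup>+\<tau>. ennreal (f x powr (q - 1)) * (if 0 < \<tau> \<and> \<tau> < f x then 1 else 0) \<partial>lborel)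
          = ennreal (f x powr (q - 1)) * (\<integral>\<^sup>+\<tau>. indicator {0<..<f x} \<tau> \<partial>lborel)"
        by (subst nn_integral_cmult[symmetric]) (auto intro!: nn_integral_cong simp: indicator_def)
      also have "\<dots> = ennreal (f x powr (q - 1) * f x)"
        using nonneg[of x] by (simp add: ennreal_mult)
      also have "f x powr (q - 1) * f x = f x powr q"
        using nonneg[of x] q by (cases "f x = 0") (auto simp: powr_diff)
      finally show "ennreal (f x powr q) = (\<integral>\<^sup>+\<tau>. ennreal (f x powr (q - 1)) * (if 0 < \<tau> \<and> \<tau> < f x then 1 else 0) \<partial>lborel)"
        by simp
    qed
    also have "\<dots> = (\<integral>\<^sup>+\<tau>. \<integral>\<^sup>+x. ennreal (f x powr (q - 1)) * (if 0 < \<tau> \<and> \<tau> < f x then 1 else 0) \<partial>lborel \<partial>lborel)"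
      by (rule lborel_pair.Fubini'[symmetric]) measurable
    also have "\<dots> \<le> (\<integral>\<^sup>+\<tau>. ennreal (N powr (q - 1)) * h \<tau> \<partial>lborel)"
    proof (rule nn_integral_mono)
      fix \<tau> :: real
      show "(\<integral>\<^sup>+x. ennreal (f x powr (q - 1)) * (if 0 < \<tau> \<and> \<tau> < f x then 1 else 0) \<partial>lborel) \<le> ennreal (N powr (q - 1)) * h \<tau>"
      proof (cases "\<tau> > 0")
        case True
        have "(\<integral>\<^sup>+x. ennreal (f x powr (q - 1)) * (if 0 < \<tau> \<and> \<tau> < f x then 1 else 0) \<partial>lborel)
          = (\<integral>\<^sup>+x. ennreal (f x powr (q - 1)) * indicator {x. f x > \<tau>} x \<partial>lborel)"
          using True by (intro nn_integral_cong) (auto simp: indicator_def)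
        also have "\<dots> \<le> ennreal ((i powr (1 / q)) powr (q - 1)) * ennreal_powr (emeasure lborel {x. f x > \<tau>}) (1 / q)"
          by (rule holder_indicator) (use True i False q in auto)
        finally show ?thesis using True by (simp add: h_def N_def)
      qed (simp add: h_def)
    qed
    also have "\<dots> = ennreal (N powr (q - 1)) * (\<integral>\<^sup>+\<tau>. h \<tau> \<partial>lborel)"
      by (rule nn_integral_cmult) measurable
    finally have le: "ennreal i \<le> ennreal (N powr (q - 1)) * (\<integral>\<^sup>+\<tau>. h \<tau> \<partial>lborel)" .
    have "ennreal N \<le> (\<integral>\<^sup>+\<tau>. h \<tau> \<partial>lborel)"
    proof (cases "\<integral>\<^sup>+\<tau>. h \<tau> \<partial>lborel")
      case (real \<xi>)
      then have "i \<le> N powr (q - 1) * \<xi>"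
        using le by (simp add: ennreal_mult[symmetric])
      moreover have "i = N powr (q - 1) * N" using N by (simp add: powr_diff)
      ultimately have "N \<le> \<xi>" using N by simp
      then show ?thesis using real by (simp add: ennreal_leI)
    qed simp
    then show ?thesis using i by (simp add: h_def N_def ennreal_powr_ennreal)
  qed
qed

section \<open>Mollification\<close>

lemma smooth_frechet_derivative_euclidean:
  fixes \<phi> :: "'a::euclidean_space \<Rightarrow> real"
  assumes "smooth_on UNIV \<phi>"
  shows "frechet_derivative \<phi> (at x) v = (\<Sum>b\<in>Basis. (v \<bullet> b) * frechet_derivative \<phi> (at x) b)"
proof -
  have lin: "linear (frechet_derivative \<phi> (at x))"
    using smooth_on_has_derivative[OF assms UNIV_I] by (rule has_derivative_linear)
  show ?thesis
    by (subst euclidean_representation[of v, symmetric])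
       (simp add: linear_sum[OF lin] linear_cmul[OF lin])
qed

text \<open>The condition \<open>norm x > \<rho>\<close> describes an open set, so vanishing there
  passes to all derivatives.\<close>

lemma smooth_support_frechet_derivative:
  fixes \<phi> :: "'a::euclidean_space \<Rightarrow> real"
  assumes "\<forall>x. norm x > \<rho> \<longrightarrow> \<phi> x = 0"
  shows "\<forall>x. norm x > \<rho> \<longrightarrow> frechet_derivative \<phi> (at x) v = 0"
proof (intro allI impI)
  fix x :: 'a assume x: "norm x > \<rho>"
  have op: "open {x::'a. norm x > \<rho>}" by (intro open_Collect_less continuous_intros)
  have "(\<phi> has_derivative (\<lambda>_. 0)) (at x)"
    by (rule has_derivative_transform_within_open[OF has_derivative_const op]) (use assms x in auto)
  then show "frechet_derivative \<phi> (at x) v = 0" by (metis frechet_derivative_at)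
qed

lemma smooth_compact_support_bounded:
  fixes \<phi> :: "'a::euclidean_space \<Rightarrow> real"
  assumes "smooth_on UNIV \<phi>" "\<forall>x. norm x > \<rho> \<longrightarrow> \<phi> x = 0"
  obtains B where "B \<ge> 0" "\<And>x. \<bar>\<phi> x\<bar> \<le> B"
proof -
  have "compact (\<phi> ` cball 0 \<rho>)"
    using smooth_on_continuous[OF assms(1)] continuous_on_subset
    by (intro compact_continuous_image) auto
  then obtain B where B: "\<And>y. y \<in> \<phi> ` cball 0 \<rho> \<Longrightarrow> norm y \<le> B"
    by (meson compact_imp_bounded bounded_iff)
  have "\<bar>\<phi> x\<bar> \<le> max B 0" for x
    using B[of "\<phi> x"] assms(2) by (cases "norm x > \<rho>") auto
  then show ?thesis using that[of "max B 0"] by simp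
qed

lemma smooth_compact_support_derivative_bounded:
  fixes \<phi> :: "'a::euclidean_space \<Rightarrow> real"
  assumes \<phi>: "smooth_on UNIV \<phi>" "\<forall>x. norm x > \<rho> \<longrightarrow> \<phi> x = 0"
  obtains B where "B \<ge> 0" "\<And>x v. \<bar>frechet_derivative \<phi> (at x) v\<bar> \<le> B * norm v"
proof -
  have "\<exists>B\<ge>0. \<forall>x. \<bar>frechet_derivative \<phi> (at x) b\<bar> \<le> B" for b
    using smooth_compact_support_bounded[OF smooth_on_frechet_derivative[OF \<phi>(1)]
        smooth_support_frechet_derivative[OF \<phi>(2)]] by metis
  then obtain B where B: "\<And>b. B b \<ge> 0" "\<And>b x. \<bar>frechet_derivative \<phi> (at x) b\<bar> \<le> B b" by metis
  have "\<bar>frechet_derivative \<phi> (at x) v\<bar> \<le> (\<Sum>b\<in>Basis. B b) * norm v" for x v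
  proof -
    have "\<bar>frechet_derivative \<phi> (at x) v\<bar> = \<bar>\<Sum>b\<in>Basis. (v \<bullet> b) * frechet_derivative \<phi> (at x) b\<bar>"
      by (subst smooth_frechet_derivative_euclidean[OF \<phi>(1)]) (rule refl)
    also have "\<dots> \<le> (\<Sum>b\<in>Basis. norm v * B b)"
      by (rule order_trans[OF sum_abs])
         (auto intro!: sum_mono mult_mono B Basis_le_norm simp: abs_mult)
    finally show ?thesis by (simp add: sum_distrib_right[symmetric] mult.commute)
  qed
  then show ?thesis using that[of "\<Sum>b\<in>Basis. B b"] B(1) by (simp add: sum_nonneg)
qed

text \<open>Second derivatives are bounded by compactness of the support, so the first derivative is
  Lipschitz, and linearization on the ball of radius \<open>norm h\<close> costs a second factor
  \<open>norm h\<close>. Uniformity in \<open>x\<close> permits integration of the error against a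
  merely integrable function.\<close>

lemma smooth_compact_support_taylor:
  fixes \<phi> :: "'a::euclidean_space \<Rightarrow> real"
  assumes \<phi>: "smooth_on UNIV \<phi>" "\<forall>x. norm x > \<rho> \<longrightarrow> \<phi> x = 0"
  obtains B where "B \<ge> 0" "\<And>x h. \<bar>\<phi> (x + h) - \<phi> x - frechet_derivative \<phi> (at x) h\<bar> \<le> B * (norm h)\<^sup>2"
proof -
  let ?D = "\<lambda>x. frechet_derivative \<phi> (at x)"
  have "\<exists>B\<ge>0. \<forall>x v. \<bar>frechet_derivative (\<lambda>x. ?D x b) (at x) v\<bar> \<le> B * norm v" for b
    using smooth_compact_support_derivative_bounded[OF smooth_on_frechet_derivative[OF \<phi>(1)]
        smooth_support_frechet_derivative[OF \<phi>(2)]] by metis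
  then obtain B where B: "\<And>b. B b \<ge> 0" "\<And>b x v. \<bar>frechet_derivative (\<lambda>x. ?D x b) (at x) v\<bar> \<le> B b * norm v"
    by metis
  have lip: "\<bar>?D x b - ?D y b\<bar> \<le> B b * norm (x - y)" for b x y
  proof -
    have "norm (?D x b - ?D y b) \<le> B b * norm (x - y)"
    proof (rule differentiable_bound[of UNIV])
      show "((\<lambda>x. ?D x b) has_derivative frechet_derivative (\<lambda>x. ?D x b) (at x)) (at x within UNIV)" for x
        using smooth_on_has_derivative[OF smooth_on_frechet_derivative[OF \<phi>(1)] UNIV_I] by simp
      show "onorm (frechet_derivative (\<lambda>x. ?D x b) (at x)) \<le> B b" for x
        using B by (intro onorm_bound) auto
    qed auto
    then show ?thesis by simp
  qed
  define L where "L = (\<Sum>b\<in>Basis. B b)"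
  have L: "L \<ge> 0" using B(1) by (simp add: L_def sum_nonneg)
  have lipD: "\<bar>?D x v - ?D y v\<bar> \<le> L * norm (x - y) * norm v" for x y v
  proof -
    note rep = smooth_frechet_derivative_euclidean[OF \<phi>(1), where v=v]
    have "?D x v - ?D y v = (\<Sum>b\<in>Basis. (v \<bullet> b) * (?D x b - ?D y b))"
      by (simp add: rep[of x] rep[of y] sum_subtractf right_diff_distrib)
    also have "\<bar>\<dots>\<bar> \<le> (\<Sum>b\<in>Basis. norm v * (B b * norm (x - y)))"
      by (rule order_trans[OF sum_abs])
         (auto intro!: sum_mono mult_mono lip Basis_le_norm simp: abs_mult)
    finally show ?thesis by (simp add: L_def sum_distrib_right sum_distrib_left mult_ac)
  qed
  have "\<bar>\<phi> (x + h) - \<phi> x - ?D x h\<bar> \<le> L * (norm h)\<^sup>2" for x h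
  proof -
    have "norm (\<phi> (x + h) - \<phi> x - ?D x ((x + h) - x)) \<le> norm ((x + h) - x) * (L * norm h)"
    proof (rule differentiable_bound_linearization[where S="cball x (norm h)"])
      show "x + t *\<^sub>R (x + h - x) \<in> cball x (norm h)" if "t \<in> {0..1}" for t
        using that by (auto simp: dist_norm mult_left_le_one_le)
      show "(\<phi> has_derivative ?D y) (at y within cball x (norm h))" for y
        using smooth_on_has_derivative[OF \<phi>(1) UNIV_I] by (rule has_derivative_at_withinI)
      show "onorm (?D y - ?D x) \<le> L * norm h" if "y \<in> cball x (norm h)" for y
      proof (rule onorm_bound)
        fix v
        have "norm ((?D y - ?D x) v) \<le> L * norm (y - x) * norm v" using lipD[of y v x] by simp
        also have "\<dots> \<le> L * norm h * norm v"
          using that L by (intro mult_right_mono mult_left_mono) (auto simp: dist_norm norm_minus_commute)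
        finally show "norm ((?D y - ?D x) v) \<le> L * norm h * norm v" .
      qed (use L in auto)
    qed auto
    then show ?thesis by (simp add: power2_eq_square mult_ac)
  qed
  then show ?thesis using that[of L] L by blast
qed

section \<open>Differentiation of convolutions\<close>

lemma integrable_convolution:
  fixes u \<phi> :: "'a::euclidean_space \<Rightarrow> real"
  assumes u: "integrable lborel u" and \<phi>: "continuous_on UNIV \<phi>" "\<And>x. \<bar>\<phi> x\<bar> \<le> B"
  shows "integrable lborel (\<lambda>y. u y * \<phi> (x - y))"
proof (rule Bochner_Integration.integrable_bound)
  show "integrable lborel (\<lambda>y. u y * B)" using u by simp
  have [measurable]: "\<phi> \<in> borel_measurable borel" "u \<in> borel_measurable borel"
    using borel_measurable_continuous_onI[OF \<phi>(1)] u by auto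
  show "(\<lambda>y. u y * \<phi> (x - y)) \<in> borel_measurable lborel" by measurable
  have "0 \<le> B" using \<phi>(2)[of 0] by linarith
  then show "AE y in lborel. norm (u y * \<phi> (x - y)) \<le> norm (u y * B)"
    using \<phi>(2) by (auto simp: abs_mult intro!: mult_left_mono)
qed

text \<open>Integrating the uniform Taylor bound against \<open>\<bar>u\<bar>\<close> leaves an
  error of order \<open>(norm h)\<^sup>2\<close>, so no dominated convergence is required.\<close>

lemma convolution_has_derivative:
  fixes u \<phi> :: "'a::euclidean_space \<Rightarrow> real"
  assumes u: "integrable lborel u" and \<phi>: "smooth_on UNIV \<phi>" "\<forall>x. norm x > \<rho> \<longrightarrow> \<phi> x = 0"
  shows "((\<lambda>x. \<integral>y. u y * \<phi> (x - y) \<partial>lborel) has_derivative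
      (\<lambda>v. \<integral>y. u y * frechet_derivative \<phi> (at (x - y)) v \<partial>lborel)) (at x)"
proof -
  let ?D = "\<lambda>x. frechet_derivative \<phi> (at x)"
  let ?I = "\<integral>y. \<bar>u y\<bar> \<partial>lborel"
  have lin: "linear (?D x)" for x
    using smooth_on_has_derivative[OF \<phi>(1) UNIV_I] by (rule has_derivative_linear)
  obtain B0 where B0: "\<And>x. \<bar>\<phi> x\<bar> \<le> B0" using smooth_compact_support_bounded[OF \<phi>] by metis
  obtain B1 where B1: "B1 \<ge> 0" "\<And>x v. \<bar>?D x v\<bar> \<le> B1 * norm v"
    using smooth_compact_support_derivative_bounded[OF \<phi>] by metis
  obtain B2 where B2: "B2 \<ge> 0" "\<And>x h. \<bar>\<phi> (x + h) - \<phi> x - ?D x h\<bar> \<le> B2 * (norm h)\<^sup>2"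
    using smooth_compact_support_taylor[OF \<phi>] by metis
  have int0: "integrable lborel (\<lambda>y. u y * \<phi> (x - y))" for x
    by (rule integrable_convolution[OF u smooth_on_continuous[OF \<phi>(1)] B0])
  have int1: "integrable lborel (\<lambda>y. u y * ?D (x - y) v)" for x v
    by (rule integrable_convolution[OF u smooth_on_continuous[OF smooth_on_frechet_derivative[OF \<phi>(1)]] B1(2)])
  have iu: "integrable lborel (\<lambda>y. \<bar>u y\<bar>)" using u by simp
  have I: "?I \<ge> 0" by simp
  have bl: "bounded_linear (\<lambda>v. \<integral>y. u y * ?D (x - y) v \<partial>lborel)"
  proof (rule bounded_linear_intro)
    show "norm (\<integral>y. u y * ?D (x - y) v \<partial>lborel) \<le> norm v * (B1 * ?I)" for v
    proof -
      have "norm (\<integral>y. u y * ?D (x - y) v \<partial>lborel) \<le> (\<integral>y. \<bar>u y\<bar> * (B1 * norm v) \<partial>lborel)"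
        by (rule Bochner_Integration.integral_norm_bound_integral[OF int1])
           (use B1 iu in \<open>auto simp: abs_mult intro!: mult_left_mono\<close>)
      then show ?thesis by (simp add: mult_ac)
    qed
  qed (simp_all add: linear_add[OF lin] linear_cmul[OF lin] distrib_left int1 mult.left_commute)
  have main: "norm ((\<integral>y. u y * \<phi> (x + h - y) \<partial>lborel) - (\<integral>y. u y * \<phi> (x - y) \<partial>lborel)
      - (\<integral>y. u y * ?D (x - y) h \<partial>lborel)) / norm h \<le> B2 * ?I * norm h" for h
  proof -
    have "(\<integral>y. u y * \<phi> (x + h - y) \<partial>lborel) - (\<integral>y. u y * \<phi> (x - y) \<partial>lborel)
        - (\<integral>y. u y * ?D (x - y) h \<partial>lborel)
      = (\<integral>y. u y * (\<phi> ((x - y) + h) - \<phi> (x - y) - ?D (x - y) h) \<partial>lborel)"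
      using int0[of x] int0[of "x + h"] int1[of x h] by (simp add: right_diff_distrib algebra_simps)
    also have "norm \<dots> \<le> (\<integral>y. \<bar>u y\<bar> * (B2 * (norm h)\<^sup>2) \<partial>lborel)"
    proof (rule Bochner_Integration.integral_norm_bound_integral)
      show "integrable lborel (\<lambda>y. u y * (\<phi> ((x - y) + h) - \<phi> (x - y) - ?D (x - y) h))"
        using int0[of x] int0[of "x + h"] int1[of x h] by (simp add: right_diff_distrib algebra_simps)
    qed (use iu B2 in \<open>auto simp: abs_mult intro!: mult_left_mono\<close>)
    also have "\<dots> = B2 * ?I * norm h * norm h" by (simp add: power2_eq_square mult_ac)
    finally show ?thesis using B2 I by (cases "h = 0") (auto simp: divide_simps)
  qed
  have "((\<lambda>h. B2 * ?I * norm h) \<longlongrightarrow> 0) (at (0::'a))"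
    by (rule tendsto_mult_right_zero[OF tendsto_norm_zero[OF tendsto_ident_at]])
  then have "((\<lambda>h. norm ((\<integral>y. u y * \<phi> (x + h - y) \<partial>lborel) - (\<integral>y. u y * \<phi> (x - y) \<partial>lborel)
      - (\<integral>y. u y * ?D (x - y) h \<partial>lborel)) / norm h) \<longlongrightarrow> 0) (at 0)"
    by (rule Lim_null_comparison[rotated]) (use main in simp)
  with bl show ?thesis unfolding has_derivative_at by simp
qed

text \<open>All derivatives fall on \<open>\<phi>\<close>; the induction therefore varies
  \<open>\<phi>\<close> and keeps \<open>u\<close> fixed.\<close>

lemma smooth_on_convolution:
  fixes u \<phi> :: "'a::euclidean_space \<Rightarrow> real"
  assumes u: "integrable lborel u" and \<phi>: "smooth_on UNIV \<phi>" "\<forall>x. norm x > \<rho> \<longrightarrow> \<phi> x = 0"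
  shows "smooth_on UNIV (\<lambda>x. \<integral>y. u y * \<phi> (x - y) \<partial>lborel)"
  unfolding smooth_on_def
proof
  fix k
  show "higher_differentiable_on k (\<lambda>x. \<integral>y. u y * \<phi> (x - y) \<partial>lborel) UNIV"
    using \<phi>
  proof (induction k arbitrary: \<phi>)
    case 0
    then show ?case
      using has_derivative_continuous[OF convolution_has_derivative[OF u 0]]
      by (simp add: continuous_at_imp_continuous_on)
  next
    case (Suc k)
    show ?case
    proof (rule higher_differentiable_on_SucI[OF open_UNIV convolution_has_derivative[OF u Suc.prems]])
      fix v
      show "higher_differentiable_on k (\<lambda>x. \<integral>y. u y * frechet_derivative \<phi> (at (x - y)) v \<partial>lborel) UNIV"
        by (rule Suc.IH[OF smooth_on_frechet_derivative[OF Suc.prems(1)]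
              smooth_support_frechet_derivative[OF Suc.prems(2)]])
    qed
  qed
qed

section \<open>Convolution with a mollifier\<close>

text \<open>The factor \<open>B\<close> in the height bound is independent of
  \<open>\<epsilon>\<close>: the L1 estimate for mollified functions relies on this uniform
  growth.\<close>

lemma mollifier_exists:
  obtains B :: real where "B > 0"
    "\<And>\<epsilon>. \<epsilon> > 0 \<Longrightarrow> \<exists>\<phi> :: 'a::euclidean_space \<Rightarrow> real. smooth_on UNIV \<phi> \<and> (\<forall>x. 0 \<le> \<phi> x) \<and>
       (\<forall>x. norm x \<ge> \<epsilon> \<longrightarrow> \<phi> x = 0) \<and> (\<forall>x. \<phi> x \<le> B / \<epsilon> ^ DIM('a)) \<and> (\<integral>\<^sup>+x. ennreal (\<phi> x) \<partial>lborel) = 1"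
proof -
  let ?n = "DIM('a)"
  define V where "V = unit_ball_vol (real ?n)"
  have V: "V > 0" by (simp add: V_def)
  have mono: "flat_exp 0 a \<le> flat_exp 0 b" if "a \<le> b" for a b
    using that by (auto simp: flat_exp_def divide_simps)
  have nonneg: "flat_exp 0 a \<ge> 0" for a by (simp add: flat_exp_def)
  have p34: "flat_exp 0 (3 / 4) > 0" by (simp add: flat_exp_def)
  \<comment> \<open>The bump is at most \<open>flat_exp 0 1\<close>, and on the ball of radius
    \<open>\<epsilon> / 2\<close> at least \<open>flat_exp 0 (3 / 4)\<close>, as its argument there
    is at least \<open>1 - 1 / 4\<close>. \<open>B\<close> is the maximum over the resulting lower
    bound for the mass, with the powers of \<open>\<epsilon>\<close> removed.\<close>
  define B where "B = flat_exp 0 1 / (flat_exp 0 (3 / 4) * V * (1 / 2) ^ ?n)"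
  show ?thesis
  proof (rule that[of B])
    show "B > 0" using p34 V by (simp add: B_def flat_exp_def)
    fix \<epsilon> :: real assume \<epsilon>: "\<epsilon> > 0"
    define \<beta> :: "'a \<Rightarrow> real" where "\<beta> x = flat_exp 0 (1 - 1 / \<epsilon>\<^sup>2 * (x \<bullet> x))" for x
    have smooth: "smooth_on UNIV \<beta>" unfolding \<beta>_def by (rule smooth_on_bump)
    then have [measurable]: "\<beta> \<in> borel_measurable borel"
      by (intro borel_measurable_continuous_onI smooth_on_continuous)
    have arg: "1 / \<epsilon>\<^sup>2 * (x \<bullet> x) = (norm x / \<epsilon>)\<^sup>2" for x :: 'a
      by (simp add: power_divide power2_norm_eq_inner)
    have zero: "\<beta> x = 0" if "norm x \<ge> \<epsilon>" for x
    proof -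
      have "1 \<le> (norm x / \<epsilon>)\<^sup>2" using that \<epsilon> by (intro one_le_power) (simp add: field_simps)
      then show ?thesis unfolding \<beta>_def arg by (simp add: flat_exp_def)
    qed
    have le1: "\<beta> x \<le> flat_exp 0 1" for x unfolding \<beta>_def arg by (rule mono) simp
    have ge: "flat_exp 0 (3 / 4) \<le> \<beta> x" if "norm x < \<epsilon> / 2" for x
    proof -
      have "(norm x / \<epsilon>)\<^sup>2 \<le> (1 / 2)\<^sup>2" using that \<epsilon> by (intro power_mono) (simp_all add: field_simps)
      then show ?thesis unfolding \<beta>_def arg by (intro mono) (simp add: power2_eq_square)
    qed
    have nn: "0 \<le> \<beta> x" for x by (simp add: \<beta>_def nonneg)
    have "(\<integral>\<^sup>+x. ennreal (\<beta> x) \<partial>lborel) \<le> (\<integral>\<^sup>+x. ennreal (flat_exp 0 1) * indicator (cball (0::'a) \<epsilon>) x \<partial>lborel)"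
      by (intro nn_integral_mono) (auto simp: indicator_def le1 zero intro!: ennreal_leI)
    also have "\<dots> < \<infinity>"
      using emeasure_bounded_finite[OF bounded_cball, of "0::'a" \<epsilon>]
      by (simp add: nn_integral_cmult_indicator ennreal_mult_less_top)
    finally obtain I where I: "(\<integral>\<^sup>+x. ennreal (\<beta> x) \<partial>lborel) = ennreal I" "0 \<le> I"
      by (cases "\<integral>\<^sup>+x. ennreal (\<beta> x) \<partial>lborel") auto
    have "ennreal (flat_exp 0 (3 / 4) * (V * (\<epsilon> / 2) ^ ?n)) = ennreal (flat_exp 0 (3 / 4)) * emeasure lborel (ball (0::'a) (\<epsilon> / 2))"
      using \<epsilon> V nonneg by (simp add: emeasure_ball V_def ennreal_mult)
    also have "\<dots> = (\<integral>\<^sup>+x. ennreal (flat_exp 0 (3 / 4)) * indicator (ball (0::'a) (\<epsilon> / 2)) x \<partial>lborel)"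
      by (simp add: nn_integral_cmult_indicator)
    also have "\<dots> \<le> (\<integral>\<^sup>+x. ennreal (\<beta> x) \<partial>lborel)"
      by (intro nn_integral_mono) (auto simp: indicator_def ge intro!: ennreal_leI)
    finally have le: "flat_exp 0 (3 / 4) * (V * (\<epsilon> / 2) ^ ?n) \<le> I"
      using I by (simp add: ennreal_le_iff)
    have pos: "0 < flat_exp 0 (3 / 4) * (V * (\<epsilon> / 2) ^ ?n)" using p34 V \<epsilon> by simp
    have Ipos: "I > 0" using le pos by linarith
    show "\<exists>\<phi> :: 'a \<Rightarrow> real. smooth_on UNIV \<phi> \<and> (\<forall>x. 0 \<le> \<phi> x) \<and>
       (\<forall>x. norm x \<ge> \<epsilon> \<longrightarrow> \<phi> x = 0) \<and> (\<forall>x. \<phi> x \<le> B / \<epsilon> ^ DIM('a)) \<and> (\<integral>\<^sup>+x. ennreal (\<phi> x) \<partial>lborel) = 1"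
    proof (intro exI[of _ "\<lambda>x. 1 / I * \<beta> x"] conjI allI impI)
      show "smooth_on UNIV (\<lambda>x. 1 / I * \<beta> x)"
        by (intro smooth_on_mult smooth_on_const smooth open_UNIV)
      show "1 / I * \<beta> x \<le> B / \<epsilon> ^ DIM('a)" for x
      proof -
        have "1 / I * \<beta> x \<le> flat_exp 0 1 / (flat_exp 0 (3 / 4) * (V * (\<epsilon> / 2) ^ ?n))"
          using le pos Ipos le1 nonneg nn by (simp, intro frac_le) auto
        also have "\<dots> = B / \<epsilon> ^ DIM('a)"
          by (simp add: B_def power_divide)
        finally show ?thesis .
      qed
      have "(\<integral>\<^sup>+x. ennreal (1 / I * \<beta> x) \<partial>lborel) = (\<integral>\<^sup>+x. ennreal (1 / I) * ennreal (\<beta> x) \<partial>lborel)"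
        using Ipos nn by (simp add: ennreal_mult[symmetric])
      also have "\<dots> = ennreal (1 / I) * ennreal I" by (simp add: nn_integral_cmult I(1))
      also have "\<dots> = 1" using Ipos by (simp add: ennreal_mult[symmetric])
      finally show "(\<integral>\<^sup>+x. ennreal (1 / I * \<beta> x) \<partial>lborel) = 1" .
    qed (use Ipos nn zero in auto)
  qed
qed

lemma integral_lborel_reflect:
  fixes f :: "'a::euclidean_space \<Rightarrow> real"
  assumes [measurable]: "f \<in> borel_measurable borel"
  shows "(\<integral>x. f (c - x) \<partial>lborel) = (\<integral>x. f x \<partial>lborel)"
proof -
  have "(lborel :: 'a measure) = distr lborel borel (\<lambda>x. c - x)"
    using lborel_affine[of "-1" c] by (simp add: density_1 flip: one_ennreal_def)
  then have "(\<integral>x. f x \<partial>lborel) = (\<integral>x. f x \<partial>distr lborel borel (\<lambda>x. c - x))"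
    by simp
  also have "\<dots> = (\<integral>x. f (c - x) \<partial>lborel)"
    by (rule integral_distr) measurable
  finally show ?thesis by simp
qed

lemma integrable_bounded_compact_support:
  fixes f :: "'a::euclidean_space \<Rightarrow> real"
  assumes [measurable]: "f \<in> borel_measurable borel"
    and f: "\<And>x. 0 \<le> f x" "\<And>x. f x \<le> M" "\<And>x. x \<notin> K \<Longrightarrow> f x = 0" "compact K"
  shows "integrable lborel f"
proof (rule integrableI_bounded)
  have [measurable]: "K \<in> sets borel" using f(4) by (simp add: compact_imp_closed)
  have "(\<integral>\<^sup>+x. ennreal (norm (f x)) \<partial>lborel) \<le> (\<integral>\<^sup>+x. ennreal M * indicator K x \<partial>lborel)"
    using f by (intro nn_integral_mono) (auto simp: indicator_def intro!: ennreal_leI)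
  also have "\<dots> < \<infinity>"
    using emeasure_bounded_finite[OF compact_imp_bounded[OF f(4)]]
    by (simp add: nn_integral_cmult_indicator ennreal_mult_less_top)
  finally show "(\<integral>\<^sup>+x. ennreal (norm (f x)) \<partial>lborel) < \<infinity>" .
qed simp

locale mollification =
  fixes \<phi> u :: "'a::euclidean_space \<Rightarrow> real" and \<epsilon> M :: real and S :: "'a set"
  assumes eps: "0 < \<epsilon>" and phi_smooth: "smooth_on UNIV \<phi>" and phi_nonneg: "\<And>x. 0 \<le> \<phi> x"
    and phi_support: "\<And>x. norm x \<ge> \<epsilon> \<Longrightarrow> \<phi> x = 0"
    and phi_mass: "(\<integral>\<^sup>+x. ennreal (\<phi> x) \<partial>lborel) = 1"
    and u_measurable [measurable]: "u \<in> borel_measurable borel"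
    and u_nonneg: "\<And>x. 0 \<le> u x" and u_le: "\<And>x. u x \<le> M"
    and u_support: "\<And>x. x \<notin> S \<Longrightarrow> u x = 0" and compact: "compact S"
begin

definition w :: "'a \<Rightarrow> real" where "w x = (\<integral>y. u y * \<phi> (x - y) \<partial>lborel)"

lemma phi_measurable [measurable]: "\<phi> \<in> borel_measurable borel"
  by (intro borel_measurable_continuous_onI smooth_on_continuous phi_smooth)

lemma M_nonneg: "0 \<le> M"
  using u_nonneg u_le order_trans by blast

lemma integrable_u: "integrable lborel u"
  by (rule integrable_bounded_compact_support[OF u_measurable u_nonneg u_le u_support compact])

lemma smooth_w: "smooth_on UNIV w"
  unfolding w_def by (rule smooth_on_convolution[OF integrable_u phi_smooth, of \<epsilon>]) (simp add: phi_support)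

lemma w_measurable [measurable]: "w \<in> borel_measurable borel"
  by (intro borel_measurable_continuous_onI smooth_on_continuous smooth_w)

lemma integrable_phi: "integrable lborel \<phi>"
  by (rule integrableI_bounded) (simp_all add: phi_nonneg phi_mass)

lemma integral_phi: "(\<integral>x. \<phi> x \<partial>lborel) = 1"
  by (subst integral_eq_nn_integral) (simp_all add: phi_nonneg phi_mass)

lemma integrable_shift: "integrable lborel (\<lambda>z. u (x - z) * \<phi> z)"
proof (rule Bochner_Integration.integrable_bound)
  show "integrable lborel (\<lambda>z. M * \<phi> z)" using integrable_phi by simp
  show "AE z in lborel. norm (u (x - z) * \<phi> z) \<le> norm (M * \<phi> z)"
    using u_nonneg u_le M_nonneg phi_nonneg by (auto simp: abs_mult intro!: mult_right_mono)
qed measurable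

lemma w_eq: "w x = (\<integral>z. u (x - z) * \<phi> z \<partial>lborel)"
  unfolding w_def by (subst integral_lborel_reflect[of _ x, symmetric]) simp_all

lemma w_nonneg: "0 \<le> w x"
  unfolding w_def by (intro Bochner_Integration.integral_nonneg mult_nonneg_nonneg u_nonneg phi_nonneg)

lemma w_le: "w x \<le> M"
proof -
  have "w x \<le> (\<integral>z. M * \<phi> z \<partial>lborel)"
    unfolding w_eq using integrable_phi
    by (intro integral_mono integrable_shift mult_right_mono u_le phi_nonneg) simp
  then show ?thesis by (simp add: integral_phi)
qed

text \<open>Used with 0 to locate the support of \<open>w\<close>, and with 1 to make
  \<open>w\<close> admissible for the capacity of a compact set inside \<open>D\<close>.\<close>

lemma w_eq_const:
  assumes "\<And>y. norm (x - y) < \<epsilon> \<Longrightarrow> u y = c"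
  shows "w x = c"
proof -
  have "u (x - z) * \<phi> z = c * \<phi> z" for z
    using assms[of "x - z"] phi_support[of z] by (cases "norm z < \<epsilon>") auto
  then have "w x = (\<integral>z. c * \<phi> z \<partial>lborel)" unfolding w_eq by (simp only:)
  then show ?thesis by (simp add: integral_phi)
qed

lemma w_diff_le:
  "ennreal \<bar>w x - w y\<bar> \<le> (\<integral>\<^sup>+z. ennreal \<bar>u (x - z) - u (y - z)\<bar> * ennreal (\<phi> z) \<partial>lborel)"
proof -
  have int: "integrable lborel (\<lambda>z. (u (x - z) - u (y - z)) * \<phi> z)"
    using integrable_shift[of x] integrable_shift[of y] by (simp add: left_diff_distrib)
  have "w x - w y = (\<integral>z. (u (x - z) - u (y - z)) * \<phi> z \<partial>lborel)"
    using integrable_shift[of x] integrable_shift[of y] by (simp add: w_eq left_diff_distrib)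
  then have "ennreal \<bar>w x - w y\<bar> \<le> (\<integral>\<^sup>+z. ennreal (norm ((u (x - z) - u (y - z)) * \<phi> z)) \<partial>lborel)"
    using integral_norm_bound_ennreal[OF int] by simp
  then show ?thesis by (simp add: abs_mult phi_nonneg ennreal_mult)
qed

lemma w_diff_u_le:
  "ennreal \<bar>w x - u x\<bar> \<le> (\<integral>\<^sup>+y. ennreal \<bar>u x - u y\<bar> * ennreal (\<phi> (x - y)) \<partial>lborel)"
proof -
  have int: "integrable lborel (\<lambda>z. (u (x - z) - u x) * \<phi> z)"
    using integrable_shift[of x] integrable_phi by (simp add: left_diff_distrib)
  have "w x - u x = (\<integral>z. (u (x - z) - u x) * \<phi> z \<partial>lborel)"
    using integrable_shift[of x] integrable_phi by (simp add: w_eq left_diff_distrib integral_phi)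
  then have "ennreal \<bar>w x - u x\<bar> \<le> (\<integral>\<^sup>+z. ennreal (norm ((u (x - z) - u x) * \<phi> z)) \<partial>lborel)"
    using integral_norm_bound_ennreal[OF int] by simp
  also have "\<dots> = (\<integral>\<^sup>+z. ennreal \<bar>u x - u (x - z)\<bar> * ennreal (\<phi> z) \<partial>lborel)"
    by (simp add: abs_mult phi_nonneg ennreal_mult abs_minus_commute)
  also have "\<dots> = (\<integral>\<^sup>+y. ennreal \<bar>u x - u y\<bar> * ennreal (\<phi> (x - y)) \<partial>lborel)"
    using nn_integral_lborel_reflect[of "\<lambda>y. ennreal \<bar>u x - u y\<bar> * ennreal (\<phi> (x - y))" x] by simp
  finally show ?thesis .
qed

text \<open>\<open>w\<close> is an average of translates of \<open>u\<close>. Shifting both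
  variables by \<open>z\<close> leaves the kernel unchanged and carries points of \<open>H\<close>
  into \<open>G\<close>, so each translate contributes at most the energy of \<open>u\<close>, and
  the weights have total mass 1.\<close>

lemma energy_w_le:
  assumes [measurable]: "H \<in> sets borel" "G \<in> sets borel"
    and HG: "\<And>x z. x \<in> H \<Longrightarrow> norm z < \<epsilon> \<Longrightarrow> x - z \<in> G"
  shows "energy s H w \<le> energy s G u"
proof -
  define g where "g x y z = (ennreal (1 / norm (x - y) powr s) * indicator H y * indicator H x) *
      (ennreal \<bar>u (x - z) - u (y - z)\<bar> * ennreal (\<phi> z))" for x y z
  define h where "h a b = ennreal (norm (u a - u b) / norm (a - b) powr s) * indicator G b * indicator G a" for a b
  have E: "energy s G u = (\<integral>\<^sup>+a. \<integral>\<^sup>+b. h a b \<partial>lborel \<partial>lborel)"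
    unfolding energy_def h_def by (simp add: nn_integral_multc)
  have [measurable]: "(\<lambda>(a, b). h a b) \<in> borel_measurable (lborel \<Otimes>\<^sub>M lborel)"
    unfolding h_def by measurable
  have "energy s H w = (\<integral>\<^sup>+x. \<integral>\<^sup>+y. (ennreal (1 / norm (x - y) powr s) * indicator H y * indicator H x) * ennreal \<bar>w x - w y\<bar> \<partial>lborel \<partial>lborel)"
    unfolding energy_def
    by (subst nn_integral_multc[symmetric])
       (auto intro!: nn_integral_cong simp: ennreal_mult[symmetric] indicator_def)
  also have "\<dots> \<le> (\<integral>\<^sup>+x. \<integral>\<^sup>+y. (ennreal (1 / norm (x - y) powr s) * indicator H y * indicator H x) *
      (\<integral>\<^sup>+z. ennreal \<bar>u (x - z) - u (y - z)\<bar> * ennreal (\<phi> z) \<partial>lborel) \<partial>lborel \<partial>lborel)"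
    by (intro nn_integral_mono mult_left_mono w_diff_le) simp
  also have "\<dots> = (\<integral>\<^sup>+x. \<integral>\<^sup>+y. \<integral>\<^sup>+z. g x y z \<partial>lborel \<partial>lborel \<partial>lborel)"
    unfolding g_def by (simp add: nn_integral_cmult)
  also have "\<dots> = (\<integral>\<^sup>+z. \<integral>\<^sup>+x. \<integral>\<^sup>+y. g x y z \<partial>lborel \<partial>lborel \<partial>lborel)"
    by (rule nn_integral_lborel_rotate) (unfold g_def, measurable)
  also have "\<dots> \<le> (\<integral>\<^sup>+z. ennreal (\<phi> z) * energy s G u \<partial>lborel)"
  proof (rule nn_integral_mono)
    fix z
    have "g x y z \<le> ennreal (\<phi> z) * h (x - z) (y - z)" for x y
      using HG[of x z] HG[of y z] phi_support[of z]
      by (cases "norm z < \<epsilon>")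
         (auto simp: g_def h_def indicator_def ennreal_mult[symmetric] phi_nonneg mult_ac)
    then have "(\<integral>\<^sup>+x. \<integral>\<^sup>+y. g x y z \<partial>lborel \<partial>lborel) \<le> (\<integral>\<^sup>+x. \<integral>\<^sup>+y. ennreal (\<phi> z) * h (x - z) (y - z) \<partial>lborel \<partial>lborel)"
      by (intro nn_integral_mono)
    also have "\<dots> = ennreal (\<phi> z) * (\<integral>\<^sup>+x. \<integral>\<^sup>+y. h (x - z) (y - z) \<partial>lborel \<partial>lborel)"
      by (simp add: nn_integral_cmult)
    also have "(\<integral>\<^sup>+x. \<integral>\<^sup>+y. h (x - z) (y - z) \<partial>lborel \<partial>lborel) = (\<integral>\<^sup>+x. \<integral>\<^sup>+b. h (x - z) b \<partial>lborel \<partial>lborel)"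
      using nn_integral_lborel_shift[of "h (x - z)" "- z" for x] by simp
    also have "\<dots> = energy s G u"
      unfolding E using nn_integral_lborel_shift[of "\<lambda>a. \<integral>\<^sup>+b. h a b \<partial>lborel" "- z"] by simp
    finally show "(\<integral>\<^sup>+x. \<integral>\<^sup>+y. g x y z \<partial>lborel \<partial>lborel) \<le> ennreal (\<phi> z) * energy s G u" .
  qed
  also have "\<dots> = energy s G u" by (simp add: nn_integral_multc phi_mass)
  finally show ?thesis .
qed

text \<open>Where \<open>\<phi> (x - y)\<close> does not vanish, \<open>norm (x - y) < \<epsilon>\<close>, so the kernel of the energy is at
  least \<open>\<epsilon> powr - s\<close>.\<close>

lemma nn_integral_w_diff_u_le:
  assumes [measurable]: "G \<in> sets borel" and le: "\<And>x. \<phi> x \<le> B" and s: "0 \<le> s"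
    and S': "\<And>x. w x \<noteq> 0 \<or> u x \<noteq> 0 \<Longrightarrow> x \<in> S'" "\<And>x y. x \<in> S' \<Longrightarrow> norm (x - y) < \<epsilon> \<Longrightarrow> y \<in> G"
  shows "(\<integral>\<^sup>+x. ennreal \<bar>w x - u x\<bar> \<partial>lborel) \<le> ennreal (B * \<epsilon> powr s) * energy s G u"
proof -
  define h where "h x y = ennreal (norm (u x - u y) / norm (x - y) powr s) * indicator G y * indicator G x" for x y
  have E: "energy s G u = (\<integral>\<^sup>+a. \<integral>\<^sup>+b. h a b \<partial>lborel \<partial>lborel)"
    unfolding energy_def h_def by (simp add: nn_integral_multc)
  have [measurable]: "(\<lambda>(a, b). h a b) \<in> borel_measurable (lborel \<Otimes>\<^sub>M lborel)"
    unfolding h_def by measurable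
  have B: "0 \<le> B" using le[of 0] phi_nonneg[of 0] by linarith
  have "ennreal \<bar>w x - u x\<bar> \<le> (\<integral>\<^sup>+y. ennreal (B * \<epsilon> powr s) * h x y \<partial>lborel)" for x
  proof (cases "x \<in> S'")
    case True
    have xG: "x \<in> G" using S'(2)[OF True, of x] eps by simp
    have "ennreal \<bar>u x - u y\<bar> * ennreal (\<phi> (x - y)) \<le> ennreal (B * \<epsilon> powr s) * h x y" for y
    proof (cases "norm (x - y) < \<epsilon> \<and> x \<noteq> y")
      case T: True
      then have yG: "y \<in> G" using S'(2)[OF True] by blast
      have "norm (x - y) powr s \<le> \<epsilon> powr s" using T s by (intro powr_mono2) auto
      then have "1 \<le> \<epsilon> powr s / norm (x - y) powr s" using T by simp
      then have "\<phi> (x - y) * 1 \<le> B * (\<epsilon> powr s / norm (x - y) powr s)"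
        using B by (intro mult_mono le) (auto simp: phi_nonneg)
      then have "\<bar>u x - u y\<bar> * \<phi> (x - y) \<le> \<bar>u x - u y\<bar> * (B * (\<epsilon> powr s / norm (x - y) powr s))"
        by (intro mult_left_mono) auto
      then show ?thesis using xG yG B
        by (simp add: h_def ennreal_mult[symmetric] phi_nonneg mult_ac)
    qed (auto simp: phi_support)
    then have "(\<integral>\<^sup>+y. ennreal \<bar>u x - u y\<bar> * ennreal (\<phi> (x - y)) \<partial>lborel) \<le> (\<integral>\<^sup>+y. ennreal (B * \<epsilon> powr s) * h x y \<partial>lborel)"
      by (intro nn_integral_mono)
    with w_diff_u_le show ?thesis by (rule order_trans)
  next
    case False
    then have "w x = 0" "u x = 0" using S'(1) by blast+
    then show ?thesis by simp
  qed
  then have "(\<integral>\<^sup>+x. ennreal \<bar>w x - u x\<bar> \<partial>lborel) \<le> (\<integral>\<^sup>+x. \<integral>\<^sup>+y. ennreal (B * \<epsilon> powr s) * h x y \<partial>lborel \<partial>lborel)"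
    by (intro nn_integral_mono)
  also have "\<dots> = ennreal (B * \<epsilon> powr s) * energy s G u" by (simp add: E nn_integral_cmult)
  finally show ?thesis .
qed

end

section \<open>Approximation with control of the energy over the whole domain\<close>

text \<open>A pair with one point in \<open>G - H\<close> contributes only if the other lies in
  \<open>S'\<close>; the distance is then at least \<open>r\<close> and \<open>v\<close> vanishes at
  the first point, which bounds the numerator by \<open>M\<close>. The factor 2 accounts for the two
  orders of such a pair.\<close>

lemma energy_le_separated:
  fixes v :: "'a::euclidean_space \<Rightarrow> real"
  assumes [measurable]: "v \<in> borel_measurable borel" "H \<in> sets borel" "G \<in> sets borel" "S' \<in> sets borel"
    and le: "\<And>x. \<bar>v x\<bar> \<le> M" and supp: "\<And>x. x \<notin> S' \<Longrightarrow> v x = 0"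
    and sep: "\<And>x y. x \<in> S' \<Longrightarrow> y \<in> G - H \<Longrightarrow> r \<le> norm (x - y)" and r: "0 < r"
  shows "energy s G v \<le> energy s H v + 2 * (\<integral>\<^sup>+x. \<integral>\<^sup>+y. indicator S' x * indicator (G - H) y *
      (ennreal M * (ennreal (1 / norm (x - y) powr s) * indicator {z. r \<le> norm z} (x - y))) \<partial>lborel \<partial>lborel)"
proof -
  define e where "e x y = ennreal (norm (v x - v y) / norm (x - y) powr s)" for x y
  define T where "T x y = indicator S' x * indicator (G - H) y *
      (ennreal M * (ennreal (1 / norm (x - y) powr s) * indicator {z. r \<le> norm z} (x - y)))" for x y
  have [measurable]: "(\<lambda>(x, y). e x y) \<in> borel_measurable (lborel \<Otimes>\<^sub>M lborel)"
    unfolding e_def by measurable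
  have [measurable]: "(\<lambda>(x, y). T x y) \<in> borel_measurable (lborel \<Otimes>\<^sub>M lborel)"
  proof -
    have "T x y = indicator S' x * indicator (G - H) y *
      (ennreal M * (ennreal (1 / norm (x - y) powr s) * (if r \<le> norm (x - y) then 1 else 0)))" for x y
      by (simp add: T_def)
    then show ?thesis by simp
  qed
  have M: "0 \<le> M" using le[of undefined] by linarith
  have aux: "e x y \<le> T x y" if "y \<in> G - H" for x y
  proof -
    have "y \<notin> S'" using sep[of y y] that r by auto
    then have vy: "v y = 0" by (rule supp)
    show ?thesis
    proof (cases "x \<in> S'")
      case True
      have "e x y \<le> ennreal (M / norm (x - y) powr s)"
        unfolding e_def vy using le[of x] by (intro ennreal_leI divide_right_mono) auto
      also have "\<dots> = T x y" using sep[OF True that] True that M by (simp add: T_def ennreal_mult[symmetric])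
      finally show ?thesis .
    qed (simp add: e_def vy supp)
  qed
  have sym: "e x y = e y x" for x y by (simp add: e_def norm_minus_commute abs_minus_commute)
  have "e x y * indicator G y * indicator G x \<le> e x y * indicator H y * indicator H x + (T x y + T y x)" for x y
  proof -
    consider "x \<notin> G \<or> y \<notin> G" | "x \<in> H" "y \<in> H" | "y \<in> G - H" | "x \<in> G - H" by blast
    then show ?thesis
    proof cases
      case 2
      then show ?thesis by (auto simp: indicator_def intro: add_increasing2)
    next
      case 3
      have "e x y * indicator G y * indicator G x \<le> T x y" using aux[OF 3, of x] by (auto simp: indicator_def)
      then show ?thesis by (meson add_increasing add_increasing2 zero_le)
    next
      case 4
      have "e x y * indicator G y * indicator G x \<le> T y x" using aux[OF 4, of y] by (auto simp: indicator_def sym)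
      then show ?thesis by (meson add_increasing add_increasing2 zero_le)
    qed auto
  qed
  then have "(\<integral>\<^sup>+x. \<integral>\<^sup>+y. e x y * indicator G y * indicator G x \<partial>lborel \<partial>lborel)
      \<le> (\<integral>\<^sup>+x. \<integral>\<^sup>+y. e x y * indicator H y * indicator H x + (T x y + T y x) \<partial>lborel \<partial>lborel)"
    by (intro nn_integral_mono)
  also have "\<dots> = (\<integral>\<^sup>+x. \<integral>\<^sup>+y. e x y * indicator H y * indicator H x \<partial>lborel \<partial>lborel) +
      ((\<integral>\<^sup>+x. \<integral>\<^sup>+y. T x y \<partial>lborel \<partial>lborel) + (\<integral>\<^sup>+x. \<integral>\<^sup>+y. T y x \<partial>lborel \<partial>lborel))"
    by (simp add: nn_integral_add)
  also have "(\<integral>\<^sup>+x. \<integral>\<^sup>+y. T y x \<partial>lborel \<partial>lborel) = (\<integral>\<^sup>+x. \<integral>\<^sup>+y. T x y \<partial>lborel \<partial>lborel)"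
    by (rule lborel_pair.Fubini') measurable
  finally show ?thesis
    unfolding energy_def e_def[symmetric] T_def[symmetric] by (simp add: nn_integral_multc mult_2)
qed

text \<open>Common to both analytic directions: \<open>u\<close> is the indicator of
  \<open>D\<close> for the capacity estimate and a truncated function for the functional inequality.
  The error \<open>R j\<close> is the interaction of \<open>S'\<close> with the boundary
  layer.\<close>

lemma mollified_approximation:
  fixes u :: "'a::euclidean_space \<Rightarrow> real" and G S :: "'a set"
  assumes s: "real DIM('a) < s"
    and [measurable]: "u \<in> borel_measurable borel"
    and u: "\<And>x. 0 \<le> u x" "\<And>x. u x \<le> M" "\<And>x. x \<notin> S \<Longrightarrow> u x = 0"
    and S: "compact S" "S \<subseteq> G" "open G"
  obtains w R S' where "compact S'" "S' \<subseteq> G" "\<forall>j::nat. smooth_on UNIV (w j)" "\<forall>j x. 0 \<le> w j x"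
    "\<forall>j x. w j x \<le> M" "\<forall>j x. x \<notin> S' \<longrightarrow> w j x = 0"
    "\<forall>j. energy s G (w j) \<le> energy s G u + R j" "R \<longlonglongrightarrow> 0"
    "energy s G u < \<infinity> \<longrightarrow> (\<lambda>j. \<integral>\<^sup>+x. ennreal \<bar>w j x - u x\<bar> \<partial>lborel) \<longlonglongrightarrow> 0"
    "\<forall>K D. compact K \<and> open D \<and> K \<subseteq> D \<and> (\<forall>x\<in>D. u x = 1) \<longrightarrow>
       (\<forall>\<^sub>F j in sequentially. \<forall>x\<in>K. w j x = 1)"
proof -
  have spos: "0 < s" using s DIM_positive[where 'a='a] by linarith
  have "S \<inter> - G = {}" "closed (- G)" using S by auto
  with separate_compact_closed[OF S(1) this(2,1)]
  obtain d where d: "d > 0" "\<And>x y. x \<in> S \<Longrightarrow> y \<notin> G \<Longrightarrow> d \<le> dist x y" by auto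
  obtain B :: real where B: "B > 0"
    "\<And>\<epsilon>. \<epsilon> > 0 \<Longrightarrow> \<exists>\<phi> :: 'a \<Rightarrow> real. smooth_on UNIV \<phi> \<and> (\<forall>x. 0 \<le> \<phi> x) \<and>
       (\<forall>x. norm x \<ge> \<epsilon> \<longrightarrow> \<phi> x = 0) \<and> (\<forall>x. \<phi> x \<le> B / \<epsilon> ^ DIM('a)) \<and> (\<integral>\<^sup>+x. ennreal (\<phi> x) \<partial>lborel) = 1"
    using mollifier_exists[where 'a='a] by blast
  \<comment> \<open>The distance \<open>d\<close> from \<open>S\<close> to the complement of
    \<open>G\<close> is split into thirds: one for the growth of the support to \<open>S'\<close>,
    one for the boundary layer, and one that separates them and keeps the kernel bounded.\<close>
  define \<eta> where "\<eta> j = d / 3 * inverse (real (Suc j))" for j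
  have \<eta>: "\<eta> j > 0" "\<eta> j \<le> d / 3" for j
    using d(1) by (auto simp: \<eta>_def field_simps)
  have \<eta>0: "\<eta> \<longlonglongrightarrow> 0"
    unfolding \<eta>_def by (intro tendsto_mult_right_zero LIMSEQ_inverse_real_of_nat)
  obtain \<phi> :: "nat \<Rightarrow> 'a \<Rightarrow> real" where \<phi>: "\<And>j. smooth_on UNIV (\<phi> j)" "\<And>j x. 0 \<le> \<phi> j x"
    "\<And>j x. norm x \<ge> \<eta> j \<Longrightarrow> \<phi> j x = 0" "\<And>j x. \<phi> j x \<le> B / \<eta> j ^ DIM('a)"
    "\<And>j. (\<integral>\<^sup>+x. ennreal (\<phi> j x) \<partial>lborel) = 1"
    using B(2)[OF \<eta>(1)] by metis
  interpret moll: mollification "\<phi> j" u "\<eta> j" M S for j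
    by unfold_locales (use \<phi> \<eta> u S in auto)
  define w where "w j = moll.w j" for j
  define S' where "S' = {x + y | x y. x \<in> S \<and> y \<in> cball 0 (d / 3)}"
  have S'_compact: "compact S'" unfolding S'_def by (rule compact_sums[OF S(1) compact_cball])
  then have [measurable]: "S' \<in> sets borel" by (simp add: compact_imp_closed)
  have [measurable]: "G \<in> sets borel" using S(3) by simp
  have far: "2 * d / 3 \<le> dist x y" if "x \<in> S'" "y \<notin> G" for x y
  proof -
    obtain a b where ab: "x = a + b" "a \<in> S" "norm b \<le> d / 3" using \<open>x \<in> S'\<close> by (auto simp: S'_def)
    have "d \<le> dist a y" using d(2) ab(2) that(2) by blast
    also have "\<dots> \<le> dist a x + dist x y" by (rule dist_triangle)
    also have "dist a x \<le> d / 3" using ab by (simp add: dist_norm)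
    finally show ?thesis by simp
  qed
  have S'G: "S' \<subseteq> G" using far[of x x for x] d(1) by force
  have inS': "x \<in> S'" if "x - z \<in> S" "norm z \<le> d / 3" for x z
    unfolding S'_def using that by (intro CollectI exI[of _ "x - z"] exI[of _ z]) auto
  have w0: "w j x = 0" if "x \<notin> S'" for j x
    unfolding w_def
  proof (rule moll.w_eq_const)
    fix y assume "norm (x - y) < \<eta> j"
    then show "u y = 0" using inS'[of x "x - y"] that \<eta>(2)[of j] u(3)[of y] by auto
  qed
  \<comment> \<open>The case of empty complement is explicit because \<open>infdist\<close> to the
    empty set is 0 by convention, which would make \<open>H j\<close> empty instead of all of
    \<open>G\<close>.\<close>
  define H where "H j = {x \<in> G. - G = {} \<or> \<eta> j < infdist x (- G)}" for j
  have [measurable]: "H j \<in> sets borel" for j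
  proof -
    have "open {x. \<eta> j < infdist x (- G)}"
      by (intro open_Collect_less continuous_on_const continuous_on_infdist continuous_on_id)
    then have "open (G \<inter> {x. - G = {} \<or> \<eta> j < infdist x (- G)})"
      using S(3) by (cases "- G = {}") (auto intro: open_Int)
    moreover have "H j = G \<inter> {x. - G = {} \<or> \<eta> j < infdist x (- G)}" by (auto simp: H_def)
    ultimately show ?thesis by simp
  qed
  have HG: "x - z \<in> G" if "x \<in> H j" "norm z < \<eta> j" for x z j
  proof (rule ccontr)
    assume "x - z \<notin> G"
    then have "infdist x (- G) \<le> dist x (x - z)" by (intro infdist_le) auto
    then show False using that \<open>x - z \<notin> G\<close> by (auto simp: H_def dist_norm)
  qed
  have sep: "d / 3 \<le> norm (x - y)" if "x \<in> S'" "y \<in> G - H j" for x y j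
  proof -
    have ne: "- G \<noteq> {}" and le: "infdist y (- G) \<le> \<eta> j" using that by (auto simp: H_def)
    have "closed (- G)" using S(3) by (simp add: closed_def)
    from infdist_attains_inf[OF this ne, of y] obtain p where p: "p \<notin> G" "infdist y (- G) = dist y p" by auto
    have "2 * d / 3 \<le> dist x p" using far[OF that(1) p(1)] .
    also have "\<dots> \<le> dist x y + dist y p" by (rule dist_triangle)
    finally show ?thesis using p(2) le \<eta>(2)[of j] by (simp add: dist_norm)
  qed
  have ev: "\<forall>\<^sub>F j in sequentially. x \<notin> G - H j" for x
  proof (cases "- G = {} \<or> x \<notin> G")
    case False
    have "closed (- G)" using S(3) by (simp add: closed_def)
    then have "infdist x (- G) > 0" using False by (intro infdist_pos_not_in_closed) auto
    from order_tendstoD(2)[OF \<eta>0 this] show ?thesis by eventually_elim (auto simp: H_def)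
  qed (auto simp: H_def)
  \<comment> \<open>The kernel cut off at \<open>d / 3\<close> is integrable because
    \<open>s\<close> exceeds the dimension, so it can serve as a dominating function.\<close>
  define \<kappa> :: "'a \<Rightarrow> ennreal" where "\<kappa> z = ennreal M * (ennreal (1 / norm z powr s) * indicator {z. d / 3 \<le> norm z} z)" for z
  have [measurable]: "\<kappa> \<in> borel_measurable borel" unfolding \<kappa>_def by measurable
  have \<kappa>: "(\<integral>\<^sup>+z. \<kappa> z \<partial>lborel) < \<infinity>"
    unfolding \<kappa>_def using nn_integral_inverse_powr_outside_finite[OF s, of "d / 3"] d(1)
    by (simp add: nn_integral_cmult ennreal_mult_less_top)
  have shift: "(\<integral>\<^sup>+y. \<kappa> (x - y) \<partial>lborel) = (\<integral>\<^sup>+z. \<kappa> z \<partial>lborel)" for x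
    by (rule nn_integral_lborel_reflect) measurable
  define T where "T j x = (\<integral>\<^sup>+y. indicator S' x * indicator (G - H j) y * \<kappa> (x - y) \<partial>lborel)" for j x
  define R where "R j = 2 * (\<integral>\<^sup>+x. T j x \<partial>lborel)" for j
  \<comment> \<open>Dominated convergence twice: for fixed \<open>x\<close> every \<open>y\<close>
    eventually leaves the layer, and then the integral over \<open>x\<close> is dominated on
    \<open>S'\<close>, a set of finite measure.\<close>
  have "(\<lambda>j. \<integral>\<^sup>+x. T j x \<partial>lborel) \<longlonglongrightarrow> (\<integral>\<^sup>+(x::'a). 0 \<partial>lborel)"
  proof (rule nn_integral_dominated_convergence[where w="\<lambda>x. indicator S' x * (\<integral>\<^sup>+z. \<kappa> z \<partial>lborel)"])
    show "T j \<in> borel_measurable lborel" for j unfolding T_def by measurable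
    show "AE x in lborel. T j x \<le> indicator S' x * (\<integral>\<^sup>+z. \<kappa> z \<partial>lborel)" for j
    proof (intro AE_I2)
      fix x
      have "T j x \<le> (\<integral>\<^sup>+y. indicator S' x * \<kappa> (x - y) \<partial>lborel)"
        unfolding T_def by (intro nn_integral_mono) (auto simp: indicator_def)
      also have "\<dots> = indicator S' x * (\<integral>\<^sup>+z. \<kappa> z \<partial>lborel)" by (simp add: nn_integral_cmult shift)
      finally show "T j x \<le> indicator S' x * (\<integral>\<^sup>+z. \<kappa> z \<partial>lborel)" .
    qed
    show "(\<integral>\<^sup>+x. indicator S' x * (\<integral>\<^sup>+z. \<kappa> z \<partial>lborel) \<partial>lborel) < \<infinity>"
      using \<kappa> emeasure_bounded_finite[OF compact_imp_bounded[OF S'_compact]]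
      by (simp add: nn_integral_multc ennreal_mult_less_top)
    show "AE x in lborel. (\<lambda>j. T j x) \<longlonglongrightarrow> 0"
    proof (intro AE_I2)
      fix x
      have "(\<lambda>j. T j x) \<longlonglongrightarrow> (\<integral>\<^sup>+(y::'a). 0 \<partial>lborel)"
        unfolding T_def
      proof (rule nn_integral_dominated_convergence[where w="\<lambda>y. \<kappa> (x - y)"])
        show "AE y in lborel. indicator S' x * indicator (G - H j) y * \<kappa> (x - y) \<le> \<kappa> (x - y)" for j
          by (auto simp: indicator_def)
        show "(\<integral>\<^sup>+y. \<kappa> (x - y) \<partial>lborel) < \<infinity>" using \<kappa> shift by simp
        show "AE y in lborel. (\<lambda>j. indicator S' x * indicator (G - H j) y * \<kappa> (x - y)) \<longlonglongrightarrow> 0"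
        proof (intro AE_I2 tendsto_eventually)
          fix y
          show "\<forall>\<^sub>F j in sequentially. indicator S' x * indicator (G - H j) y * \<kappa> (x - y) = 0"
            using ev[of y] by eventually_elim simp
        qed
      qed measurable
      then show "(\<lambda>j. T j x) \<longlonglongrightarrow> 0" by simp
    qed
  qed measurable
  then have R0: "R \<longlonglongrightarrow> 0"
    unfolding R_def using ennreal_tendsto_cmult[of 2 "\<lambda>j. \<integral>\<^sup>+x. T j x \<partial>lborel" 0] by simp
  have energy: "energy s G (w j) \<le> energy s G u + R j" for j
  proof -
    have [measurable]: "w j \<in> borel_measurable borel" unfolding w_def by measurable
    have "energy s G (w j) \<le> energy s (H j) (w j) + R j"
      unfolding R_def T_def \<kappa>_def
    proof (rule energy_le_separated)
      show "\<bar>w j x\<bar> \<le> M" for x using moll.w_nonneg[of j x] moll.w_le[of j x] by (simp add: w_def)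
    qed (use w0 sep d(1) in auto)
    also have "energy s (H j) (w j) \<le> energy s G u"
      unfolding w_def by (rule moll.energy_w_le) (use HG in auto)
    finally show ?thesis by (simp add: add_right_mono)
  qed
  have L1: "(\<lambda>j. \<integral>\<^sup>+x. ennreal \<bar>w j x - u x\<bar> \<partial>lborel) \<longlonglongrightarrow> 0" if fin: "energy s G u < \<infinity>"
  proof -
    have le: "(\<integral>\<^sup>+x. ennreal \<bar>w j x - u x\<bar> \<partial>lborel) \<le> ennreal (B / \<eta> j ^ DIM('a) * \<eta> j powr s) * energy s G u" for j
      unfolding w_def
    proof (rule moll.nn_integral_w_diff_u_le[where S'=S'])
      show "x \<in> S'" if "moll.w j x \<noteq> 0 \<or> u x \<noteq> 0" for x
        using that w0[of x j] u(3)[of x] inS'[of x 0] d(1) by (auto simp: w_def)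
      show "y \<in> G" if "x \<in> S'" "norm (x - y) < \<eta> j" for x y
        using far[OF that(1), of y] that(2) \<eta>(2)[of j] d(1) by (force simp: dist_norm)
    qed (use \<phi> spos in auto)
    \<comment> \<open>The height of the mollifier costs \<open>\<eta> j\<close> to the power of
      minus the dimension and the kernel regains \<open>\<eta> j powr s\<close>; the surplus
      exponent is positive.\<close>
    have eq: "B / \<eta> j ^ DIM('a) * \<eta> j powr s = B * \<eta> j powr (s - real DIM('a))" for j
      using \<eta>(1)[of j] by (simp add: powr_diff powr_realpow)
    have "(\<lambda>j. \<eta> j powr (s - real DIM('a))) \<longlonglongrightarrow> 0"
      using \<eta>(1) s by (intro tendsto_zero_powrI[OF \<eta>0 tendsto_const]) (auto intro!: always_eventually less_imp_le)
    then have "(\<lambda>j. B * \<eta> j powr (s - real DIM('a))) \<longlonglongrightarrow> 0" by (rule tendsto_mult_right_zero)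
    then have "(\<lambda>j. energy s G u * ennreal (B * \<eta> j powr (s - real DIM('a)))) \<longlonglongrightarrow> energy s G u * ennreal 0"
      using fin by (intro ennreal_tendsto_cmult tendsto_ennrealI) auto
    then have "(\<lambda>j. ennreal (B / \<eta> j ^ DIM('a) * \<eta> j powr s) * energy s G u) \<longlonglongrightarrow> 0"
      unfolding eq by (simp add: mult.commute)
    then show ?thesis by (rule tendsto_sandwich[OF _ _ tendsto_const, rotated 2]) (use le in auto)
  qed
  have one: "\<forall>\<^sub>F j in sequentially. \<forall>x\<in>K. w j x = 1"
    if K: "compact K" "open D" "K \<subseteq> D" "\<And>x. x \<in> D \<Longrightarrow> u x = 1" for K D
  proof -
    have "K \<inter> - D = {}" "closed (- D)" using K by auto
    with separate_compact_closed[OF K(1) this(2,1)]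
    obtain e where e: "e > 0" "\<And>x y. x \<in> K \<Longrightarrow> y \<notin> D \<Longrightarrow> e \<le> dist x y" by auto
    from order_tendstoD(2)[OF \<eta>0 e(1)] show ?thesis
    proof eventually_elim
      fix j assume j: "\<eta> j < e"
      show "\<forall>x\<in>K. w j x = 1" unfolding w_def
      proof (intro ballI moll.w_eq_const)
        fix x y assume "x \<in> K" "norm (x - y) < \<eta> j"
        then show "u y = 1" using e(2)[of x y] j K(4)[of y] by (force simp: dist_norm)
      qed
    qed
  qed
  show ?thesis
  proof (rule that[OF S'_compact S'G _ _ _ _ _ R0])
    show "energy s G u < \<infinity> \<longrightarrow> (\<lambda>j. \<integral>\<^sup>+x. ennreal \<bar>w j x - u x\<bar> \<partial>lborel) \<longlonglongrightarrow> 0" using L1 by blast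
    show "\<forall>K D. compact K \<and> open D \<and> K \<subseteq> D \<and> (\<forall>x\<in>D. u x = 1) \<longrightarrow>
       (\<forall>\<^sub>F j in sequentially. \<forall>x\<in>K. w j x = 1)" using one by blast
  qed (use w0 energy in \<open>auto simp: w_def intro: moll.smooth_w moll.w_nonneg moll.w_le\<close>)
qed

section \<open>Generic linear perturbations\<close>

text \<open>The nested quantifiers fit the application: a small \<open>a\<close> is fixed first, and
  the levels \<open>t\<close> are then integrated, so exceptional levels of measure zero are
  harmless.\<close>

lemma AE_regular_value:
  fixes w :: "'a::euclidean_space \<Rightarrow> real"
  assumes w: "smooth_on UNIV w"
  shows "AE a in lborel. AE t in lborel. \<forall>x. w x + a \<bullet> x = t \<longrightarrow> (\<exists>v. frechet_derivative w (at x) v + a \<bullet> v \<noteq> 0)"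
proof -
  define grad where "grad x = (\<Sum>b\<in>Basis. frechet_derivative w (at x) b *\<^sub>R b)" for x
  have grad: "frechet_derivative w (at x) v = grad x \<bullet> v" for x v
    by (subst smooth_frechet_derivative_euclidean[OF w])
       (simp add: grad_def inner_sum_left inner_commute[of v] mult.commute)
  define F where "F x = (- grad x, w x - grad x \<bullet> x)" for x
  have dw: "w differentiable (at x)" for x
    using smooth_on_has_derivative[OF w UNIV_I] by (rule differentiableI)
  have dg: "((\<lambda>x. frechet_derivative w (at x) b) has_derivative
      frechet_derivative (\<lambda>x. frechet_derivative w (at x) b) (at x)) (at x)" for x b
    by (rule smooth_on_has_derivative[OF smooth_on_frechet_derivative[OF w] UNIV_I])
  have dgrad: "grad differentiable (at x)" for x
    unfolding grad_def
    by (intro differentiable_sum finite_Basis ballI differentiableI[OF has_derivative_scaleR_left[OF dg]])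
  have "F differentiable (at x)" for x
  proof -
    obtain D1 D2 where D: "(grad has_derivative D1) (at x)" "(w has_derivative D2) (at x)"
      using dgrad[of x] dw[of x] by (auto simp: differentiable_def)
    show ?thesis unfolding F_def
      by (rule differentiableI[OF has_derivative_Pair[OF has_derivative_minus[OF D(1)]
            has_derivative_diff[OF D(2) has_derivative_inner[OF D(1) has_derivative_ident]]]])
  qed
  then have "F differentiable_on UNIV" by (simp add: differentiable_on_def)
  then have "negligible (range F)" by (rule negligible_differentiable_image_lowdim[rotated]) simp
  then have "AE p in lebesgue. p \<notin> range F" by (simp add: negligible_iff_null_sets AE_not_in)
  then have "AE p in lborel. p \<notin> range F" by (simp add: AE_completion_iff)
  then have "AE p in lborel \<Otimes>\<^sub>M lborel. p \<notin> range F" unfolding lborel_prod .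
  \<comment> \<open>Fubini for null sets: almost every slice of a null set is null.\<close>
  then have "AE a in lborel. AE t in lborel. (a, t) \<notin> range F" by (rule lborel_pair.AE_pair)
  moreover have "\<exists>v. frechet_derivative w (at x) v + a \<bullet> v \<noteq> 0"
    if *: "(a, t) \<notin> range F" "w x + a \<bullet> x = t" for a t x
  proof (rule ccontr)
    assume "\<not> ?thesis"
    then have "(grad x + a) \<bullet> v = 0" for v by (simp add: grad inner_add_left)
    then have "grad x + a = 0" by (metis inner_eq_zero_iff)
    then have "a = - grad x" by (simp add: eq_neg_iff_add_eq_0 add.commute)
    then have "F x = (a, t)" using *(2) by (simp add: F_def)
    then show False using *(1) by (metis rangeI)
  qed
  ultimately show ?thesis by (auto elim!: eventually_mono)
qed

lemma AE_ex_in_ball: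
  fixes P :: "'a::euclidean_space \<Rightarrow> bool"
  assumes "AE x in lborel. P x" "0 < r"
  shows "\<exists>x. norm x < r \<and> P x"
proof (rule ccontr)
  assume "\<not> ?thesis"
  then have "AE x in lborel. x \<notin> ball (0::'a) r" using assms(1) by (auto elim!: eventually_mono)
  then have "ball (0::'a) r \<in> null_sets lborel" by (subst AE_iff_null_sets) auto
  then show False using assms(2) unit_ball_vol_pos[of "real DIM('a)"] by (auto simp: null_sets_def emeasure_ball)
qed

lemma AE_lborel_translate:
  assumes "AE x in lborel. P (x::real)"
  shows "AE x in lborel. P (c + x)"
proof -
  obtain N where N: "{x. \<not> P x} \<subseteq> N" "N \<in> null_sets lborel"
    using assms by (auto simp: eventually_ae_filter)
  then have [measurable]: "N \<in> sets borel" by auto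
  have "AE x in lborel. c + 1 * x \<notin> N"
    by (rule AE_borel_affine) (use N(2) in \<open>auto intro: AE_not_in\<close>)
  then show ?thesis by (rule eventually_mono) (use N(1) in auto)
qed

text \<open>Fatou's lemma for the \<open>q\<close>-th powers. For finite \<open>y\<close> the bounds
  \<open>X j\<close> are eventually below \<open>y + e\<close>; this real bound is moved inside the
  power and back, and \<open>e\<close> is arbitrary.\<close>

lemma powr_integral_limit_le:
  fixes v :: "nat \<Rightarrow> 'a::euclidean_space \<Rightarrow> real"
  assumes [measurable]: "\<And>j. v j \<in> borel_measurable borel" "u \<in> borel_measurable borel"
    and nonneg: "\<And>j x. 0 \<le> v j x" and lim: "AE x in lborel. (\<lambda>j. v j x) \<longlonglongrightarrow> u x" and q: "1 \<le> q"
    and le: "\<And>j. ennreal_powr (\<integral>\<^sup>+x. ennreal (v j x powr q) \<partial>lborel) (1 / q) \<le> X j" and X: "X \<longlonglongrightarrow> y"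
  shows "ennreal_powr (\<integral>\<^sup>+x. ennreal (u x powr q) \<partial>lborel) (1 / q) \<le> y"
proof (rule ennreal_le_epsilon)
  fix e :: real assume "y < top" "0 < e"
  then obtain r where r: "y = ennreal r" "0 \<le> r" by (cases y) auto
  have "AE x in lborel. ennreal (u x powr q) = liminf (\<lambda>j. ennreal (v j x powr q))"
    using lim
  proof eventually_elim
    fix x assume "(\<lambda>j. v j x) \<longlonglongrightarrow> u x"
    then have "(\<lambda>j. v j x powr q) \<longlonglongrightarrow> u x powr q"
      using q nonneg by (intro tendsto_powr' tendsto_const) auto
    then have "(\<lambda>j. ennreal (v j x powr q)) \<longlonglongrightarrow> ennreal (u x powr q)" by (rule tendsto_ennrealI)
    then show "ennreal (u x powr q) = liminf (\<lambda>j. ennreal (v j x powr q))"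
      by (rule lim_imp_Liminf[OF trivial_limit_sequentially, symmetric])
  qed
  then have "(\<integral>\<^sup>+x. ennreal (u x powr q) \<partial>lborel) = (\<integral>\<^sup>+x. liminf (\<lambda>j. ennreal (v j x powr q)) \<partial>lborel)"
    by (rule nn_integral_cong_AE)
  also have "\<dots> \<le> liminf (\<lambda>j. \<integral>\<^sup>+x. ennreal (v j x powr q) \<partial>lborel)"
    by (rule nn_integral_liminf) measurable
  also have "\<dots> \<le> ennreal ((r + e) powr q)"
  proof (rule order_trans[OF Liminf_le_Limsup Limsup_bounded])
    have "y < ennreal (r + e)" using r \<open>0 < e\<close> by (simp add: ennreal_less_iff)
    from order_tendstoD(2)[OF X this]
    show "\<forall>\<^sub>F j in sequentially. (\<integral>\<^sup>+x. ennreal (v j x powr q) \<partial>lborel) \<le> ennreal ((r + e) powr q)"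
    proof eventually_elim
      fix j assume "X j < ennreal (r + e)"
      then have "ennreal_powr (\<integral>\<^sup>+x. ennreal (v j x powr q) \<partial>lborel) (1 / q) \<le> ennreal (r + e)"
        using le[of j] by (meson less_imp_le order_trans)
      then show "(\<integral>\<^sup>+x. ennreal (v j x powr q) \<partial>lborel) \<le> ennreal ((r + e) powr q)"
        using q r \<open>0 < e\<close> by (subst (asm) ennreal_powr_le_iff) auto
    qed
  qed auto
  finally show "ennreal_powr (\<integral>\<^sup>+x. ennreal (u x powr q) \<partial>lborel) (1 / q) \<le> y + ennreal e"
    using q r \<open>0 < e\<close> by (simp add: ennreal_powr_le_iff ennreal_plus[symmetric] del: ennreal_plus)
qed

text \<open>\<open>\<Psi> x\<close> is \<open>x\<close> times a radial, piecewise linear cutoff that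
  falls from 1 to 0 between radii \<open>R\<close> and \<open>2 * R\<close>. The Lipschitz constant
  3 is 1 from the factor \<open>x\<close> plus slope \<open>1 / R\<close> times norm at most
  \<open>2 * R\<close>.\<close>

lemma identity_cutoff_exists:
  fixes R :: real
  assumes R: "0 < R"
  obtains \<Psi> :: "'a::euclidean_space \<Rightarrow> 'a" where
    "\<And>x. norm x < R \<Longrightarrow> \<Psi> x = x" "\<And>x. norm (\<Psi> x) \<le> 2 * R"
    "\<And>x. x \<notin> cball 0 (2 * R) \<Longrightarrow> \<Psi> x = 0" "\<And>x y. norm (\<Psi> x - \<Psi> y) \<le> 3 * norm (x - y)"
proof -
  define \<theta> where "\<theta> x = max 0 (min 1 (2 - norm x / R))" for x :: 'a
  have \<theta>: "0 \<le> \<theta> x" "\<theta> x \<le> 1" for x by (auto simp: \<theta>_def)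
  have \<theta>0: "\<theta> x = 0" if "norm x \<ge> 2 * R" for x using that R by (auto simp: \<theta>_def field_simps)
  have lip: "\<bar>\<theta> x - \<theta> y\<bar> \<le> norm (x - y) / R" for x y
  proof -
    have "\<bar>\<theta> x - \<theta> y\<bar> \<le> \<bar>norm x / R - norm y / R\<bar>" by (auto simp: \<theta>_def)
    also have "\<dots> = \<bar>norm x - norm y\<bar> / R" using R by (simp add: diff_divide_distrib[symmetric])
    also have "\<dots> \<le> norm (x - y) / R" using R by (intro divide_right_mono norm_triangle_ineq3) simp
    finally show ?thesis .
  qed
  \<comment> \<open>The product estimate needs just one of the points in the larger ball; if both
    are outside, both values vanish.\<close>
  have half: "norm (\<theta> x *\<^sub>R x - \<theta> y *\<^sub>R y) \<le> 3 * norm (x - y)" if "norm y \<le> 2 * R" for x y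
  proof -
    have "\<theta> x *\<^sub>R x - \<theta> y *\<^sub>R y = \<theta> x *\<^sub>R (x - y) + (\<theta> x - \<theta> y) *\<^sub>R y" by (simp add: algebra_simps)
    then have "norm (\<theta> x *\<^sub>R x - \<theta> y *\<^sub>R y) \<le> \<theta> x * norm (x - y) + \<bar>\<theta> x - \<theta> y\<bar> * norm y"
      using norm_triangle_ineq[of "\<theta> x *\<^sub>R (x - y)" "(\<theta> x - \<theta> y) *\<^sub>R y"] \<theta>(1)[of x] by simp
    also have "\<dots> \<le> 1 * norm (x - y) + norm (x - y) / R * (2 * R)"
      using \<theta> lip that R by (intro add_mono mult_mono) auto
    also have "\<dots> = 3 * norm (x - y)" using R by simp
    finally show ?thesis .
  qed
  show ?thesis
  proof (rule that[of "\<lambda>x. \<theta> x *\<^sub>R x"])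
    show "\<theta> x *\<^sub>R x = x" if "norm x < R" for x
      using that R by (simp add: \<theta>_def field_simps min_def max_def)
    show "norm (\<theta> x *\<^sub>R x) \<le> 2 * R" for x
    proof (cases "norm x \<ge> 2 * R")
      case False
      then show ?thesis using \<theta>[of x] mult_left_le_one_le[of "norm x" "\<theta> x"] by simp
    qed (use \<theta>0 R in auto)
    show "\<theta> x *\<^sub>R x = 0" if "x \<notin> cball 0 (2 * R)" for x using \<theta>0[of x] that by simp
    show "norm (\<theta> x *\<^sub>R x - \<theta> y *\<^sub>R y) \<le> 3 * norm (x - y)" for x y
    proof (cases "norm y \<le> 2 * R \<or> norm x \<le> 2 * R")
      case True
      then show ?thesis using half[of y x] half[of x y] by (auto simp: norm_minus_commute)
    qed (use \<theta>0[of x] \<theta>0[of y] in auto)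
  qed
qed

lemma energy_inner_le:
  fixes \<Psi> :: "'a::euclidean_space \<Rightarrow> 'a"
  assumes [measurable]: "\<Psi> \<in> borel_measurable borel" "A \<in> sets borel"
  shows "energy s A (\<lambda>x. a \<bullet> \<Psi> x) \<le> ennreal (norm a) * energy s A \<Psi>"
proof -
  have "energy s A (\<lambda>x. a \<bullet> \<Psi> x) \<le> energy s A (\<lambda>x. norm a *\<^sub>R \<Psi> x)"
    by (intro energy_mono)
       (simp add: inner_diff_right[symmetric] scaleR_diff_right[symmetric] Cauchy_Schwarz_ineq2)
  also have "\<dots> = ennreal (norm a) * energy s A \<Psi>"
    unfolding energy_def
    by (simp add: scaleR_diff_right[symmetric] ennreal_mult times_divide_eq_right[symmetric] mult.assoc nn_integral_cmult del: times_divide_eq_right)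
  finally show ?thesis .
qed

section \<open>From isoperimetric to functional inequalities\<close>

text \<open>Condition (C) as a hypothesis, over Borel-Lebesgue measure, with \<open>s\<close> for
  the dimension plus \<open>\<delta>\<close>.\<close>

locale isoperimetric_domain =
  fixes G :: "(real ^ ('m::finite option)) set" and q s C :: real
  assumes open_G: "open G" and q: "1 \<le> q" and C: "0 < C"
    and s: "real CARD('m option) < s" "s < real CARD('m option) + 1"
    and isoperimetric: "\<And>D. open D \<Longrightarrow> compact (closure D) \<Longrightarrow> closure D \<subseteq> G \<Longrightarrow>
      smooth_hypersurface_in (frontier D) G \<Longrightarrow>
      ennreal_powr (emeasure lborel D) (1 / q) \<le> ennreal (2 * C) * perimeter s G D"
begin

lemma G_measurable [measurable]: "G \<in> sets borel"
  using open_G by simp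

text \<open>The subtracted constant bounds \<open>\<bar>a \<bullet> \<Psi> x\<bar>\<close>, so the
  positive part vanishes outside \<open>S\<close> and its superlevel sets at positive levels lie
  compactly in \<open>G\<close>. They lie in the ball where \<open>\<Psi>\<close> is the identity,
  hence their frontiers are level sets of the smooth function \<open>w x + a \<bullet> x\<close>,
  regular at almost every level.\<close>

lemma perturbed_inequality:
  fixes w :: "real ^ 'm option \<Rightarrow> real" and \<Psi> :: "real ^ 'm option \<Rightarrow> real ^ 'm option"
  assumes w: "smooth_on UNIV w" "\<And>x. x \<notin> S \<Longrightarrow> w x = 0" and S: "compact S" "S \<subseteq> G" "S \<subseteq> ball 0 R" "0 < R"
    and \<Psi>: "\<And>x. norm x < R \<Longrightarrow> \<Psi> x = x" "\<And>x. norm (\<Psi> x) \<le> 2 * R" "continuous_on UNIV \<Psi>"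
    and regular: "AE t in lborel. \<forall>x. w x + a \<bullet> x = t \<longrightarrow> (\<exists>v. frechet_derivative w (at x) v + a \<bullet> v \<noteq> 0)"
  shows "ennreal_powr (\<integral>\<^sup>+x. ennreal (max 0 (w x + a \<bullet> \<Psi> x - norm a * (2 * R)) powr q) \<partial>lborel) (1 / q)
    \<le> ennreal C * (energy s G w + ennreal (norm a) * energy s G \<Psi>)"
proof -
  define t0 where "t0 = norm a * (2 * R)"
  define f where "f x = w x + a \<bullet> \<Psi> x" for x
  define g where "g x = max 0 (f x - t0)" for x
  have contw: "continuous_on UNIV w" by (rule smooth_on_continuous[OF w(1)])
  have contf: "continuous_on UNIV f" unfolding f_def by (intro continuous_intros contw \<Psi>(3))
  have contg: "continuous_on UNIV g" unfolding g_def by (intro continuous_intros contf)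
  have [measurable]: "w \<in> borel_measurable borel" "\<Psi> \<in> borel_measurable borel"
      "f \<in> borel_measurable borel" "g \<in> borel_measurable borel"
    by (intro borel_measurable_continuous_onI contw \<Psi>(3) contf contg)+
  have inner_le: "\<bar>a \<bullet> \<Psi> x\<bar> \<le> t0" for x
  proof -
    have "\<bar>a \<bullet> \<Psi> x\<bar> \<le> norm a * norm (\<Psi> x)" by (rule Cauchy_Schwarz_ineq2)
    also have "\<dots> \<le> t0" unfolding t0_def by (intro mult_left_mono \<Psi>(2)) simp
    finally show ?thesis .
  qed
  have g0: "g x = 0" if "x \<notin> S" for x using inner_le[of x] w(2)[OF that] by (simp add: g_def f_def)
  have g_nonneg: "0 \<le> g x" for x by (simp add: g_def)
  have fin: "(\<integral>\<^sup>+x. ennreal (g x powr q) \<partial>lborel) < \<infinity>"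
  proof -
    have "compact (g ` S)" by (intro compact_continuous_image continuous_on_subset[OF contg] S) auto
    then obtain B where B: "\<And>y. y \<in> g ` S \<Longrightarrow> norm y \<le> B" by (meson compact_imp_bounded bounded_iff)
    have [measurable]: "S \<in> sets borel" using S(1) by (simp add: compact_imp_closed)
    have "(\<integral>\<^sup>+x. ennreal (g x powr q) \<partial>lborel) \<le> (\<integral>\<^sup>+x. ennreal (B powr q) * indicator S x \<partial>lborel)"
    proof (rule nn_integral_mono)
      fix x
      show "ennreal (g x powr q) \<le> ennreal (B powr q) * indicator S x"
      proof (cases "x \<in> S")
        case True
        then have "g x \<le> B" using B[of "g x"] by auto
        then show ?thesis using True g_nonneg q by (simp add: ennreal_leI powr_mono2)
      qed (simp add: g0)
    qed
    also have "\<dots> < \<infinity>"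
      using emeasure_bounded_finite[OF compact_imp_bounded[OF S(1)]]
      by (simp add: nn_integral_cmult_indicator ennreal_mult_less_top)
    finally show ?thesis .
  qed
  \<comment> \<open>Level \<open>\<tau>\<close> of \<open>g\<close> corresponds to level
    \<open>t0 + \<tau>\<close> of the perturbed function.\<close>
  have "AE \<tau> in lborel. \<forall>x. w x + a \<bullet> x = t0 + \<tau> \<longrightarrow> (\<exists>v. frechet_derivative w (at x) v + a \<bullet> v \<noteq> 0)"
    by (rule AE_lborel_translate[OF regular])
  then have levels: "AE \<tau> in lborel. ennreal_powr (emeasure lborel {x. g x > \<tau>}) (1 / q) * indicator {0<..} \<tau>
      \<le> ennreal (2 * C) * perimeter s G {x \<in> G. g x > \<tau>}"
  proof eventually_elim
    fix \<tau> assume reg: "\<forall>x. w x + a \<bullet> x = t0 + \<tau> \<longrightarrow> (\<exists>v. frechet_derivative w (at x) v + a \<bullet> v \<noteq> 0)"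
    show "ennreal_powr (emeasure lborel {x. g x > \<tau>}) (1 / q) * indicator {0<..} \<tau>
      \<le> ennreal (2 * C) * perimeter s G {x \<in> G. g x > \<tau>}"
    proof (cases "\<tau> > 0")
      case True
      define D where "D = {x. g x > \<tau>}"
      have DS: "D \<subseteq> S" using g0 True by (force simp: D_def)
      have cl: "closure D \<subseteq> S" using DS S(1) by (intro closure_minimal compact_imp_closed)
      have DG: "{x \<in> G. g x > \<tau>} = D" using DS S(2) by (auto simp: D_def)
      define h where "h x = w x + a \<bullet> x" for x
      have h: "smooth_on UNIV h" unfolding h_def
        by (intro smooth_on_add smooth_on_bounded_linear bounded_linear_inner_right w(1) open_UNIV)
      have "frechet_derivative h (at x) = (\<lambda>v. frechet_derivative w (at x) v + a \<bullet> v)" for x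
      proof -
        have "(h has_derivative (\<lambda>v. frechet_derivative w (at x) v + a \<bullet> v)) (at x)"
          unfolding h_def
          by (intro has_derivative_add smooth_on_has_derivative[OF w(1) UNIV_I]
              bounded_linear_imp_has_derivative bounded_linear_inner_right)
        then show ?thesis by (metis frechet_derivative_at)
      qed
      note dh = this
      have "smooth_hypersurface_in (frontier D) G"
      proof (rule smooth_hypersurface_frontier_superlevel[OF h open_ball[of 0 R]])
        show "closure D \<subseteq> ball 0 R" "closure D \<subseteq> G" using cl S by auto
        show "x \<in> D \<longleftrightarrow> h x > t0 + \<tau>" if "x \<in> ball 0 R" for x
          using that True \<Psi>(1)[of x] by (auto simp: D_def g_def f_def h_def)
        show "\<exists>v. frechet_derivative h (at x) v \<noteq> 0" if "h x = t0 + \<tau>" for x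
          using reg that by (simp add: dh h_def)
      qed
      moreover have "open D" unfolding D_def by (intro open_Collect_less contg continuous_on_const)
      moreover have "compact (closure D)" using bounded_subset[OF compact_imp_bounded[OF S(1)] DS] by simp
      ultimately show ?thesis
        using isoperimetric[of D] cl S(2) True unfolding DG by (simp add: D_def)
    qed simp
  qed
  have "ennreal_powr (\<integral>\<^sup>+x. ennreal (g x powr q) \<partial>lborel) (1 / q)
    \<le> (\<integral>\<^sup>+\<tau>. ennreal_powr (emeasure lborel {x. g x > \<tau>}) (1 / q) * indicator {0<..} \<tau> \<partial>lborel)"
    by (rule nn_integral_powr_le_levels) (use g_nonneg q fin in auto)
  also have "\<dots> \<le> (\<integral>\<^sup>+\<tau>. ennreal (2 * C) * perimeter s G {x \<in> G. g x > \<tau>} \<partial>lborel)"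
    by (rule nn_integral_mono_AE[OF levels])
  \<comment> \<open>The 2 of the isoperimetric constant is exactly the 2 of the coarea
    formula.\<close>
  also have "\<dots> = ennreal C * (2 * (\<integral>\<^sup>+\<tau>. perimeter s G {x \<in> G. g x > \<tau>} \<partial>lborel))"
    using C by (simp add: nn_integral_cmult ennreal_mult mult_ac)
  also have "\<dots> = ennreal C * energy s G g" by (simp add: energy_coarea)
  also have "energy s G g \<le> energy s G f"
    by (rule energy_mono) (auto simp: g_def)
  also have "energy s G f \<le> energy s G w + energy s G (\<lambda>x. a \<bullet> \<Psi> x)"
    unfolding f_def by (rule energy_triangle) measurable
  also have "energy s G (\<lambda>x. a \<bullet> \<Psi> x) \<le> ennreal (norm a) * energy s G \<Psi>"
    by (rule energy_inner_le) measurable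
  finally show ?thesis by (simp add: g_def f_def t0_def mult_left_mono add_left_mono)
qed

text \<open>Let admissible perturbations \<open>a j\<close> tend to 0: the integrands converge
  pointwise to \<open>w\<close>, and the extra energy is \<open>norm (a j)\<close> times the finite
  energy of \<open>\<Psi>\<close>.\<close>

lemma smooth_inequality:
  fixes w :: "real ^ 'm option \<Rightarrow> real"
  assumes w: "smooth_on UNIV w" "\<And>x. 0 \<le> w x" "\<And>x. x \<notin> S \<Longrightarrow> w x = 0" and S: "compact S" "S \<subseteq> G"
  shows "ennreal_powr (\<integral>\<^sup>+x. ennreal (w x powr q) \<partial>lborel) (1 / q) \<le> ennreal C * energy s G w"
proof -
  obtain R where R: "0 < R" "S \<subseteq> ball 0 R"
    using bounded_subset_ballD[OF compact_imp_bounded[OF S(1)], of 0] by blast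
  obtain \<Psi> :: "real ^ 'm option \<Rightarrow> real ^ 'm option" where \<Psi>:
    "\<And>x. norm x < R \<Longrightarrow> \<Psi> x = x" "\<And>x. norm (\<Psi> x) \<le> 2 * R"
    "\<And>x. x \<notin> cball 0 (2 * R) \<Longrightarrow> \<Psi> x = 0" "\<And>x y. norm (\<Psi> x - \<Psi> y) \<le> 3 * norm (x - y)"
    using identity_cutoff_exists[OF R(1)] by blast
  have "3-lipschitz_on UNIV \<Psi>" using \<Psi>(4) by (auto simp: lipschitz_on_def dist_norm)
  then have cont: "continuous_on UNIV \<Psi>" by (rule lipschitz_on_continuous_on)
  have Z: "energy s G \<Psi> < \<infinity>"
    by (rule energy_lipschitz_finite[where S="cball 0 (2 * R)", OF _ _ \<Psi>(4) _ \<Psi>(2,3)])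
       (use s emeasure_bounded_finite[OF bounded_cball] in auto)
  define good where "good a \<longleftrightarrow> (AE t in lborel. \<forall>x. w x + a \<bullet> x = t \<longrightarrow>
      (\<exists>v. frechet_derivative w (at x) v + a \<bullet> v \<noteq> 0))" for a
  have "AE a in lborel. good a" unfolding good_def by (rule AE_regular_value[OF w(1)])
  then have "\<exists>a. norm a < 1 / real (Suc j) \<and> good a" for j by (rule AE_ex_in_ball) simp
  then obtain a where a: "\<And>j. norm (a j) < 1 / real (Suc j)" "\<And>j. good (a j)" by metis
  have a0: "(\<lambda>j. norm (a j)) \<longlonglongrightarrow> 0"
    by (rule tendsto_sandwich[OF _ _ tendsto_const LIMSEQ_inverse_real_of_nat])
       (use a(1) in \<open>auto simp: inverse_eq_divide intro!: always_eventually less_imp_le\<close>)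
  define v where "v j x = max 0 (w x + a j \<bullet> \<Psi> x - norm (a j) * (2 * R))" for j x
  have [measurable]: "w \<in> borel_measurable borel" "\<Psi> \<in> borel_measurable borel"
    by (intro borel_measurable_continuous_onI smooth_on_continuous w(1) cont)+
  show ?thesis
  proof (rule powr_integral_limit_le[where v=v and X="\<lambda>j. ennreal C * (energy s G w + ennreal (norm (a j)) * energy s G \<Psi>)"])
    show "v j \<in> borel_measurable borel" for j unfolding v_def by measurable
    show "0 \<le> v j x" for j x by (simp add: v_def)
    show "AE x in lborel. (\<lambda>j. v j x) \<longlonglongrightarrow> w x"
    proof (intro AE_I2)
      fix x
      have "(\<lambda>j. a j \<bullet> \<Psi> x) \<longlonglongrightarrow> 0 \<bullet> \<Psi> x"
        using a0 by (intro tendsto_inner tendsto_const) (simp add: tendsto_norm_zero_iff)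
      then have "(\<lambda>j. v j x) \<longlonglongrightarrow> max 0 (w x + 0 \<bullet> \<Psi> x - 0 * (2 * R))"
        unfolding v_def using a0 by (intro tendsto_max tendsto_diff tendsto_add tendsto_mult tendsto_const)
      then show "(\<lambda>j. v j x) \<longlonglongrightarrow> w x" using w(2)[of x] by (simp add: max_def)
    qed
    show "ennreal_powr (\<integral>\<^sup>+x. ennreal (v j x powr q) \<partial>lborel) (1 / q)
        \<le> ennreal C * (energy s G w + ennreal (norm (a j)) * energy s G \<Psi>)" for j
      unfolding v_def by (rule perturbed_inequality[OF w(1,3) S R(2,1) \<Psi>(1,2) cont a(2)[unfolded good_def]])
    have "(\<lambda>j. energy s G \<Psi> * ennreal (norm (a j))) \<longlonglongrightarrow> energy s G \<Psi> * ennreal 0"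
      using Z a0 by (intro ennreal_tendsto_cmult tendsto_ennrealI) auto
    then have "(\<lambda>j. energy s G w + ennreal (norm (a j)) * energy s G \<Psi>) \<longlonglongrightarrow> energy s G w + 0"
      by (intro tendsto_add tendsto_const) (simp add: mult.commute)
    then show "(\<lambda>j. ennreal C * (energy s G w + ennreal (norm (a j)) * energy s G \<Psi>)) \<longlonglongrightarrow> ennreal C * energy s G w"
      by (intro ennreal_tendsto_cmult) auto
  qed (use q in auto)
qed

text \<open>For infinite energy there is nothing to show. Otherwise the mollified functions converge
  in L1, and a subsequence converges almost everywhere, as the limit lemma requires.\<close>

lemma bounded_inequality:
  fixes u :: "real ^ 'm option \<Rightarrow> real"
  assumes [measurable]: "u \<in> borel_measurable borel"
    and u: "\<And>x. 0 \<le> u x" "\<And>x. u x \<le> M" "\<And>x. x \<notin> S \<Longrightarrow> u x = 0" and S: "compact S" "S \<subseteq> G"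
  shows "ennreal_powr (\<integral>\<^sup>+x. ennreal (u x powr q) \<partial>lborel) (1 / q) \<le> ennreal C * energy s G u"
proof (cases "energy s G u < \<infinity>")
  case False
  then show ?thesis using C by (simp add: less_top[symmetric] ennreal_mult_top)
next
  case True
  have s': "real DIM(real ^ 'm option) < s" using s by simp
  obtain w R S' where w: "compact S'" "S' \<subseteq> G" "\<forall>j::nat. smooth_on UNIV (w j)" "\<forall>j x. 0 \<le> w j x"
    "\<forall>j x. w j x \<le> M" "\<forall>j x. x \<notin> S' \<longrightarrow> w j x = 0"
    "\<forall>j. energy s G (w j) \<le> energy s G u + R j" "R \<longlonglongrightarrow> 0"
    "energy s G u < \<infinity> \<longrightarrow> (\<lambda>j. \<integral>\<^sup>+x. ennreal \<bar>w j x - u x\<bar> \<partial>lborel) \<longlonglongrightarrow> 0"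
    "\<forall>K D. compact K \<and> open D \<and> K \<subseteq> D \<and> (\<forall>x\<in>D. u x = 1) \<longrightarrow>
       (\<forall>\<^sub>F j in sequentially. \<forall>x\<in>K. w j x = 1)"
    by (rule mollified_approximation[OF s' assms(1) u S open_G]) (assumption, (rule that; assumption))
  have [measurable]: "w j \<in> borel_measurable borel" for j
    by (intro borel_measurable_continuous_onI smooth_on_continuous w(3)[rule_format])
  have int_diff: "integrable lborel (\<lambda>x. w j x - u x)" for j
    by (intro Bochner_Integration.integrable_diff 
        integrable_bounded_compact_support[OF _ w(4,5,6)[rule_format] w(1)]
        integrable_bounded_compact_support[OF _ u S(1)]) auto
  have "(\<lambda>j. \<integral>x. norm (w j x - u x) \<partial>lborel) \<longlonglongrightarrow> 0"
  proof -
    have "(\<integral>x. norm (w j x - u x) \<partial>lborel) = enn2real (\<integral>\<^sup>+x. ennreal \<bar>w j x - u x\<bar> \<partial>lborel)" for j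
      by (subst integral_eq_nn_integral) auto
    moreover have "(\<lambda>j. enn2real (\<integral>\<^sup>+x. ennreal \<bar>w j x - u x\<bar> \<partial>lborel)) \<longlonglongrightarrow> enn2real 0"
      by (rule tendsto_enn2real[OF _ _]) (use w(9)[rule_format, OF True] in auto)
    ultimately show ?thesis by simp
  qed
  from tendsto_L1_AE_subseq[OF int_diff this]
  obtain r where r: "strict_mono r" "AE x in lborel. (\<lambda>j. w (r j) x - u x) \<longlonglongrightarrow> 0" by blast
  show ?thesis
  proof (rule powr_integral_limit_le[where v="\<lambda>j. w (r j)" and X="\<lambda>j. ennreal C * (energy s G u + R (r j))"])
    show "AE x in lborel. (\<lambda>j. w (r j) x) \<longlonglongrightarrow> u x" using r(2) by (simp add: LIM_zero_iff)
    show "ennreal_powr (\<integral>\<^sup>+x. ennreal (w (r j) x powr q) \<partial>lborel) (1 / q) \<le> ennreal C * (energy s G u + R (r j))" for j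
      by (rule order_trans[OF smooth_inequality[OF w(3,4,6)[rule_format] w(1,2)] mult_left_mono[OF w(7)[rule_format]]]) auto
    have "(\<lambda>j. R (r j)) \<longlonglongrightarrow> 0" using LIMSEQ_subseq_LIMSEQ[OF w(8) r(1)] by (simp add: o_def)
    then have "(\<lambda>j. energy s G u + R (r j)) \<longlonglongrightarrow> energy s G u + 0" by (intro tendsto_add tendsto_const)
    then show "(\<lambda>j. ennreal C * (energy s G u + R (r j))) \<longlonglongrightarrow> ennreal C * energy s G u"
      by (intro ennreal_tendsto_cmult) auto
  qed (use w q in auto)
qed

text \<open>Truncation at \<open>j\<close> is 1-Lipschitz in the value, so it does not increase the
  energy and the constant is kept.\<close>

lemma nonneg_inequality:
  fixes u :: "real ^ 'm option \<Rightarrow> real"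
  assumes [measurable]: "u \<in> borel_measurable borel"
    and u: "\<And>x. 0 \<le> u x" "\<And>x. x \<notin> S \<Longrightarrow> u x = 0" and S: "compact S" "S \<subseteq> G"
  shows "ennreal_powr (\<integral>\<^sup>+x. ennreal (u x powr q) \<partial>lborel) (1 / q) \<le> ennreal C * energy s G u"
proof (rule powr_integral_limit_le[where v="\<lambda>j x. min (u x) (real j)" and X="\<lambda>_. ennreal C * energy s G u"])
  show "AE x in lborel. (\<lambda>j. min (u x) (real j)) \<longlonglongrightarrow> u x"
  proof (intro AE_I2 tendsto_eventually)
    fix x
    show "\<forall>\<^sub>F j in sequentially. min (u x) (real j) = u x"
      using eventually_ge_at_top[of "nat \<lceil>u x\<rceil>"] by eventually_elim (simp add: nat_ceiling_le_eq)
  qed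
  show "ennreal_powr (\<integral>\<^sup>+x. ennreal (min (u x) (real j) powr q) \<partial>lborel) (1 / q) \<le> ennreal C * energy s G u" for j
  proof -
    have "ennreal_powr (\<integral>\<^sup>+x. ennreal (min (u x) (real j) powr q) \<partial>lborel) (1 / q)
        \<le> ennreal C * energy s G (\<lambda>x. min (u x) (real j))"
      by (rule bounded_inequality[where M="real j" and S=S]) (use u S in auto)
    also have "\<dots> \<le> ennreal C * energy s G u"
      by (intro mult_left_mono energy_mono) auto
    finally show ?thesis .
  qed
qed (use u q in auto)

end

section \<open>The equivalence\<close>

text \<open>Bridge from Lebesgue to Borel integrals; \<open>v\<close> may be a Borel representative
  of \<open>u\<close>, replaced first in the inner variable and then in the outer one.\<close>

lemma frac_energy_eq_energy:
  fixes u v :: "real ^ 'n \<Rightarrow> real"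
  assumes "AE x in lborel. x \<in> G \<longrightarrow> u x = v x"
  shows "frac_energy \<delta> G u = energy (real CARD('n) + \<delta>) G v"
proof -
  have "(\<integral>\<^sup>+y\<in>G. ennreal (\<bar>u x - u y\<bar> / norm (x - y) powr (real CARD('n) + \<delta>)) \<partial>lborel)
      = (\<integral>\<^sup>+y\<in>G. ennreal (\<bar>u x - v y\<bar> / norm (x - y) powr (real CARD('n) + \<delta>)) \<partial>lborel)" for x
    using assms by (intro nn_integral_cong_AE) (auto elim!: eventually_mono simp: indicator_def)
  then have "frac_energy \<delta> G u = (\<integral>\<^sup>+x\<in>G. (\<integral>\<^sup>+y\<in>G. ennreal (\<bar>u x - v y\<bar> / norm (x - y) powr (real CARD('n) + \<delta>))
        \<partial>lborel) \<partial>lborel)"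
    unfolding frac_energy_def by (simp add: nn_integral_completion)
  also have "\<dots> = energy (real CARD('n) + \<delta>) G v"
    unfolding energy_def using assms
    by (intro nn_integral_cong_AE) (auto elim!: eventually_mono simp: indicator_def)
  finally show ?thesis .
qed

lemma frac_perimeter_eq_perimeter:
  fixes D :: "(real ^ 'n) set"
  shows "frac_perimeter \<delta> D G = perimeter (real CARD('n) + \<delta>) G D"
  unfolding frac_perimeter_def perimeter_def by (simp add: nn_integral_completion)

lemma compact_support_inI:
  assumes "compact S" "S \<subseteq> G" "\<And>x. x \<notin> S \<Longrightarrow> u x = 0"
  shows "compact_support_in G u"
proof -
  have "closure {x \<in> G. u x \<noteq> 0} \<subseteq> S"
    using assms by (intro closure_minimal compact_imp_closed) auto
  then show ?thesis
    using assms(1,2) bounded_subset[OF compact_imp_bounded[OF assms(1)], of "{x \<in> G. u x \<noteq> 0}"]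
      closure_subset[of "{x \<in> G. u x \<noteq> 0}"] by (auto simp: compact_support_in_def)
qed

text \<open>Since \<open>K\<close> has positive distance to the complement of \<open>D\<close>, the
  mollified indicators eventually equal 1 exactly on \<open>K\<close>, so they are admissible
  without a rescaling that would spoil the constant.\<close>

lemma frac_cap_le_perimeter:
  fixes G D K :: "(real ^ 'n) set"
  assumes "open G" "0 < \<delta>" and D: "open D" "compact (closure D)" "closure D \<subseteq> G"
    and K: "compact K" "K \<subseteq> D"
  shows "frac_cap \<delta> K G \<le> 2 * frac_perimeter \<delta> D G"
proof -
  let ?s = "real CARD('n) + \<delta>"
  have [measurable]: "D \<in> sets borel" "G \<in> sets borel" using assms by auto
  have s: "real DIM(real ^ 'n) < ?s" using assms(2) by simp
  have ind: "indicat_real D x = 0" if "x \<notin> closure D" for x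
    using that closure_subset[of D] by (auto simp: indicator_def)
  obtain w R S' where w: "compact S'" "S' \<subseteq> G" "\<forall>j::nat. smooth_on UNIV (w j)" "\<forall>j x. 0 \<le> w j x"
    "\<forall>j x. w j x \<le> 1" "\<forall>j x. x \<notin> S' \<longrightarrow> w j x = 0"
    "\<forall>j. energy ?s G (w j) \<le> energy ?s G (indicat_real D) + R j" "R \<longlonglongrightarrow> 0"
    "energy ?s G (indicat_real D) < \<infinity> \<longrightarrow> (\<lambda>j. \<integral>\<^sup>+x. ennreal \<bar>w j x - indicat_real D x\<bar> \<partial>lborel) \<longlonglongrightarrow> 0"
    "\<forall>K E. compact K \<and> open E \<and> K \<subseteq> E \<and> (\<forall>x\<in>E. indicat_real D x = 1) \<longrightarrow>
       (\<forall>\<^sub>F j in sequentially. \<forall>x\<in>K. w j x = 1)"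
    by (rule mollified_approximation[where u="indicat_real D", OF s _ indicator_pos_le indicator_le_1 ind D(2,3) assms(1)])
       (simp, assumption, (rule that; assumption))
  have "D \<subseteq> G" using D(3) closure_subset[of D] by blast
  then have E: "energy ?s G (indicat_real D) = 2 * frac_perimeter \<delta> D G"
    by (simp add: energy_indicator frac_perimeter_eq_perimeter)
  have "\<forall>\<^sub>F j in sequentially. \<forall>x\<in>K. w j x = 1" using w(10)[rule_format, of K D] K D(1) by simp
  then have "\<forall>\<^sub>F j in sequentially. frac_cap \<delta> K G \<le> 2 * frac_perimeter \<delta> D G + R j"
  proof eventually_elim
    fix j assume j: "\<forall>x\<in>K. w j x = 1"
    have "w j \<in> C0 G"
      using compact_support_inI[OF w(1,2) w(6)[rule_format]] smooth_on_continuous[OF w(3)[rule_format, of j]]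
      by (auto simp: C0_def intro: continuous_on_subset)
    then have "frac_cap \<delta> K G \<le> frac_energy \<delta> G (w j)"
      unfolding frac_cap_def using j by (intro INF_lower) auto
    also have "\<dots> = energy ?s G (w j)" by (rule frac_energy_eq_energy) simp
    also have "\<dots> \<le> 2 * frac_perimeter \<delta> D G + R j" using w(7)[rule_format, of j] by (simp add: E)
    finally show "frac_cap \<delta> K G \<le> 2 * frac_perimeter \<delta> D G + R j" .
  qed
  moreover have "(\<lambda>j. 2 * frac_perimeter \<delta> D G + R j) \<longlonglongrightarrow> 2 * frac_perimeter \<delta> D G + 0"
    by (intro tendsto_add tendsto_const w(8))
  ultimately show ?thesis
    using tendsto_lowerbound[of "\<lambda>j. 2 * frac_perimeter \<delta> D G + R j" "2 * frac_perimeter \<delta> D G" sequentially "frac_cap \<delta> K G"]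
    by simp
qed

lemma (in isoperimetric_domain) frac_inequality:
  fixes u :: "real ^ 'm option \<Rightarrow> real"
  assumes u: "u \<in> borel_measurable (lebesgue_on G)" "compact_support_in G u"
    and \<delta>: "s = real CARD('m option) + \<delta>"
  shows "ennreal_powr (\<integral>\<^sup>+x\<in>G. ennreal (\<bar>u x\<bar> powr q) \<partial>lebesgue) (1 / q) \<le> ennreal C * frac_energy \<delta> G u"
proof -
  define S where "S = closure {x \<in> G. u x \<noteq> 0}"
  have S: "compact S" "S \<subseteq> G" using u(2) by (auto simp: S_def compact_support_in_def)
  have uS: "u x = 0" if "x \<in> G" "x \<notin> S" for x
    using that closure_subset[of "{x \<in> G. u x \<noteq> 0}"] by (auto simp: S_def)
  have "(\<lambda>x. if x \<in> G then u x else 0) \<in> borel_measurable lebesgue"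
    using u(1) by (subst borel_measurable_if) simp_all
  then obtain u' where u'[measurable]: "u' \<in> borel_measurable lborel"
    and ae: "AE x in lborel. (if x \<in> G then u x else 0) = u' x"
    using completion_ex_borel_measurable_real by blast
  have [measurable]: "S \<in> sets borel" using S(1) by (simp add: compact_imp_closed)
  \<comment> \<open>The representative agrees with \<open>u\<close> only almost everywhere;
    multiplication by the indicator of \<open>S\<close> restores vanishing at every point outside
    \<open>S\<close>.\<close>
  define v where "v x = indicator S x * \<bar>u' x\<bar>" for x
  have [measurable]: "v \<in> borel_measurable borel" unfolding v_def by measurable
  have v: "AE x in lborel. x \<in> G \<longrightarrow> \<bar>u x\<bar> = v x"
    using ae by eventually_elim (auto simp: v_def indicator_def uS)
  have "(\<integral>\<^sup>+x\<in>G. ennreal (\<bar>u x\<bar> powr q) \<partial>lebesgue) = (\<integral>\<^sup>+x. ennreal (v x powr q) \<partial>lborel)"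
    unfolding nn_integral_completion
    by (rule nn_integral_cong_AE)
       (use v S(2) in \<open>auto elim!: eventually_mono simp: indicator_def v_def\<close>)
  then have "ennreal_powr (\<integral>\<^sup>+x\<in>G. ennreal (\<bar>u x\<bar> powr q) \<partial>lebesgue) (1 / q)
      = ennreal_powr (\<integral>\<^sup>+x. ennreal (v x powr q) \<partial>lborel) (1 / q)" by simp
  also have "\<dots> \<le> ennreal C * energy s G v"
    by (rule nonneg_inequality[OF _ _ _ S]) (auto simp: v_def)
  also have "energy s G v = frac_energy \<delta> G (\<lambda>x. \<bar>u x\<bar>)"
    unfolding \<delta> by (rule frac_energy_eq_energy[OF v, symmetric])
  also have "frac_energy \<delta> G (\<lambda>x. \<bar>u x\<bar>) \<le> frac_energy \<delta> G u"
    using energy_mono[of G "\<lambda>x. \<bar>u x\<bar>" u "real CARD('m option) + \<delta>"]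
      frac_energy_eq_energy[of G u u \<delta>] frac_energy_eq_energy[of G "\<lambda>x. \<bar>u x\<bar>" "\<lambda>x. \<bar>u x\<bar>" \<delta>]
    by (simp add: abs_triangle_ineq3)
  finally show ?thesis by (simp add: mult_left_mono)
qed

theorem theorem4p1:
  fixes G :: "(real ^ ('m::finite option)) set" and q \<delta> C :: real
  assumes "open G" and "1 \<le> q" and "0 < \<delta>" and "\<delta> < 1" and "0 < C"
  defines "inequality \<equiv>
      (\<forall>u :: real ^ ('m option) \<Rightarrow> real.
         u \<in> borel_measurable (lebesgue_on G) \<and> compact_support_in G u \<longrightarrow>
         ennreal_powr (\<integral>\<^sup>+x\<in>G. ennreal (\<bar>u x\<bar> powr q) \<partial>lebesgue) (1 / q)
           \<le> ennreal C * frac_energy \<delta> G u)"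
    and "isocapacitary \<equiv>
      (\<forall>K. compact K \<and> K \<subseteq> G \<longrightarrow>
         ennreal_powr (emeasure lebesgue K) (1 / q) \<le> ennreal C * frac_cap \<delta> K G)"
    and "isoperimetric \<equiv>
      (\<forall>D. open D \<and> compact (closure D) \<and> closure D \<subseteq> G \<and> smooth_hypersurface_in (frontier D) G \<longrightarrow>
         ennreal_powr (emeasure lebesgue D) (1 / q) \<le> ennreal (2 * C) * frac_perimeter \<delta> D G)"
  shows "(inequality \<longleftrightarrow> isocapacitary) \<and> (isocapacitary \<longleftrightarrow> isoperimetric)"
proof -
  have "isocapacitary" if A: inequality
    unfolding isocapacitary_def
  proof (intro allI impI)
    fix K assume K: "compact K \<and> K \<subseteq> G"
    let ?L = "ennreal_powr (emeasure lebesgue K) (1 / q)"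
    \<comment> \<open>The constant is moved to the left before taking the infimum over test
      functions and moved back afterwards.\<close>
    have cancel: "ennreal C * (ennreal (1 / C) * x) = x" for x
      using assms(5) by (simp add: mult.assoc[symmetric] ennreal_mult[symmetric])
    have "ennreal (1 / C) * ?L \<le> frac_energy \<delta> G u" if u: "u \<in> C0 G" "\<forall>x\<in>K. u x \<ge> 1" for u
    proof -
      have "u \<in> borel_measurable (lebesgue_on G)"
        using u(1) assms(1) by (intro continuous_imp_measurable_on_sets_lebesgue) (auto simp: C0_def)
      then have *: "ennreal_powr (\<integral>\<^sup>+x\<in>G. ennreal (\<bar>u x\<bar> powr q) \<partial>lebesgue) (1 / q) \<le> ennreal C * frac_energy \<delta> G u"
        using A u(1) by (auto simp: inequality_def C0_def)
      have "emeasure lebesgue K = (\<integral>\<^sup>+x. indicator K x \<partial>lebesgue)"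
        using K by (simp add: compact_imp_closed lmeasurable_compact fmeasurableD)
      also have "\<dots> \<le> (\<integral>\<^sup>+x\<in>G. ennreal (\<bar>u x\<bar> powr q) \<partial>lebesgue)"
      proof (rule nn_integral_mono)
        fix x
        show "indicator K x \<le> ennreal (\<bar>u x\<bar> powr q) * indicator G x"
        proof (cases "x \<in> K")
          case True
          then have "1 \<le> \<bar>u x\<bar> powr q" using u(2) assms(2) by (intro ge_one_powr_ge_zero) force+
          then have "ennreal 1 \<le> ennreal (\<bar>u x\<bar> powr q)" by (rule ennreal_leI)
          then show ?thesis using True K by (auto simp: indicator_def)
        qed simp
      qed
      finally have "?L \<le> ennreal C * frac_energy \<delta> G u"
        using assms(2) by (intro order_trans[OF ennreal_powr_mono *]) auto
      then have "ennreal (1 / C) * ?L \<le> ennreal (1 / C) * (ennreal C * frac_energy \<delta> G u)"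
        by (intro mult_left_mono) auto
      then show ?thesis using cancel by (simp add: mult.left_commute)
    qed
    then have "ennreal (1 / C) * ?L \<le> frac_cap \<delta> K G"
      unfolding frac_cap_def by (intro INF_greatest) auto
    then have "ennreal C * (ennreal (1 / C) * ?L) \<le> ennreal C * frac_cap \<delta> K G"
      by (intro mult_left_mono) auto
    then show "?L \<le> ennreal C * frac_cap \<delta> K G" by (simp only: cancel)
  qed
  moreover have "isoperimetric" if B: isocapacitary
    unfolding isoperimetric_def
  proof (intro allI impI)
    fix D assume D: "open D \<and> compact (closure D) \<and> closure D \<subseteq> G \<and> smooth_hypersurface_in (frontier D) G"
    let ?X = "ennreal (2 * C) * frac_perimeter \<delta> D G"
    \<comment> \<open>The capacity estimate reaches only compact subsets of \<open>D\<close>, so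
      \<open>D\<close> is then exhausted from inside with a bound independent of the subset.\<close>
    have le: "ennreal_powr (emeasure lebesgue K) (1 / q) \<le> ?X" if K: "compact K" "K \<subseteq> D" for K
    proof -
      have "K \<subseteq> G" using K D closure_subset[of D] by blast
      then have "ennreal_powr (emeasure lebesgue K) (1 / q) \<le> ennreal C * frac_cap \<delta> K G"
        using B K by (auto simp: isocapacitary_def)
      also have "\<dots> \<le> ennreal C * (2 * frac_perimeter \<delta> D G)"
        using frac_cap_le_perimeter[OF assms(1,3) _ _ _ K] D by (intro mult_left_mono) auto
      also have "\<dots> = ?X" using assms(5) by (simp add: ennreal_mult mult_ac)
      finally show ?thesis .
    qed
    show "ennreal_powr (emeasure lebesgue D) (1 / q) \<le> ?X"
    proof (cases ?X)
      case (real r)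
      have "open D" using D by blast
      then obtain K :: "nat \<Rightarrow> (real ^ 'm option) set" where K: "\<forall>n. compact (K n)" "\<forall>n. K n \<subseteq> D"
        "\<forall>n. K n \<subseteq> interior (K (Suc n))" "\<Union> (range K) = D"
        by (rule open_Union_compact_subsets) (rule that; simp)
      have "incseq K" by (intro incseq_SucI order_trans[OF K(3)[rule_format] interior_subset])
      \<comment> \<open>Continuity of the measure from below, applied to the measure itself, which
        is why the exponent is first moved to the real bound \<open>r\<close>.\<close>
      then have "emeasure lebesgue D = (SUP n. emeasure lebesgue (K n))"
        using K by (subst SUP_emeasure_incseq) (auto simp: lmeasurable_compact fmeasurableD)
      also have "\<dots> \<le> ennreal (r powr q)"
      proof (rule SUP_least)
        fix n
        show "emeasure lebesgue (K n) \<le> ennreal (r powr q)"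
          using le[OF K(1,2)[rule_format]] assms(2) real by (subst ennreal_powr_le_iff[symmetric]) auto
      qed
      finally show ?thesis using assms(2) real by (simp add: ennreal_powr_le_iff)
    qed simp
  qed
  moreover have "inequality" if P: isoperimetric
  proof -
    interpret isoperimetric_domain G q "real CARD('m option) + \<delta>" C
    proof
      fix D :: "(real ^ 'm option) set"
      assume D: "open D" "compact (closure D)" "closure D \<subseteq> G" "smooth_hypersurface_in (frontier D) G"
      then have "ennreal_powr (emeasure lebesgue D) (1 / q) \<le> ennreal (2 * C) * frac_perimeter \<delta> D G"
        using P by (auto simp: isoperimetric_def)
      then show "ennreal_powr (emeasure lborel D) (1 / q) \<le> ennreal (2 * C) * perimeter (real CARD('m option) + \<delta>) G D"
        using D(1) by (simp add: frac_perimeter_eq_perimeter)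
    qed (use assms in auto)
    show ?thesis unfolding inequality_def using frac_inequality by auto
  qed
  ultimately show ?thesis by blast
qed

end
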